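(* Let $w$ be a permutation and let $\mathrm{YR}(w)$ denote the set of Yamanouchi reduced words for $w$. Then \[ \mathfrak{S}_w=\sum_{\rho\in \mathrm{YR}(w)} \kappa_{\mathrm{des}(\rho)} . \]
   Context: Reduced words. For $w\in\mathcal S_n$, $\ell(w)$ is the number of inversions of $w$ and $s_i$ is the simple transposition $(i\ i{+}1)$. A word of positive integers $\rho=(\rho_\ell,\ldots,\rho_1)$ (indices decrease from left to right, so $\rho_\ell$ is the leftmost letter) is a reduced word for $w$ if $\ell=\ell(w)$ and $w=s_{\rho_\ell}\cdots s_{\rho_1}$; $R(w)$ denotes the set of reduced words for $w$. Coxeter–Knuth equivalence. For a word $\rho=(\rho_\ell,\ldots,\rho_1)$ and $1\le j<\ell$, $\mathfrak c_j$ exchanges $\rho_j$ and $\rho_{j+1}$ if $|\rho_j-\rho_{j+1}|>1$ and is the identity otherwise; for $1<j<\ell$, $\mathfrak b_j$ replaces the consecutive letters $\rho_{j+1}\rho_j\rho_{j-1}$ by $\rho_j\rho_{j+1}\rho_j$ if $\rho_{j+1}=\rho_{j-1}$ and is the identity otherwise. For $1<i<\ell$, the elementary Coxeter–Knuth relation $\mathfrak d_i$ is: $\mathfrak d_i(\rho)=\mathfrak b_i(\rho)$ if $\rho_{i+1}=\rho_{i-1}=\rho_i\pm1$; $\mathfrak d_i(\rho)=\mathfrak c_{i-1}(\rho)$ if $\rho_{i-1}>\rho_{i+1}>\rho_i$ or $\rho_{i-1}<\rho_{i+1}<\rho_i$; $\mathfrak d_i(\rho)=\mathfrak c_{i}(\rho)$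 if $\rho_{i+1}>\rho_{i-1}>\rho_i$ or $\rho_{i+1}<\rho_{i-1}<\rho_i$; $\mathfrak d_i(\rho)=\rho$ otherwise. Two reduced words are Coxeter–Knuth equivalent if one is obtained from the other by a finite sequence of the maps $\mathfrak d_i$. Weak descent composition. The run decomposition of a reduced word $\rho$ writes $\rho=\rho^{(k)}\cdots\rho^{(1)}$ as a concatenation of maximal consecutive segments that are strictly increasing from left to right. Let $r_i=\min(\rho^{(i)})$, $\hat r_k=r_k$ and $\hat r_i=\min(r_i,\hat r_{i+1}-1)$ for $i<k$. If $\hat r_1\le 0$, $\rho$ is called virtual and $\mathrm{des}(\rho)=\varnothing$; otherwise $\mathrm{des}(\rho)$ is the weak composition (sequence of nonnegative integers) whose $\hat r_i$-th part is $|\rho^{(i)}|$ for $i=1,\ldots,k$ and all of whose other parts are $0$. For weak compositions, $b\ge a$ means $b_1+\cdots+b_j\ge a_1+\cdots+a_j$ for all $j$. Yamanouchi. A non-virtual reduced word $\rho$ is Yamanouchi if $\mathrm{des}(\sigma)\ge\mathrm{des}(\rho)$ for every non-virtual reduced word $\sigma$ that is Coxeter–Knuth equivalent to $\rho$. Polynomials. $\partial_i f=(f-s_if)/(x_i-x_{i+1})$, where $s_i$ swaps $x_i,x_{i+1}$, and $\pi_i f=\partial_i(x_i f)$. $\mathfrak S_w$ is the Schubert polynomial: $\mathfrak S_{w_0}=x_1^{n-1}x_2^{n-2}\cdots x_{n-1}$ for the longest $w_0\in\mathcal S_n$ and $\mathfrak S_{ws_i}=\partial_i\mathfrak S_w$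 whenever $w(i)>w(i+1)$. $\kappa_a$ is the Demazure character (key polynomial) of the weak composition $a$: $\kappa_a=x_1^{a_1}x_2^{a_2}\cdots$ if $a$ is weakly decreasing, and $\kappa_{s_ia}=\pi_i\kappa_a$ whenever $a_i>a_{i+1}$ (with $s_ia$ swapping parts $i,i+1$).
   Formalization: The product w = s_{ρ_ℓ}⋯s_{ρ_1} is read as successive swaps of positions in one-line notation, rightmost letter first (as functions, w = s_{ρ_1}∘⋯∘s_{ρ_ℓ}), since with ordinary composition the identity fails, e.g. for w = 312. *)

theory Defs
  imports "HOL-Library.Poly_Mapping" "HOL-Combinatorics.Permutations"
begin

text \<open>
  Positions of words, parts of weak compositions and variables are numbered from 1, and
  the symmetric group of degree \<open>n\<close> consists of the functions \<open>w\<close> with \<open>w permutes {1..n}\<close>.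
  A weak composition is a finitely supported function on the naturals, and a polynomial over
  the integers is a finitely supported function on exponent vectors. Index 0 is unused.
\<close>

type_synonym weak_comp = "nat \<Rightarrow>\<^sub>0 nat"
type_synonym zpoly = "(nat \<Rightarrow>\<^sub>0 nat) \<Rightarrow>\<^sub>0 int"

abbreviation simple_transp :: "nat \<Rightarrow> nat \<Rightarrow> nat" where
  "simple_transp i \<equiv> Transposition.transpose i (Suc i)"


section \<open>Reduced words\<close>

text \<open>A finitely supported permutation is a function on all naturals; points outside
  \<open>{1..n}\<close> contribute no inversions.\<close>

definition num_inversions :: "(nat \<Rightarrow> nat) \<Rightarrow> nat" where
  "num_inversions w = card {(i, j). i < j \<and> w j < w i}"

text \<open>
  A word \<open>(\<rho>\<^sub>\<ell>, \<dots>, \<rho>\<^sub>1)\<close> is the list of its letters from left to right. In the product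
  \<open>s\<^bsub>\<rho>\<^sub>\<ell>\<^esub> \<cdots> s\<^bsub>\<rho>\<^sub>1\<^esub>\<close> each \<open>s\<^sub>i\<close> acts on one-line notation by exchanging the entries in positions
  \<open>i\<close> and \<open>i + 1\<close> (just as \<open>s\<^sub>i a\<close> exchanges two parts of a weak composition), starting from
  the identity with the rightmost letter. As a composite of functions the result is
  \<open>s\<^bsub>\<rho>\<^sub>1\<^esub> \<circ> \<cdots> \<circ> s\<^bsub>\<rho>\<^sub>\<ell>\<^esub>\<close>. This convention is forced by the run decomposition below together
  with \<open>\<SS>\<^bsub>w s\<^sub>i\<^esub> = \<partial>\<^sub>i \<SS>\<^sub>w\<close> for \<open>w i > w (i + 1)\<close>: the only reduced word of the permutation
  312, whose Schubert polynomial is \<open>x\<^sub>1\<^sup>2\<close>, has to be the single run \<open>(1, 2)\<close>.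
\<close>

definition word_perm :: "nat list \<Rightarrow> nat \<Rightarrow> nat" where
  "word_perm \<rho> = foldr (\<lambda>i v. v \<circ> simple_transp i) \<rho> id"

definition reduced_words :: "(nat \<Rightarrow> nat) \<Rightarrow> nat list set" where
  "reduced_words w =
     {\<rho>. (\<forall>i \<in> set \<rho>. 1 \<le> i) \<and> length \<rho> = num_inversions w \<and> word_perm \<rho> = w}"

definition reduced_word :: "nat list \<Rightarrow> bool" where
  "reduced_word \<rho> \<longleftrightarrow> \<rho> \<in> reduced_words (word_perm \<rho>)"


section \<open>Coxeter--Knuth equivalence\<close>

text \<open>The letter \<open>\<rho>\<^sub>j\<close>, counted from the right starting with 1.\<close>

definition letter :: "nat list \<Rightarrow> nat \<Rightarrow> nat" where
  "letter \<rho> j = \<rho> ! (length \<rho> - j)"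

definition set_letter :: "nat \<Rightarrow> nat \<Rightarrow> nat list \<Rightarrow> nat list" where
  "set_letter j x \<rho> = \<rho>[length \<rho> - j := x]"

definition ck_c :: "nat \<Rightarrow> nat list \<Rightarrow> nat list" where
  "ck_c j \<rho> =
     (if \<bar>int (letter \<rho> j) - int (letter \<rho> (j + 1))\<bar> > 1
      then set_letter j (letter \<rho> (j + 1)) (set_letter (j + 1) (letter \<rho> j) \<rho>)
      else \<rho>)"

definition ck_b :: "nat \<Rightarrow> nat list \<Rightarrow> nat list" where
  "ck_b j \<rho> =
     (if letter \<rho> (j + 1) = letter \<rho> (j - 1)
      then set_letter (j + 1) (letter \<rho> j)
            (set_letter j (letter \<rho> (j + 1))
              (set_letter (j - 1) (letter \<rho> j) \<rho>))
      else \<rho>)"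

definition ck_d :: "nat \<Rightarrow> nat list \<Rightarrow> nat list" where
  "ck_d i \<rho> =
     (let p = letter \<rho> (i + 1); q = letter \<rho> i; r = letter \<rho> (i - 1) in
      if p = r \<and> (r = q + 1 \<or> q = r + 1) then ck_b i \<rho>
      else if (r > p \<and> p > q) \<or> (r < p \<and> p < q) then ck_c (i - 1) \<rho>
      else if (p > r \<and> r > q) \<or> (p < r \<and> r < q) then ck_c i \<rho>
      else \<rho>)"

text \<open>For \<open>1 < i < length \<rho>\<close>, \<open>ck_d i\<close> is an involution on words of that length,
  so the reflexive transitive closure is symmetric.\<close>

definition ck_equiv :: "nat list \<Rightarrow> nat list \<Rightarrow> bool" where
  "ck_equiv = (\<lambda>\<rho> \<sigma>. \<exists>i. 1 < i \<and> i < length \<rho> \<and> \<sigma> = ck_d i \<rho>)\<^sup>*\<^sup>*"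


section \<open>Weak descent compositions and Yamanouchi words\<close>

text \<open>The lists \<open>runs \<rho> = [\<rho>\<^sup>(\<^sup>k\<^sup>), \<dots>, \<rho>\<^sup>(\<^sup>1\<^sup>)]\<close>, \<open>[r\<^sub>k, \<dots>, r\<^sub>1]\<close> and
  \<open>run_rows \<rho>\<close> (the adjusted minima from index \<open>k\<close> down to 1) are all ordered from left
  to right.\<close>

fun runs :: "nat list \<Rightarrow> nat list list" where
  "runs [] = []"
| "runs [x] = [[x]]"
| "runs (x # y # zs) =
     (if x < y then (x # hd (runs (y # zs))) # tl (runs (y # zs)) else [x] # runs (y # zs))"

fun adjust_minima :: "int list \<Rightarrow> int list" where
  "adjust_minima [] = []"
| "adjust_minima [r] = [r]"
| "adjust_minima (r # r' # rs) = r # adjust_minima (min r' (r - 1) # rs)"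

definition run_rows :: "nat list \<Rightarrow> int list" where
  "run_rows \<rho> = adjust_minima (map (\<lambda>run. int (Min (set run))) (runs \<rho>))"

text \<open>The empty word has no runs; it is not virtual, and its weak descent composition is 0.\<close>

definition virtual :: "nat list \<Rightarrow> bool" where
  "virtual \<rho> \<longleftrightarrow> \<rho> \<noteq> [] \<and> last (run_rows \<rho>) \<le> 0"

text \<open>\<open>None\<close> stands for the value \<open>\<emptyset>\<close> at virtual words. The adjusted minima are
  strictly decreasing, so the summands have disjoint supports.\<close>

definition des :: "nat list \<Rightarrow> weak_comp option" where
  "des \<rho> =
     (if virtual \<rho> then None
      else Some (\<Sum>(r, run) \<leftarrow> zip (run_rows \<rho>) (runs \<rho>).
                   Poly_Mapping.single (nat r) (length run)))"

definition dominates :: "weak_comp \<Rightarrow> weak_comp \<Rightarrow> bool" where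
  "dominates b a \<longleftrightarrow>
     (\<forall>j. (\<Sum>i = 1..j. Poly_Mapping.lookup b i) \<ge> (\<Sum>i = 1..j. Poly_Mapping.lookup a i))"

definition yamanouchi :: "nat list \<Rightarrow> bool" where
  "yamanouchi \<rho> \<longleftrightarrow> reduced_word \<rho> \<and> \<not> virtual \<rho> \<and>
     (\<forall>\<sigma>. reduced_word \<sigma> \<and> \<not> virtual \<sigma> \<and> ck_equiv \<rho> \<sigma> \<longrightarrow>
        dominates (the (des \<sigma>)) (the (des \<rho>)))"

definition YR :: "(nat \<Rightarrow> nat) \<Rightarrow> nat list set" where
  "YR w = {\<rho> \<in> reduced_words w. yamanouchi \<rho>}"


section \<open>Divided differences, Schubert and key polynomials\<close>

definition X :: "nat \<Rightarrow> zpoly" where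
  "X i = Poly_Mapping.single (Poly_Mapping.single i 1) 1"

definition swap_parts :: "nat \<Rightarrow> weak_comp \<Rightarrow> weak_comp" where
  "swap_parts i a = Poly_Mapping.map_key (simple_transp i) a"

definition swap_vars :: "nat \<Rightarrow> zpoly \<Rightarrow> zpoly" where
  "swap_vars i f = Poly_Mapping.map_key (swap_parts i) f"

text \<open>The quotient is unique because \<^typ>\<open>zpoly\<close> is an integral domain.\<close>

definition divdiff :: "nat \<Rightarrow> zpoly \<Rightarrow> zpoly" where
  "divdiff i f = (THE g. (X i - X (Suc i)) * g = f - swap_vars i f)"

definition demazure_op :: "nat \<Rightarrow> zpoly \<Rightarrow> zpoly" where
  "demazure_op i f = divdiff i (X i * f)"

definition longest_perm :: "nat \<Rightarrow> nat \<Rightarrow> nat" where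
  "longest_perm n i = (if i \<in> {1..n} then n + 1 - i else i)"

text \<open>
  Schubert polynomials and key polynomials are the functions determined by the recursions
  below; that the result does not depend on the chosen chain of simple transpositions is the
  classical consequence of the braid relations for \<open>\<partial>\<^sub>i\<close> and \<open>\<pi>\<^sub>i\<close>.
\<close>

inductive schubert_rel :: "nat \<Rightarrow> (nat \<Rightarrow> nat) \<Rightarrow> zpoly \<Rightarrow> bool" for n where
  longest: "schubert_rel n (longest_perm n) (\<Prod>i = 1..n. X i ^ (n - i))"
| step: "\<lbrakk>schubert_rel n w f; 1 \<le> i; i < n; w i > w (Suc i)\<rbrakk>
         \<Longrightarrow> schubert_rel n (w \<circ> simple_transp i) (divdiff i f)"

definition schubert :: "nat \<Rightarrow> (nat \<Rightarrow> nat) \<Rightarrow> zpoly" where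
  "schubert n w = (THE f. schubert_rel n w f)"

inductive key_rel :: "weak_comp \<Rightarrow> zpoly \<Rightarrow> bool" where
  decreasing: "\<lbrakk>Poly_Mapping.lookup a 0 = 0;
                \<forall>i\<ge>1. Poly_Mapping.lookup a (Suc i) \<le> Poly_Mapping.lookup a i\<rbrakk>
               \<Longrightarrow> key_rel a (Poly_Mapping.single a 1)"
| step: "\<lbrakk>key_rel a f; 1 \<le> i; Poly_Mapping.lookup a i > Poly_Mapping.lookup a (Suc i)\<rbrakk>
         \<Longrightarrow> key_rel (swap_parts i a) (demazure_op i f)"

definition key_poly :: "weak_comp \<Rightarrow> zpoly" where
  "key_poly a = (THE f. key_rel a f)"

end

theory Submission
  imports Defs
begin

text \<open>
  By the theorem of Billey, Jockusch and Stanley, \<open>\<SS>\<^sub>w\<close> is the sum of \<open>x\<^sub>i\<close>-monomials over all pairs of a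
  reduced word of \<open>w\<close> and a compatible sequence of indices, each index being at most its letter. Split this
  sum over the Coxeter--Knuth classes. The claim is that each class contributes a key polynomial or 0.

  Relaxing the flag condition so that the letter \<open>p\<close> may carry the index \<open>p + 1\<close> applies the Demazure operator
  \<open>\<pi>\<^sub>p\<close> to the contribution of a class, because row insertion lets one exchange the lengths of two adjacent
  increasing runs inside the class. A Little bump maps a class bijectively onto another one and keeps the
  runs, and so the compatible sequences; it either preserves the flag condition or turns it into
  the relaxed one. As bumps decrease the sum of the letters, repeated bumping ends at a dominant
  permutation, which has a single Coxeter--Knuth class and a single monomial. Hence every contribution
  arises from a monomial by Demazure operators.

  Finally, \<open>a\<close> is the unique dominance-minimal exponent of \<open>\<kappa>\<^sub>a\<close>, with coefficient 1, and \<open>des \<sigma>\<close> is the minimal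
  content among the compatible sequences of \<open>\<sigma>\<close>. So a class with contribution \<open>\<kappa>\<^sub>a\<close> contains exactly one
  Yamanouchi word, whose weak descent composition is \<open>a\<close>, and a class with contribution 0 contains none.
\<close>

abbreviation part :: "weak_comp \<Rightarrow> nat \<Rightarrow> nat" where
  "part \<equiv> Poly_Mapping.lookup"

abbreviation coeff :: "zpoly \<Rightarrow> weak_comp \<Rightarrow> int" where
  "coeff \<equiv> Poly_Mapping.lookup"

abbreviation monom :: "weak_comp \<Rightarrow> zpoly" where
  "monom b \<equiv> Poly_Mapping.single b 1"

abbreviation unit_comp :: "nat \<Rightarrow> weak_comp" where
  "unit_comp i \<equiv> Poly_Mapping.single i 1"

section \<open>Divided differences and Demazure operators\<close>

lemma part_swap_parts [simp]: "part (swap_parts i a) j = part a (simple_transp i j)"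
  unfolding swap_parts_def by (subst map_key.rep_eq) (auto simp: transpose_def inj_def)

lemma swap_parts_swap_parts [simp]: "swap_parts i (swap_parts i a) = a"
  by (rule poly_mapping_eqI) simp

lemma inj_swap_parts: "inj (swap_parts i)"
  by (metis injI swap_parts_swap_parts)

lemma swap_parts_zero [simp]: "swap_parts i 0 = 0"
  by (rule poly_mapping_eqI) simp

lemma swap_parts_add: "swap_parts i (a + b) = swap_parts i a + swap_parts i b"
  by (rule poly_mapping_eqI) (simp add: lookup_add)

lemma swap_parts_single [simp]:
  "swap_parts i (Poly_Mapping.single j c) = Poly_Mapping.single (simple_transp i j) c"
  by (rule poly_mapping_eqI) (auto simp: lookup_single when_def transpose_def)

lemma coeff_swap_vars [simp]: "coeff (swap_vars i f) b = coeff f (swap_parts i b)"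
  unfolding swap_vars_def by (subst map_key.rep_eq) (auto simp: inj_swap_parts)

lemma swap_vars_swap_vars [simp]: "swap_vars i (swap_vars i f) = f"
  by (rule poly_mapping_eqI) simp

lemma swap_vars_single [simp]:
  "swap_vars i (Poly_Mapping.single b c) = Poly_Mapping.single (swap_parts i b) c"
  by (rule poly_mapping_eqI) (auto simp: lookup_single when_def)

lemma swap_vars_one [simp]: "swap_vars i 1 = 1"
  by (metis single_one swap_vars_single swap_parts_zero)

lemma swap_vars_zero [simp]: "swap_vars i 0 = 0"
  by (rule poly_mapping_eqI) simp

lemma swap_vars_add: "swap_vars i (f + g) = swap_vars i f + swap_vars i g"
  by (rule poly_mapping_eqI) (simp add: lookup_add)

lemma swap_vars_diff: "swap_vars i (f - g) = swap_vars i f - swap_vars i g"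
  by (rule poly_mapping_eqI) (simp add: lookup_minus)

lemma swap_vars_sum: "swap_vars i (sum f A) = (\<Sum>x\<in>A. swap_vars i (f x))"
  by (induction A rule: infinite_finite_induct) (auto simp: swap_vars_add)

lemma zpoly_induct [case_names zero single add]:
  assumes "P 0" "\<And>b c. P (Poly_Mapping.single b c)" "\<And>f g. P f \<Longrightarrow> P g \<Longrightarrow> P (f + g)"
  shows "P (f :: zpoly)"
proof (induction f rule: update_induct)
  case const
  show ?case using assms(1) by simp
next
  case (update f a b)
  have "Poly_Mapping.update a b f = f + Poly_Mapping.single a b"
    using update by (intro poly_mapping_eqI) (auto simp: lookup_update lookup_add lookup_single when_def in_keys_iff)
  then show ?case using assms update by simp
qed

lemma swap_vars_mult: "swap_vars i (f * g) = swap_vars i f * swap_vars i g"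
proof (induction f rule: zpoly_induct)
  case (single b c)
  show ?case
    by (induction g rule: zpoly_induct) (auto simp: mult_single swap_parts_add distrib_left swap_vars_add)
qed (auto simp: distrib_right swap_vars_add)

lemma swap_vars_X: "swap_vars i (X j) = X (simple_transp i j)"
  by (simp add: X_def)

lemma X_diff_nonzero: "i \<noteq> j \<Longrightarrow> X i - X j \<noteq> 0"
proof
  assume "i \<noteq> j" "X i - X j = 0"
  then have "coeff (X i) (unit_comp i) = coeff (X j) (unit_comp i)" by simp
  then have "unit_comp j = unit_comp i" by (simp add: X_def lookup_single when_def split: if_splits)
  then have "part (unit_comp j) i = part (unit_comp i) i" by simp
  then show False using \<open>i \<noteq> j\<close> by (simp add: lookup_single)
qed

lemma single_eq_times_X:
  "Poly_Mapping.single (Poly_Mapping.single k n) (1::int) = X k ^ n"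
proof (induction n)
  case (Suc n)
  have "Poly_Mapping.single k (Suc n) = unit_comp k + Poly_Mapping.single k n"
    by (simp flip: single_add)
  then have "monom (Poly_Mapping.single k (Suc n)) = X k * monom (Poly_Mapping.single k n)"
    by (simp only: X_def mult_single) simp
  then show ?case using Suc by simp
qed simp

lemma divdiff_dvd: "(X i - X (Suc i)) dvd (f - swap_vars i f)"
proof -
  let ?D = "\<lambda>f. (X i - X (Suc i)) dvd (f - swap_vars i f)"
  have mult: "?D (f * g)" if "?D f" "?D g" for f g
  proof -
    have "f * g - swap_vars i (f * g) = f * (g - swap_vars i g) + (f - swap_vars i f) * swap_vars i g"
      by (simp add: swap_vars_mult algebra_simps)
    then show ?thesis using that by (auto intro!: dvd_add dvd_mult dvd_mult2)
  qed
  have X: "?D (X j)" for j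
  proof -
    consider "j = i" | "j = Suc i" | "j \<noteq> i" "j \<noteq> Suc i" by blast
    then show ?thesis
    proof cases
      case 2
      have "X (Suc i) - X i = - (X i - X (Suc i))" by simp
      then show ?thesis unfolding 2 swap_vars_X by (metis dvd_minus_iff dvd_refl transpose_apply_second)
    qed (auto simp: swap_vars_X)
  qed
  have Xpow: "?D (X j ^ n)" for j n
    by (induction n) (auto intro: mult X)
  have mon: "?D (monom b)" for b
  proof (induction b rule: update_induct)
    case const
    show ?case by simp
  next
    case (update b k n)
    have "Poly_Mapping.update k n b = Poly_Mapping.single k n + b"
      using update by (intro poly_mapping_eqI) (auto simp: lookup_update lookup_add lookup_single when_def in_keys_iff)
    then have "monom (Poly_Mapping.update k n b) = X k ^ n * monom b"
      by (simp add: mult_single flip: single_eq_times_X)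
    then show ?case using mult[OF Xpow update(3)] by simp
  qed
  show ?thesis
  proof (induction f rule: zpoly_induct)
    case (single b c)
    have "Poly_Mapping.single b c = Poly_Mapping.single 0 c * monom b" by (simp add: mult_single)
    moreover have "?D (Poly_Mapping.single 0 c)" by simp
    ultimately show ?case using mult mon by metis
  next
    case (add f g)
    have "f + g - swap_vars i (f + g) = (f - swap_vars i f) + (g - swap_vars i g)"
      by (simp add: swap_vars_add)
    then show ?case using add by (metis dvd_add)
  qed simp
qed

lemma divdiff_eqI:
  assumes "(X i - X (Suc i)) * g = f - swap_vars i f"
  shows "divdiff i f = g"
  unfolding divdiff_def
proof (rule the_equality)
  fix h assume "(X i - X (Suc i)) * h = f - swap_vars i f"
  then have "(X i - X (Suc i)) * h = (X i - X (Suc i)) * g" using assms by simp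
  then show "h = g" using X_diff_nonzero[of i "Suc i"] by simp
qed (rule assms)

lemma demazure_op_eq:
  "(X i - X (Suc i)) * demazure_op i f = X i * f - X (Suc i) * swap_vars i f"
proof -
  obtain g where g: "X i * f - swap_vars i (X i * f) = (X i - X (Suc i)) * g"
    using divdiff_dvd by blast
  then have "demazure_op i f = g" unfolding demazure_op_def by (intro divdiff_eqI) simp
  then show ?thesis using g by (simp add: swap_vars_mult swap_vars_X)
qed

lemma demazure_op_eqI:
  assumes "(X i - X (Suc i)) * g = X i * f - X (Suc i) * swap_vars i f"
  shows "demazure_op i f = g"
proof -
  have "(X i - X (Suc i)) * demazure_op i f = (X i - X (Suc i)) * g"
    using assms demazure_op_eq[of i f] by simp
  then show ?thesis using X_diff_nonzero[of i "Suc i"] by simp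
qed

lemma demazure_op_symmetric: "swap_vars i f = f \<Longrightarrow> demazure_op i f = f"
  by (rule demazure_op_eqI) (simp add: algebra_simps)

lemma swap_vars_demazure_op: "swap_vars i (demazure_op i f) = demazure_op i f"
proof -
  have "swap_vars i ((X i - X (Suc i)) * demazure_op i f) = swap_vars i (X i * f - X (Suc i) * swap_vars i f)"
    by (simp only: demazure_op_eq)
  then have "(X (Suc i) - X i) * swap_vars i (demazure_op i f) = X (Suc i) * swap_vars i f - X i * f"
    by (simp add: swap_vars_mult swap_vars_diff swap_vars_X)
  then have "(X i - X (Suc i)) * swap_vars i (demazure_op i f) = X i * f - X (Suc i) * swap_vars i f"
    by (simp add: algebra_simps)
  then show ?thesis using demazure_op_eqI by metis
qed

lemma demazure_op_idem: "demazure_op i (demazure_op i f) = demazure_op i f"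
  by (simp add: demazure_op_symmetric swap_vars_demazure_op)

lemma swap_vars_commute:
  assumes "i \<noteq> j" "i \<noteq> Suc j" "j \<noteq> Suc i"
  shows "swap_vars i (swap_vars j f) = swap_vars j (swap_vars i f)"
proof -
  have "swap_parts j (swap_parts i b) = swap_parts i (swap_parts j b)" for b
    using assms by (intro poly_mapping_eqI) (auto simp: transpose_def)
  then show ?thesis by (intro poly_mapping_eqI) simp
qed

lemma swap_vars_braid:
  "swap_vars i (swap_vars (Suc i) (swap_vars i f)) = swap_vars (Suc i) (swap_vars i (swap_vars (Suc i) f))"
proof -
  have "swap_parts i (swap_parts (Suc i) (swap_parts i b)) = swap_parts (Suc i) (swap_parts i (swap_parts (Suc i) b))" for b
    by (intro poly_mapping_eqI) (auto simp: transpose_def)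
  then show ?thesis by (intro poly_mapping_eqI) simp
qed

lemma demazure_op_commute:
  assumes "i \<noteq> j" "i \<noteq> Suc j" "j \<noteq> Suc i"
  shows "demazure_op i (demazure_op j f) = demazure_op j (demazure_op i f)"
proof -
  have *: "(X i - X (Suc i)) * ((X j - X (Suc j)) * demazure_op i (demazure_op j f)) =
      X i * (X j * f - X (Suc j) * swap_vars j f)
      - X (Suc i) * (X j * swap_vars i f - X (Suc j) * swap_vars i (swap_vars j f))"
    if ij: "i \<noteq> j" "i \<noteq> Suc j" "j \<noteq> Suc i" for i j
  proof -
    have D: "(X j - X (Suc j)) * demazure_op j f = X j * f - X (Suc j) * swap_vars j f"
      by (rule demazure_op_eq)
    have "swap_vars i ((X j - X (Suc j)) * demazure_op j f) = swap_vars i (X j * f - X (Suc j) * swap_vars j f)"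
      by (simp only: D)
    then have D': "(X j - X (Suc j)) * swap_vars i (demazure_op j f) = X j * swap_vars i f - X (Suc j) * swap_vars i (swap_vars j f)"
      using ij by (simp add: swap_vars_mult swap_vars_diff swap_vars_X transpose_def)
    have "(X i - X (Suc i)) * ((X j - X (Suc j)) * demazure_op i (demazure_op j f)) =
      (X j - X (Suc j)) * ((X i - X (Suc i)) * demazure_op i (demazure_op j f))" by simp
    also have "\<dots> = X i * ((X j - X (Suc j)) * demazure_op j f) - X (Suc i) * ((X j - X (Suc j)) * swap_vars i (demazure_op j f))"
      unfolding demazure_op_eq[of i] by (simp add: algebra_simps)
    finally show ?thesis unfolding D D' .
  qed
  have "(X i - X (Suc i)) * ((X j - X (Suc j)) * demazure_op i (demazure_op j f)) =
     (X j - X (Suc j)) * ((X i - X (Suc i)) * demazure_op j (demazure_op i f))"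
    unfolding *[OF assms] *[OF assms(1)[symmetric] assms(3,2)] swap_vars_commute[OF assms]
    by (simp add: algebra_simps)
  then show ?thesis using X_diff_nonzero[of i "Suc i"] X_diff_nonzero[of j "Suc j"] by simp
qed

lemma demazure_op_braid:
  "demazure_op i (demazure_op (Suc i) (demazure_op i f)) =
   demazure_op (Suc i) (demazure_op i (demazure_op (Suc i) f))"
proof -
  define j k where "j = Suc i" and "k = Suc (Suc i)"
  have [simp]: "simple_transp i i = j" "simple_transp i j = i" "simple_transp i k = k"
    "simple_transp j i = i" "simple_transp j j = k" "simple_transp j k = j"
    by (auto simp: transpose_def j_def k_def)
  define s t where "s = swap_vars i" and "t = swap_vars j"
  have hom: "s (f * g) = s f * s g" "s (f - g) = s f - s g" "t (f * g) = t f * t g" "t (f - g) = t f - t g" for f g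
    by (auto simp: s_def t_def swap_vars_mult swap_vars_diff)
  have X: "s (X i) = X j" "s (X j) = X i" "s (X k) = X k" "t (X i) = X i" "t (X j) = X k" "t (X k) = X j"
    by (simp_all add: s_def t_def swap_vars_X) (simp_all add: j_def k_def)
  have ss: "s (s f) = f" "t (t f) = f" for f by (auto simp: s_def t_def)
  have br: "s (t (s f)) = t (s (t f))" for f using swap_vars_braid[of i f] by (simp add: s_def t_def j_def)
  have Pi: "(X i - X j) * demazure_op i f = X i * f - X j * s f" for f
    using demazure_op_eq[of i f] by (simp add: s_def j_def)
  have Pj: "(X j - X k) * demazure_op j f = X j * f - X k * t f" for f
    using demazure_op_eq[of j f] by (simp add: t_def j_def k_def)
  define A where "A = X i * X j * (X i * f - X j * s f) - X i * X k * (X i * t f - X k * t (s f))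
     + X j * X k * (X j * s (t f) - X k * s (t (s f)))"
  have 1: "(X i - X j) * (X i - X k) * (X j - X k) * demazure_op i (demazure_op j (demazure_op i f)) = A"
  proof -
    define g where "g = demazure_op i f"
    define h where "h = demazure_op j g"
    have sg: "s g = g" by (simp add: g_def s_def swap_vars_demazure_op)
    have g: "(X i - X j) * g = X i * f - X j * s f" by (simp add: g_def Pi)
    have "t ((X i - X j) * g) = t (X i * f - X j * s f)" by (simp only: g)
    then have tg: "(X i - X k) * t g = X i * t f - X k * t (s f)" by (simp add: hom X)
    then have "s ((X i - X k) * t g) = s (X i * t f - X k * t (s f))" by simp
    then have stg: "(X j - X k) * s (t g) = X j * s (t f) - X k * s (t (s f))" by (simp add: hom X)
    have h: "(X j - X k) * h = X j * g - X k * t g" by (simp add: h_def Pj)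
    have "s ((X j - X k) * h) = s (X j * g - X k * t g)" by (simp only: h)
    then have sh: "(X i - X k) * s h = X i * g - X k * s (t g)" by (simp add: hom X sg)
    have "(X i - X j) * (X i - X k) * (X j - X k) * demazure_op i h =
      (X i - X k) * (X j - X k) * ((X i - X j) * demazure_op i h)" by (simp add: ac_simps)
    also have "\<dots> = X i * (X i - X k) * ((X j - X k) * h) - X j * (X j - X k) * ((X i - X k) * s h)"
      unfolding Pi by (simp add: algebra_simps)
    also have "\<dots> = X i * X j * ((X i - X j) * g) - X i * X k * ((X i - X k) * t g) + X j * X k * ((X j - X k) * s (t g))"
      unfolding h sh by (simp add: algebra_simps)
    finally show ?thesis unfolding g tg stg by (simp add: A_def h_def g_def)
  qed
  have 2: "(X i - X j) * (X i - X k) * (X j - X k) * demazure_op j (demazure_op i (demazure_op j f)) = A"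
  proof -
    define g where "g = demazure_op j f"
    define h where "h = demazure_op i g"
    have tg': "t g = g" by (simp add: g_def t_def swap_vars_demazure_op)
    have g: "(X j - X k) * g = X j * f - X k * t f" by (simp add: g_def Pj)
    have "s ((X j - X k) * g) = s (X j * f - X k * t f)" by (simp only: g)
    then have sg: "(X i - X k) * s g = X i * s f - X k * s (t f)" by (simp add: hom X)
    then have "t ((X i - X k) * s g) = t (X i * s f - X k * s (t f))" by simp
    then have tsg: "(X i - X j) * t (s g) = X i * t (s f) - X j * t (s (t f))" by (simp add: hom X)
    have h: "(X i - X j) * h = X i * g - X j * s g" by (simp add: h_def Pi)
    have "t ((X i - X j) * h) = t (X i * g - X j * s g)" by (simp only: h)
    then have th: "(X i - X k) * t h = X i * g - X k * t (s g)" by (simp add: hom X tg')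
    have "(X i - X j) * (X i - X k) * (X j - X k) * demazure_op j h =
      (X i - X k) * (X i - X j) * ((X j - X k) * demazure_op j h)" by (simp add: ac_simps)
    also have "\<dots> = X j * (X i - X k) * ((X i - X j) * h) - X k * (X i - X j) * ((X i - X k) * t h)"
      unfolding Pj by (simp add: algebra_simps)
    also have "\<dots> = X i * X i * ((X j - X k) * g) - X j * X j * ((X i - X k) * s g) + X k * X k * ((X i - X j) * t (s g))"
      unfolding h th by (simp add: algebra_simps)
    finally show ?thesis unfolding g sg tsg by (simp add: A_def h_def g_def br algebra_simps)
  qed
  have "(X i - X j) * (X i - X k) * (X j - X k) \<noteq> 0"
    using X_diff_nonzero[of i j] X_diff_nonzero[of i k] X_diff_nonzero[of j k] by (simp add: j_def k_def)
  then show ?thesis using 1 2 unfolding j_def by (metis mult_cancel_left)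
qed

section \<open>Key polynomials\<close>

definition num_ascents :: "weak_comp \<Rightarrow> nat" where
  "num_ascents a = card {(i, j). 1 \<le> i \<and> i < j \<and> part a i < part a j}"

lemma num_ascents_swap_parts:
  assumes "1 \<le> i" "part a i < part a (Suc i)"
  shows "num_ascents (swap_parts i a) < num_ascents a"
proof -
  let ?A = "\<lambda>a. {(i, j). 1 \<le> i \<and> i < j \<and> part a i < part a j}"
  let ?t = "simple_transp i"
  have fin: "finite (?A a)"
  proof (rule finite_subset)
    show "?A a \<subseteq> {..Max (Poly_Mapping.keys a)} \<times> Poly_Mapping.keys a"
    proof clarify
      fix i j assume "i < j" "part a i < part a j"
      then have "j \<in> Poly_Mapping.keys a" by (simp add: in_keys_iff)
      moreover from this have "j \<le> Max (Poly_Mapping.keys a)" by simp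
      then have "i \<le> Max (Poly_Mapping.keys a)" using \<open>i < j\<close> by linarith
      ultimately show "i \<in> {..Max (Poly_Mapping.keys a)} \<and> j \<in> Poly_Mapping.keys a" by simp
    qed
  qed simp
  have "map_prod ?t ?t ` ?A (swap_parts i a) \<subseteq> ?A a - {(i, Suc i)}"
    using assms by (auto simp: transpose_def split: if_splits)
  then have "card (map_prod ?t ?t ` ?A (swap_parts i a)) \<le> card (?A a - {(i, Suc i)})"
    using fin by (intro card_mono) auto
  moreover have "inj_on (map_prod ?t ?t) (?A (swap_parts i a))"
    by (intro inj_on_subset[OF prod.inj_map subset_UNIV] bij_is_inj bij_transpose)
  moreover have "card (?A a - {(i, Suc i)}) < card (?A a)"
    using fin assms by (intro psubset_card_mono) auto
  ultimately show ?thesis unfolding num_ascents_def by (simp add: card_image)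
qed

lemma key_relE:
  assumes "key_rel a f"
  obtains (decreasing) "\<forall>i\<ge>1. part a (Suc i) \<le> part a i" "f = monom a"
  | (step) i g where "1 \<le> i" "part a i < part a (Suc i)" "key_rel (swap_parts i a) g" "f = demazure_op i g"
  using assms by (cases rule: key_rel.cases) auto

lemma key_rel_part_0: "key_rel a f \<Longrightarrow> part a 0 = 0"
  by (induction rule: key_rel.induct) (auto simp: transpose_def)

lemma key_rel_stepI:
  assumes "key_rel (swap_parts i a) g" "1 \<le> i" "part a i < part a (Suc i)"
  shows "key_rel a (demazure_op i g)"
  using key_rel.step[OF assms(1,2)] assms(3) by simp

lemma key_rel_exists:
  assumes "part a 0 = 0"
  obtains f where "key_rel a f"
proof -
  have "\<exists>f. key_rel a f"
    using assms
  proof (induction "num_ascents a" arbitrary: a rule: less_induct)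
    case less
    show ?case
    proof (cases "\<forall>i\<ge>1. part a (Suc i) \<le> part a i")
      case True
      then show ?thesis using less.prems by (blast intro: key_rel.decreasing)
    next
      case False
      then obtain i where i: "1 \<le> i" "part a i < part a (Suc i)" by (auto simp: not_le)
      then obtain g where "key_rel (swap_parts i a) g"
        using less.hyps[OF num_ascents_swap_parts[OF i]] less.prems by (auto simp: transpose_def)
      then show ?thesis using key_rel_stepI i by blast
    qed
  qed
  then show ?thesis using that by blast
qed

lemma swap_parts_commute:
  assumes "i \<noteq> j" "i \<noteq> Suc j" "j \<noteq> Suc i"
  shows "swap_parts i (swap_parts j a) = swap_parts j (swap_parts i a)"
  using assms by (intro poly_mapping_eqI) (auto simp: transpose_def)

lemma swap_parts_braid:
  "swap_parts i (swap_parts (Suc i) (swap_parts i a)) = swap_parts (Suc i) (swap_parts i (swap_parts (Suc i) a))"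
  by (intro poly_mapping_eqI) (auto simp: transpose_def)

lemma key_rel_far:
  assumes "1 \<le> i" "1 \<le> j" "i \<noteq> j" "i \<noteq> Suc j" "j \<noteq> Suc i"
    and "part a i < part a (Suc i)" "part a j < part a (Suc j)" "part a 0 = 0"
  obtains h where "key_rel (swap_parts i a) (demazure_op j h)"
    "key_rel (swap_parts j a) (demazure_op i h)"
proof -
  obtain h where h: "key_rel (swap_parts j (swap_parts i a)) h"
    using key_rel_exists[of "swap_parts j (swap_parts i a)"] assms by (auto simp: transpose_def)
  show ?thesis
  proof (rule that)
    show "key_rel (swap_parts i a) (demazure_op j h)"
      using h assms by (intro key_rel_stepI) (auto simp: transpose_def)
    have "swap_parts i (swap_parts j a) = swap_parts j (swap_parts i a)"
      using assms by (intro swap_parts_commute)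
    then show "key_rel (swap_parts j a) (demazure_op i h)"
      using h assms by (intro key_rel_stepI) (auto simp: transpose_def)
  qed
qed

lemma key_rel_near:
  assumes "1 \<le> i" "part a i < part a (Suc i)" "part a (Suc i) < part a (Suc (Suc i))" "part a 0 = 0"
  obtains h where "key_rel (swap_parts i a) (demazure_op (Suc i) (demazure_op i h))"
    "key_rel (swap_parts (Suc i) a) (demazure_op i (demazure_op (Suc i) h))"
proof -
  let ?b = "swap_parts i (swap_parts (Suc i) (swap_parts i a))"
  obtain h where h: "key_rel ?b h"
    using key_rel_exists[of ?b] assms by (auto simp: transpose_def)
  show ?thesis
  proof (rule that)
    show "key_rel (swap_parts i a) (demazure_op (Suc i) (demazure_op i h))"
      using h assms by (intro key_rel_stepI) (auto simp: transpose_def)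
    show "key_rel (swap_parts (Suc i) a) (demazure_op i (demazure_op (Suc i) h))"
      using h assms unfolding swap_parts_braid by (intro key_rel_stepI) (auto simp: transpose_def)
  qed
qed

lemma key_rel_unique:
  assumes "key_rel a f" "key_rel a g"
  shows "f = g"
  using assms
proof (induction "num_ascents a" arbitrary: a f g rule: less_induct)
  case less
  note IH = less.hyps[OF num_ascents_swap_parts]
  have a0: "part a 0 = 0" using less.prems key_rel_part_0 by blast
  from less.prems(1) show ?case
  proof (cases rule: key_relE)
    case decreasing
    from less.prems(2) show ?thesis
      by (cases rule: key_relE) (use decreasing in \<open>auto simp: not_le[symmetric]\<close>)
  next
    case (step i f')
    from less.prems(2) show ?thesis
    proof (cases rule: key_relE)
      case decreasing
      then show ?thesis using step by (auto simp: not_le[symmetric])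
    next
      case step': (step j g')
      have near: "demazure_op i u = demazure_op (Suc i) v"
        if asc: "1 \<le> i" "part a i < part a (Suc i)" "part a (Suc i) < part a (Suc (Suc i))" and uv:
          "key_rel (swap_parts i a) u" "key_rel (swap_parts (Suc i) a) v" for i u v
      proof -
        obtain h where h: "key_rel (swap_parts i a) (demazure_op (Suc i) (demazure_op i h))"
          "key_rel (swap_parts (Suc i) a) (demazure_op i (demazure_op (Suc i) h))"
          using key_rel_near[OF asc a0] by blast
        then have "u = demazure_op (Suc i) (demazure_op i h)" "v = demazure_op i (demazure_op (Suc i) h)"
          using IH[OF asc(1,2)] IH[OF _ asc(3)] uv by auto
        then show ?thesis by (simp add: demazure_op_braid)
      qed
      consider "i = j" | "j = Suc i" | "i = Suc j" | "i \<noteq> j" "i \<noteq> Suc j" "j \<noteq> Suc i" by blast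
      then show ?thesis
      proof cases
        case 1
        then show ?thesis using step step' IH by blast
      next
        case 2
        then show ?thesis using near[of i f' g'] step step' by simp
      next
        case 3
        then show ?thesis using near[of j g' f'] step step' by simp
      next
        case 4
        then obtain h where h: "key_rel (swap_parts i a) (demazure_op j h)" "key_rel (swap_parts j a) (demazure_op i h)"
          using key_rel_far step step' a0 by metis
        then have "f' = demazure_op j h" "g' = demazure_op i h" using IH step step' by blast+
        then show ?thesis using 4 step step' demazure_op_commute by metis
      qed
    qed
  qed
qed

lemma key_poly_eqI: "key_rel a f \<Longrightarrow> key_poly a = f"
  unfolding key_poly_def using key_rel_unique by blast

lemma demazure_op_key_eq_parts:
  assumes "key_rel a f" "1 \<le> i" "part a i = part a (Suc i)"
  shows "demazure_op i f = f"
  using assms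
proof (induction "num_ascents a" arbitrary: a f i rule: less_induct)
  case less
  have a0: "part a 0 = 0" using less.prems key_rel_part_0 by blast
  from less.prems(1) show ?case
  proof (cases rule: key_relE)
    case decreasing
    have "swap_parts i a = a" using less.prems by (intro poly_mapping_eqI) (auto simp: transpose_def)
    then show ?thesis using decreasing by (intro demazure_op_symmetric) simp
  next
    case (step j g)
    have dec: "num_ascents (swap_parts j a) < num_ascents a" using step num_ascents_swap_parts by blast
    have "i \<noteq> j" using step less.prems by auto
    then consider "j = Suc i" | "i = Suc j" | "i \<noteq> Suc j" "j \<noteq> Suc i" by blast
    then show ?thesis
    proof cases
      case 1
      let ?b = "swap_parts i (swap_parts j a)"
      obtain h where h: "key_rel ?b h"
        using key_rel_exists[of ?b] a0 less.prems 1 by (auto simp: transpose_def)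
      have "key_rel (swap_parts j a) (demazure_op i h)"
        using h step 1 less.prems by (intro key_rel_stepI) (auto simp: transpose_def)
      then have g: "g = demazure_op i h" using step key_rel_unique by blast
      have "num_ascents ?b < num_ascents a"
        using dec num_ascents_swap_parts[of i "swap_parts j a"] step 1 less.prems by (auto simp: transpose_def)
      then have "demazure_op j h = h"
        using less.hyps[of ?b h j] h step 1 less.prems by (auto simp: transpose_def)
      then show ?thesis unfolding step(4) g 1 by (simp add: demazure_op_braid)
    next
      case 2
      let ?b = "swap_parts i (swap_parts j a)"
      obtain h where h: "key_rel ?b h"
        using key_rel_exists[of ?b] a0 less.prems step 2 by (auto simp: transpose_def)
      have "key_rel (swap_parts j a) (demazure_op i h)"
        using h step 2 less.prems by (intro key_rel_stepI) (auto simp: transpose_def)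
      then have g: "g = demazure_op i h" using step key_rel_unique by blast
      have "num_ascents ?b < num_ascents a"
        using dec num_ascents_swap_parts[of i "swap_parts j a"] step 2 less.prems by (auto simp: transpose_def)
      then have "demazure_op j h = h"
        using less.hyps[of ?b h j] h step 2 less.prems by (auto simp: transpose_def)
      then show ?thesis unfolding step(4) g 2 by (metis demazure_op_braid)
    next
      case 3
      have "demazure_op i g = g"
        using less.hyps[OF dec step(3) less.prems(2)] less.prems 3 \<open>i \<noteq> j\<close> by (auto simp: transpose_def)
      then show ?thesis using step 3 \<open>i \<noteq> j\<close> demazure_op_commute by metis
    qed
  qed
qed

lemma demazure_op_key_le_parts:
  assumes "key_rel a f" "1 \<le> i" "part a i \<le> part a (Suc i)"
  shows "demazure_op i f = f"
proof (cases "part a i = part a (Suc i)")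
  case False
  then have lt: "part a i < part a (Suc i)" using assms by simp
  then obtain g where "key_rel (swap_parts i a) g"
    using key_rel_exists[of "swap_parts i a"] key_rel_part_0[OF assms(1)] assms by (auto simp: transpose_def)
  then have "f = demazure_op i g" using key_rel_stepI key_rel_unique assms lt by blast
  then show ?thesis by (simp add: demazure_op_idem)
qed (use assms demazure_op_key_eq_parts in blast)

section \<open>The minimal monomial of a key polynomial\<close>

lemma coeff_X_mult: "coeff (X j * f) (b + unit_comp j) = coeff f b"
proof (induction f rule: zpoly_induct)
  case (single c k)
  have "unit_comp j + c = b + unit_comp j \<longleftrightarrow> c = b" by (simp only: add.commute[of b] add_left_cancel)
  then show ?case by (simp add: X_def mult_single lookup_single when_def)
qed (auto simp: distrib_left lookup_add)

lemma coeff_X_mult_0: "part b j = 0 \<Longrightarrow> coeff (X j * f) b = 0"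
proof (induction f rule: zpoly_induct)
  case (single c k)
  then have "unit_comp j + c \<noteq> b" by (auto simp: lookup_add)
  then show ?case by (auto simp: X_def mult_single lookup_single when_def)
qed (auto simp: distrib_left lookup_add)

text \<open>Dominance of the exponents of \<open>\<kappa>\<^sub>a\<close> over \<open>a\<close> is not inductive under the Demazure operators;
  comparing the sums over all sets in this family is. The sets \<open>{1..j}\<close> belong to it.\<close>

definition admissible :: "weak_comp \<Rightarrow> nat set \<Rightarrow> bool" where
  "admissible a S \<longleftrightarrow> finite S \<and> (\<forall>i j. 1 \<le> i \<and> i \<notin> S \<and> j \<in> S \<and> i < j \<longrightarrow> part a j \<le> part a i)"

definition key_like :: "zpoly \<Rightarrow> weak_comp \<Rightarrow> bool" where
  "key_like f a \<longleftrightarrow> key_rel a f \<and> coeff f a = 1 \<and>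
     (\<forall>b S. coeff f b \<noteq> 0 \<longrightarrow> admissible a S \<longrightarrow> sum (part a) S \<le> sum (part b) S)"

lemma key_like_monom:
  assumes "part a 0 = 0" "\<forall>i\<ge>1. part a (Suc i) \<le> part a i"
  shows "key_like (monom a) a"
  unfolding key_like_def using assms by (auto simp: lookup_single when_def intro: key_rel.decreasing)

lemma key_like_demazure_op:
  assumes f: "key_like f a" and p: "1 \<le> p"
    and g: "g = demazure_op p f" "g = f + X (Suc p) * h"
    and sym: "swap_vars p h = h"
    and nonneg: "\<And>b. 0 \<le> coeff f b" "\<And>b. 0 \<le> coeff h b"
  shows "\<exists>a'. key_like g a'"
proof (cases "part a p \<le> part a (Suc p)")
  case True
  then show ?thesis using f p demazure_op_key_le_parts unfolding key_like_def g(1) by metis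
next
  case False
  then have lt: "part a (Suc p) < part a p" by simp
  define line where "line b t \<longleftrightarrow> (\<forall>j. j \<noteq> p \<longrightarrow> j \<noteq> Suc p \<longrightarrow> part t j = part b j) \<and>
    part t p + part t (Suc p) = part b p + part b (Suc p)" for b t
  have symg: "coeff g (swap_parts p b) = coeff g b" for b
    using swap_vars_demazure_op[of p f] unfolding g(1) by (metis coeff_swap_vars)
  have symh: "coeff h (swap_parts p b) = coeff h b" for b
    using sym by (metis coeff_swap_vars)
  have nnX: "0 \<le> coeff (X (Suc p) * h) b" for b
  proof (cases "part b (Suc p) = 0")
    case False
    then have "b = (b - unit_comp (Suc p)) + unit_comp (Suc p)"
      by (intro poly_mapping_eqI) (auto simp: lookup_add lookup_minus lookup_single when_def)
    then show ?thesis using coeff_X_mult nonneg(2) by metis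
  qed (simp add: coeff_X_mult_0)
  have shift: "\<exists>b'. coeff g b' \<noteq> 0 \<and> line b b' \<and> part b' p = Suc (part b p) \<and> Suc (part b' (Suc p)) = part b (Suc p)"
    if "coeff (X (Suc p) * h) b \<noteq> 0" for b
  proof -
    have "part b (Suc p) \<noteq> 0" using that coeff_X_mult_0 by blast
    define m where "m = b - unit_comp (Suc p)"
    have b: "b = m + unit_comp (Suc p)" unfolding m_def using \<open>part b (Suc p) \<noteq> 0\<close>
      by (intro poly_mapping_eqI) (auto simp: lookup_add lookup_minus lookup_single when_def)
    let ?c = "swap_parts p m + unit_comp (Suc p)"
    have "coeff (X (Suc p) * h) ?c \<noteq> 0" using that symh[of m] unfolding b coeff_X_mult by simp
    then have "coeff g ?c \<noteq> 0" using nnX[of ?c] nonneg(1)[of ?c] unfolding g(2) lookup_add by linarith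
    then have "coeff g (swap_parts p ?c) \<noteq> 0" using symg by simp
    moreover have "part (swap_parts p ?c) j = part (m + unit_comp p) j" for j
      by (auto simp: lookup_add lookup_single when_def transpose_def)
    ultimately show ?thesis unfolding b line_def
      by (intro exI[of _ "swap_parts p ?c"]) (auto simp: lookup_add lookup_single when_def transpose_def)
  qed
  have top: "\<exists>t. coeff f t \<noteq> 0 \<and> line b t \<and> part b p \<le> part t p \<and> part b (Suc p) \<le> part t p"
    if "coeff g b \<noteq> 0" for b
  proof -
    have *: "\<exists>t. coeff f t \<noteq> 0 \<and> line b t \<and> part b p \<le> part t p"
      if "coeff g b \<noteq> 0" for b
      using that
    proof (induction "part b (Suc p)" arbitrary: b)
      case 0
      then have "coeff f b \<noteq> 0" using coeff_X_mult_0[of b "Suc p"] unfolding g(2) by (simp add: lookup_add)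
      then show ?case by (auto simp: line_def)
    next
      case (Suc k)
      show ?case
      proof (cases "coeff f b = 0")
        case True
        then have "coeff (X (Suc p) * h) b \<noteq> 0" using Suc.prems unfolding g(2) by (simp add: lookup_add)
        then obtain b' where b': "coeff g b' \<noteq> 0" "line b b'" "part b' p = Suc (part b p)" "Suc (part b' (Suc p)) = part b (Suc p)"
          using shift by blast
        then obtain t where "coeff f t \<noteq> 0" "line b' t" "part b' p \<le> part t p"
          using Suc.hyps(1)[of b'] Suc.hyps(2) by auto
        then show ?thesis using b' by (intro exI[of _ t]) (auto simp: line_def)
      qed (auto simp: line_def)
    qed
    show ?thesis
    proof (cases "part b (Suc p) \<le> part b p")
      case True
      then show ?thesis using *[OF that] by auto
    next
      case False
      have "coeff g (swap_parts p b) \<noteq> 0" using that symg by simp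
      from *[OF this] obtain t where t: "coeff f t \<noteq> 0" "line (swap_parts p b) t" "part b (Suc p) \<le> part t p"
        by auto
      have "line b t" using t(2) by (auto simp: line_def transpose_def)
      then show ?thesis using t False by (intro exI[of _ t]) auto
    qed
  qed
  have fa: "key_rel a f" "coeff f a = 1" and dom: "\<And>b S. coeff f b \<noteq> 0 \<Longrightarrow> admissible a S \<Longrightarrow> sum (part a) S \<le> sum (part b) S"
    using f by (auto simp: key_like_def)
  let ?a = "swap_parts p a"
  have "key_like g ?a"
    unfolding key_like_def
  proof (intro conjI allI impI)
    show "key_rel ?a g" unfolding g(1) using key_rel.step[OF fa(1) p lt] .
    have "coeff (X (Suc p) * h) a = 0"
    proof (rule ccontr)
      assume "coeff (X (Suc p) * h) a \<noteq> 0"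
      then obtain b' where b': "coeff g b' \<noteq> 0" "line a b'" "part b' p = Suc (part a p)"
        using shift by blast
      then obtain t where t: "coeff f t \<noteq> 0" "line b' t" "part b' p \<le> part t p" using top by blast
      let ?S = "insert (Suc p) {1..<p}"
      have "admissible a ?S"
        unfolding admissible_def
      proof (intro conjI allI impI)
        fix i j assume "1 \<le> i \<and> i \<notin> ?S \<and> j \<in> ?S \<and> i < j"
        then have "i = p" "j = Suc p" by auto
        then show "part a j \<le> part a i" using lt by simp
      qed simp
      then have "sum (part a) ?S \<le> sum (part t) ?S" using dom t by blast
      moreover have "sum (part a) {1..<p} = sum (part t) {1..<p}"
        using t b' by (intro sum.cong) (auto simp: line_def)
      ultimately have "part a (Suc p) \<le> part t (Suc p)" by simp
      then show False using t b' by (auto simp: line_def)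
    qed
    then show "coeff g ?a = 1" using fa symg unfolding g(2) by (simp add: lookup_add)
    fix b S assume b: "coeff g b \<noteq> 0" and S: "admissible ?a S"
    obtain t where t: "coeff f t \<noteq> 0" "line b t" "part b p \<le> part t p" "part b (Suc p) \<le> part t p"
      using top[OF b] by blast
    have fin: "finite S" using S by (simp add: admissible_def)
    have adm: "part ?a j \<le> part ?a i" if "1 \<le> i" "i \<notin> S" "j \<in> S" "i < j" for i j
      using S that unfolding admissible_def by blast
    have not: "\<not> (p \<notin> S \<and> Suc p \<in> S)" using S lt p by (force simp: admissible_def transpose_def)
    define R where "R = S - {p, Suc p}"
    have R: "finite R" "p \<notin> R" "Suc p \<notin> R" using fin by (auto simp: R_def)
    have Req: "sum (part ?a) R = sum (part a) R" "sum (part t) R = sum (part b) R"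
      using t R by (auto intro!: sum.cong simp: transpose_def line_def)
    consider "S = R" | "S = insert p (insert (Suc p) R)" | "S = insert p R"
      using not unfolding R_def by blast
    then show "sum (part ?a) S \<le> sum (part b) S"
    proof cases
      case 1
      have "admissible a S" unfolding admissible_def
      proof (intro conjI allI impI fin)
        fix i j assume ij: "1 \<le> i \<and> i \<notin> S \<and> j \<in> S \<and> i < j"
        then have j: "part ?a j = part a j" using R 1 by (auto simp: transpose_def)
        show "part a j \<le> part a i"
        proof (cases "i = p \<or> i = Suc p")
          case True
          then have "Suc p < j" using ij R 1 by (metis Suc_lessI not_less_eq less_antisym)
          moreover have "p \<notin> S" "Suc p \<notin> S" "1 \<le> Suc p" "p < j" using 1 R \<open>Suc p < j\<close> by auto
          ultimately have "part ?a j \<le> part ?a p" "part ?a j \<le> part ?a (Suc p)"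
            using adm ij p by blast+
          then show ?thesis using j True by auto
        next
          case False
          then have "part ?a i = part a i" by (auto simp: transpose_def)
          then show ?thesis using adm ij j by metis
        qed
      qed
      then show ?thesis using dom[OF t(1)] 1 Req by metis
    next
      case 2
      have "admissible a S" unfolding admissible_def
      proof (intro conjI allI impI fin)
        fix i j assume ij: "1 \<le> i \<and> i \<notin> S \<and> j \<in> S \<and> i < j"
        then have i: "part ?a i = part a i" using 2 by (auto simp: transpose_def)
        show "part a j \<le> part a i"
        proof (cases "j = p \<or> j = Suc p")
          case True
          then have "i < p" using ij 2 by (auto simp: less_Suc_eq)
          moreover have "p \<in> S" "Suc p \<in> S" "i < Suc p" using 2 \<open>i < p\<close> by auto
          ultimately have "part ?a p \<le> part ?a i" "part ?a (Suc p) \<le> part ?a i"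
            using adm ij by blast+
          then show ?thesis using i True by auto
        next
          case False
          then have "part ?a j = part a j" by (auto simp: transpose_def)
          then show ?thesis using adm ij i by metis
        qed
      qed
      then have "sum (part a) S \<le> sum (part t) S" using dom t by blast
      then show ?thesis using 2 R Req t by (simp add: line_def)
    next
      case 3
      let ?S = "insert (Suc p) R"
      have "admissible a ?S" unfolding admissible_def
      proof (intro conjI allI impI)
        show "finite ?S" using R by simp
        fix i j assume ij: "1 \<le> i \<and> i \<notin> ?S \<and> j \<in> ?S \<and> i < j"
        have "j \<noteq> p" using ij R by auto
        show "part a j \<le> part a i"
        proof (cases "i = p")
          case True
          show ?thesis
          proof (cases "j = Suc p")
            case False
            then have "Suc p \<notin> S" "j \<in> S" "Suc p < j" using ij 3 True R by auto
            then have "part ?a j \<le> part ?a (Suc p)" using adm[of "Suc p" j] by simp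
            then show ?thesis using True False ij by (auto simp: transpose_def split: if_splits)
          qed (use True lt in simp)
        next
          case False
          then have i: "i \<notin> S" "part ?a i = part a i" using ij 3 by (auto simp: transpose_def)
          show ?thesis
          proof (cases "j = Suc p")
            case True
            then have "p \<in> S" "i < p" using ij 3 False by auto
            then have "part ?a p \<le> part ?a i" using adm ij i by blast
            then show ?thesis using i True by simp
          next
            case False
            then have "j \<in> S" "part ?a j = part a j" using ij 3 \<open>j \<noteq> p\<close> by (auto simp: transpose_def)
            then show ?thesis using adm ij i by metis
          qed
        qed
      qed
      then have "sum (part a) ?S \<le> sum (part t) ?S" using dom t by blast
      then have "part a (Suc p) + sum (part a) R \<le> part t (Suc p) + sum (part t) R" using R by simp
      moreover have "part t (Suc p) \<le> part b p" using t by (auto simp: line_def)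
      ultimately show ?thesis using 3 R Req by simp
    qed
  qed
  then show ?thesis by blast
qed

lemma key_like_sum_le:
  assumes "key_like f a" "coeff f b \<noteq> 0"
  shows "(\<Sum>i = 1..j. part a i) \<le> (\<Sum>i = 1..j. part b i)"
proof -
  have "admissible a {1..j}" by (auto simp: admissible_def)
  then show ?thesis using assms by (auto simp: key_like_def)
qed

section \<open>Words and inversions\<close>

lemma word_perm_Nil [simp]: "word_perm [] = id"
  by (simp add: word_perm_def)

lemma word_perm_Cons: "word_perm (a # xs) = word_perm xs \<circ> simple_transp a"
  by (simp add: word_perm_def)

lemma word_perm_append: "word_perm (xs @ ys) = word_perm ys \<circ> word_perm xs"
  by (induction xs) (auto simp: word_perm_Cons)

lemma word_perm_rev_apply: "word_perm (rev xs) (word_perm xs i) = i"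
  by (induction xs arbitrary: i) (auto simp: word_perm_Cons word_perm_append)

lemma word_perm_apply_rev: "word_perm xs (word_perm (rev xs) i) = i"
  using word_perm_rev_apply[of "rev xs"] by simp

lemma bij_word_perm: "bij (word_perm xs)"
  by (rule bij_betw_byWitness[of _ "word_perm (rev xs)"])
    (auto simp: word_perm_rev_apply word_perm_apply_rev)

lemma word_perm_eq_iff [simp]: "word_perm xs i = word_perm xs j \<longleftrightarrow> i = j"
  by (metis word_perm_rev_apply)

lemma word_perm_rev_eq_iff: "word_perm (rev xs) i = j \<longleftrightarrow> word_perm xs j = i"
  by (metis word_perm_rev_apply word_perm_apply_rev)

lemma word_perm_permutes:
  assumes "set xs \<subseteq> {a..<n}"
  shows "word_perm xs permutes {a..n}"
  using assms
proof (induction xs)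
  case (Cons x xs)
  then show ?case unfolding word_perm_Cons
    by (intro permutes_compose permutes_swap_id) auto
qed (simp add: permutes_id)

definition inversions :: "(nat \<Rightarrow> nat) \<Rightarrow> (nat \<times> nat) set" where
  "inversions w = {(i, j). i < j \<and> w j < w i}"

lemma num_inversions_inversions: "num_inversions w = card (inversions w)"
  by (simp add: num_inversions_def inversions_def)

lemma finite_inversions:
  assumes "w permutes {a..n}"
  shows "finite (inversions w)"
proof (rule finite_subset)
  show "inversions w \<subseteq> {..n} \<times> {..n}"
  proof clarify
    fix i j assume "(i, j) \<in> inversions w"
    then have ij: "i < j" "w j < w i" by (auto simp: inversions_def)
    have "j \<le> n"
    proof (rule ccontr)
      assume "\<not> j \<le> n"
      then have "w j = j" using assms by (auto simp: permutes_def)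
      then have "w i \<notin> {a..n}" using ij \<open>\<not> j \<le> n\<close> by auto
      then have "i \<notin> {a..n}" using assms by (meson permutes_in_image)
      then show False using ij \<open>w j = j\<close> assms by (auto simp: permutes_def)
    qed
    then show "i \<in> {..n} \<and> j \<in> {..n}" using ij by auto
  qed
qed simp

lemma finite_inversions_word_perm: "finite (inversions (word_perm xs))"
proof -
  have "set xs \<subseteq> {0..<Suc (Max (set xs))}" by (auto simp: less_Suc_eq_le)
  then show ?thesis using word_perm_permutes finite_inversions by blast
qed

context
  fixes w :: "nat \<Rightarrow> nat" and i j :: nat
  assumes fin: "finite (inversions w)" "finite (inversions (w \<circ> Transposition.transpose i j))"
    and ij: "i < j" "w i < w j"
begin

private abbreviation "t \<equiv> Transposition.transpose i j"

private definition "shift = (\<lambda>(a, b). if t a < t b then (t a, t b) else (a, b))"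

private lemma shift_image: "shift ` inversions w \<subseteq> inversions (w \<circ> t) - {(i, j)}"
  using ij by (auto simp: shift_def inversions_def transpose_def split: if_splits)

private lemma inj_shift: "inj_on shift (inversions w)"
  by (rule inj_onI) (auto simp: shift_def inversions_def transpose_def split: if_splits)

lemma num_inversions_transpose_gt: "num_inversions w < num_inversions (w \<circ> t)"
proof -
  have "card (inversions w) \<le> card (inversions (w \<circ> t) - {(i, j)})"
    using card_inj_on_le[OF inj_shift shift_image] fin by simp
  moreover have "(i, j) \<in> inversions (w \<circ> t)" using ij by (auto simp: inversions_def)
  ultimately show ?thesis unfolding num_inversions_inversions
    using fin by (metis card_Diff1_less le_less_trans)
qed

lemma num_inversions_transpose_cover:
  assumes "\<And>k. i < k \<Longrightarrow> k < j \<Longrightarrow> w k < w i \<or> w j < w k"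
  shows "num_inversions (w \<circ> t) = Suc (num_inversions w)"
proof -
  have "inversions (w \<circ> t) - {(i, j)} \<subseteq> shift ` inversions w"
  proof clarify
    fix a b assume ab: "(a, b) \<in> inversions (w \<circ> t)" "(a, b) \<notin> shift ` inversions w"
    show "a = i \<and> b = j"
    proof (rule ccontr)
      assume *: "\<not> (a = i \<and> b = j)"
      have lt: "a < b" "w (t b) < w (t a)" using ab by (auto simp: inversions_def)
      show False
      proof (cases "t a < t b")
        case True
        then have "(t a, t b) \<in> inversions w" "shift (t a, t b) = (a, b)"
          using lt by (auto simp: inversions_def shift_def)
        then show False using ab by (metis imageI)
      next
        case False
        have "a = i \<and> i < b \<and> b < j \<or> b = j \<and> i < a \<and> a < j"
          using False lt(1) * ij by (auto simp: transpose_def split: if_splits)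
        then have "(a, b) \<in> inversions w" using assms[of a] assms[of b] lt ij
          by (auto simp: inversions_def transpose_def split: if_splits)
        moreover have "shift (a, b) = (a, b)" using False by (simp add: shift_def)
        ultimately show False using ab by (metis imageI)
      qed
    qed
  qed
  then have "inversions (w \<circ> t) - {(i, j)} = shift ` inversions w" using shift_image by blast
  then have "card (inversions (w \<circ> t) - {(i, j)}) = card (inversions w)"
    using card_image[OF inj_shift] by simp
  moreover have "(i, j) \<in> inversions (w \<circ> t)" using ij by (auto simp: inversions_def)
  ultimately show ?thesis unfolding num_inversions_inversions
    using fin by (metis card_Suc_Diff1)
qed

end

lemma num_inversions_word_perm_Cons:
  "num_inversions (word_perm (a # xs)) =
     (if word_perm xs a < word_perm xs (Suc a) then Suc (num_inversions (word_perm xs))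
      else num_inversions (word_perm xs) - 1)"
  "word_perm xs (Suc a) < word_perm xs a \<Longrightarrow> 0 < num_inversions (word_perm xs)"
proof -
  have up: "num_inversions (word_perm ys \<circ> simple_transp a) = Suc (num_inversions (word_perm ys))"
    if "word_perm ys a < word_perm ys (Suc a)" for ys
    by (rule num_inversions_transpose_cover)
      (use that finite_inversions_word_perm[of ys] finite_inversions_word_perm[of "a # ys"] in \<open>auto simp: word_perm_Cons\<close>)
  have down: "num_inversions (word_perm xs) = Suc (num_inversions (word_perm (a # xs)))"
    if "word_perm xs (Suc a) < word_perm xs a"
  proof -
    have "word_perm xs = word_perm (a # xs) \<circ> simple_transp a"
      by (simp add: word_perm_Cons fun_eq_iff)
    moreover have "word_perm (a # xs) a < word_perm (a # xs) (Suc a)" using that by (simp add: word_perm_Cons)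
    ultimately show ?thesis using up[of "a # xs"] by metis
  qed
  have "word_perm xs (Suc a) < word_perm xs a" if "\<not> word_perm xs a < word_perm xs (Suc a)"
    using that word_perm_eq_iff[of xs "Suc a" a] by linarith
  then show "num_inversions (word_perm (a # xs)) =
     (if word_perm xs a < word_perm xs (Suc a) then Suc (num_inversions (word_perm xs))
      else num_inversions (word_perm xs) - 1)"
    using up[of xs] down by (cases "word_perm xs a < word_perm xs (Suc a)") (simp_all add: word_perm_Cons)
  show "word_perm xs (Suc a) < word_perm xs a \<Longrightarrow> 0 < num_inversions (word_perm xs)"
    using down by simp
qed

lemma num_inversions_id [simp]: "num_inversions id = 0" "num_inversions (\<lambda>x. x) = 0"
proof -
  have *: "{(i, j). i < j \<and> j < i} = ({} :: (nat \<times> nat) set)" by auto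
  show "num_inversions id = 0" "num_inversions (\<lambda>x. x) = 0"
    unfolding num_inversions_def id_apply * by (rule card.empty)+
qed

lemma num_inversions_le_length: "num_inversions (word_perm xs) \<le> length xs"
proof (induction xs)
  case (Cons a xs)
  then show ?case unfolding num_inversions_word_perm_Cons by auto
qed simp

section \<open>Reduced words\<close>

lemma reduced_word_iff:
  "reduced_word xs \<longleftrightarrow> (\<forall>i\<in>set xs. 1 \<le> i) \<and> length xs = num_inversions (word_perm xs)"
  by (simp add: reduced_word_def reduced_words_def)

lemma reduced_words_iff: "xs \<in> reduced_words w \<longleftrightarrow> reduced_word xs \<and> word_perm xs = w"
  by (auto simp: reduced_word_iff reduced_words_def)

lemma reduced_word_Cons:
  "reduced_word (a # xs) \<longleftrightarrow> 1 \<le> a \<and> reduced_word xs \<and> word_perm xs a < word_perm xs (Suc a)"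
  using num_inversions_le_length[of xs] unfolding reduced_word_iff num_inversions_word_perm_Cons
  by auto

lemma reduced_word_appendD2: "reduced_word (xs @ ys) \<Longrightarrow> reduced_word ys"
  by (induction xs) (auto simp: reduced_word_Cons)

lemma num_inversions_word_perm_rev: "num_inversions (word_perm (rev xs)) = num_inversions (word_perm xs)"
proof -
  have "bij_betw (\<lambda>(i, j). (word_perm xs j, word_perm xs i)) (inversions (word_perm xs)) (inversions (word_perm (rev xs)))"
    by (rule bij_betw_byWitness[of _ "\<lambda>(i, j). (word_perm (rev xs) j, word_perm (rev xs) i)"])
      (auto simp: inversions_def word_perm_rev_apply word_perm_apply_rev)
  then show ?thesis unfolding num_inversions_inversions by (simp add: bij_betw_same_card)
qed

lemma reduced_word_rev [simp]: "reduced_word (rev xs) \<longleftrightarrow> reduced_word xs"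
  by (simp add: reduced_word_iff num_inversions_word_perm_rev)

lemma reduced_word_appendD1: "reduced_word (xs @ ys) \<Longrightarrow> reduced_word xs"
  using reduced_word_appendD2[of "rev ys" "rev xs"] by (metis rev_append reduced_word_rev)

lemma reduced_word_cong:
  assumes "word_perm xs = word_perm ys" "length xs = length ys" "\<forall>i\<in>set ys. 1 \<le> i" "reduced_word xs"
  shows "reduced_word ys"
  using assms by (auto simp: reduced_word_iff)

lemma not_reduced_word_repeat: "\<not> reduced_word (xs @ a # a # ys)"
proof
  assume "reduced_word (xs @ a # a # ys)"
  then have "reduced_word (a # a # ys)" by (rule reduced_word_appendD2)
  then show False by (auto simp: reduced_word_Cons word_perm_Cons)
qed

lemma word_perm_far_commute:
  assumes "Suc a < b \<or> Suc b < a"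
  shows "word_perm [a, b] = word_perm [b, a]"
  using assms by (auto simp: word_perm_Cons fun_eq_iff transpose_def)

lemma word_perm_context:
  "word_perm xs = word_perm ys \<Longrightarrow> word_perm (A @ xs @ B) = word_perm (A @ ys @ B)"
  by (simp add: word_perm_append)

lemma reduced_word_far_swap:
  assumes "Suc a < b \<or> Suc b < a"
  shows "reduced_word (A @ a # b # B) \<longleftrightarrow> reduced_word (A @ b # a # B)"
  using word_perm_context[OF word_perm_far_commute[OF assms], of A B] by (auto simp: reduced_word_iff)

lemma word_perm_crossing:
  assumes "i < j" "word_perm ys j < word_perm ys i"
  obtains B d D where "ys = B @ d # D" "word_perm B i = d" "word_perm B j = Suc d"
proof -
  have "\<exists>B d D. ys = B @ d # D \<and> word_perm B i = d \<and> word_perm B j = Suc d"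
    using assms
  proof (induction ys arbitrary: i j)
    case (Cons a ys)
    show ?case
    proof (cases "i = a \<and> j = Suc a")
      case True
      then show ?thesis by (intro exI[of _ "[]"]) auto
    next
      case False
      then have "simple_transp a i < simple_transp a j" using Cons.prems(1) by (auto simp: transpose_def)
      then obtain B d D where "ys = B @ d # D" "word_perm B (simple_transp a i) = d"
          "word_perm B (simple_transp a j) = Suc d"
        using Cons.IH[of "simple_transp a i" "simple_transp a j"] Cons.prems(2) by (auto simp: word_perm_Cons)
      then show ?thesis by (intro exI[of _ "a # B"] exI[of _ d] exI[of _ D]) (auto simp: word_perm_Cons)
    qed
  qed simp
  then show ?thesis using that by blast
qed

lemma word_perm_snoc: "word_perm (xs @ [d]) i = simple_transp d (word_perm xs i)"
  by (simp add: word_perm_append word_perm_Cons)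

lemma reduced_word_snoc:
  "reduced_word (xs @ [d]) \<longleftrightarrow> 1 \<le> d \<and> reduced_word xs \<and> word_perm (rev xs) d < word_perm (rev xs) (Suc d)"
  using reduced_word_Cons[of d "rev xs"] reduced_word_rev[of "xs @ [d]"] by simp

lemma reduced_word_inversion_persists:
  assumes "reduced_word (xs @ ys)" "i < j" "word_perm xs j < word_perm xs i"
  shows "word_perm (xs @ ys) j < word_perm (xs @ ys) i"
  using assms(1)
proof (induction ys rule: rev_induct)
  case (snoc d ys)
  let ?w = "word_perm (xs @ ys)"
  have red: "reduced_word ((xs @ ys) @ [d])" using snoc.prems by simp
  then have IH: "?w j < ?w i" using snoc.IH reduced_word_appendD1 by blast
  have "word_perm (rev (xs @ ys)) d < word_perm (rev (xs @ ys)) (Suc d)"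
    using red by (simp only: reduced_word_snoc)
  then have "\<not> (?w j = d \<and> ?w i = Suc d)" using assms(2) by (metis word_perm_rev_apply not_less_iff_gr_or_eq)
  then have "simple_transp d (?w j) < simple_transp d (?w i)"
    using IH by (auto simp: transpose_def)
  then show ?case by (simp only: append_assoc[symmetric] word_perm_snoc)
qed (use assms in simp)

lemma reduced_word_letter_less:
  assumes "reduced_word xs" "word_perm xs permutes {1..n}" "a \<in> set xs"
  shows "a < n"
proof (rule ccontr)
  assume "\<not> a < n"
  define m where "m = Max (set xs)"
  have m: "m \<in> set xs" "\<And>b. b \<in> set xs \<Longrightarrow> b \<le> m"
    using assms(3) unfolding m_def by (auto intro!: Max_in)
  have mn: "n \<le> m" using m(2)[OF assms(3)] \<open>\<not> a < n\<close> by simp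
  obtain ys zs where xs: "xs = ys @ m # zs" "m \<notin> set ys" using m(1) by (meson split_list_first)
  have "set ys \<subseteq> {0..<m}" using m(2) xs by (force simp: less_le)
  then have "word_perm ys permutes {0..m}" by (rule word_perm_permutes)
  then have fix1: "word_perm ys (Suc m) = Suc m" by (auto simp: permutes_def)
  have red: "reduced_word ((ys @ [m]) @ zs)" using assms xs by simp
  define i where "i = word_perm (rev ys) m"
  have i: "word_perm ys i = m" by (simp add: i_def word_perm_apply_rev)
  have "word_perm (rev ys) m < word_perm (rev ys) (Suc m)"
    using reduced_word_appendD1[OF red] by (simp only: reduced_word_snoc)
  moreover have "word_perm (rev ys) (Suc m) = Suc m" using fix1 word_perm_rev_eq_iff by blast
  ultimately have lt: "i < Suc m" by (simp add: i_def)
  have "word_perm (ys @ [m]) (Suc m) < word_perm (ys @ [m]) i"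
    unfolding word_perm_snoc fix1 i by simp
  from reduced_word_inversion_persists[OF red lt this]
  have "word_perm xs (Suc m) < word_perm xs i" using xs by simp
  moreover have "word_perm xs (Suc m) = Suc m" using assms(2) mn by (auto simp: permutes_def)
  moreover have "word_perm xs i \<le> m"
  proof (cases "i \<in> {1..n}")
    case True
    then have "word_perm xs i \<in> {1..n}" using assms(2) by (meson permutes_in_image)
    then show ?thesis using mn by simp
  next
    case False
    then show ?thesis using assms(2) lt by (auto simp: permutes_def)
  qed
  ultimately show False by simp
qed

section \<open>Coxeter--Knuth moves\<close>

inductive ck_triple :: "nat list \<Rightarrow> nat list \<Rightarrow> bool" where
  "q < p \<Longrightarrow> p < r \<Longrightarrow> ck_triple [p, q, r] [p, r, q]"
| "r < p \<Longrightarrow> p < q \<Longrightarrow> ck_triple [p, q, r] [p, r, q]"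
| "p < r \<Longrightarrow> r < q \<Longrightarrow> ck_triple [p, q, r] [q, p, r]"
| "q < r \<Longrightarrow> r < p \<Longrightarrow> ck_triple [p, q, r] [q, p, r]"
| "q = Suc p \<Longrightarrow> ck_triple [p, q, p] [q, p, q]"
| "p = Suc q \<Longrightarrow> ck_triple [p, q, p] [q, p, q]"

lemma ck_triple_sym: "ck_triple T T' \<Longrightarrow> ck_triple T' T"
  by (induction rule: ck_triple.induct) (auto intro: ck_triple.intros)

lemma ck_triple_functional: "ck_triple T T' \<Longrightarrow> ck_triple T T'' \<Longrightarrow> T' = T''"
  by (elim ck_triple.cases) auto

lemma ck_triple_length: "ck_triple T T' \<Longrightarrow> length T = 3 \<and> length T' = 3"
  by (induction rule: ck_triple.induct) auto

lemma ck_triple_set: "ck_triple T T' \<Longrightarrow> set T = set T'"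
  by (induction rule: ck_triple.induct) auto

lemma ck_triple_word_perm: "ck_triple T T' \<Longrightarrow> word_perm T = word_perm T'"
proof (induction rule: ck_triple.induct)
qed (auto simp: word_perm_Cons fun_eq_iff transpose_def)

definition ck_at :: "nat \<Rightarrow> nat list \<Rightarrow> nat list \<Rightarrow> bool" where
  "ck_at i \<rho> \<sigma> \<longleftrightarrow> (\<exists>A T T' B. length A = i \<and> \<rho> = A @ T @ B \<and> \<sigma> = A @ T' @ B \<and> ck_triple T T')"

lemma ck_at_sym: "ck_at i \<rho> \<sigma> \<Longrightarrow> ck_at i \<sigma> \<rho>"
  unfolding ck_at_def using ck_triple_sym by blast

lemma ck_at_functional:
  assumes "ck_at i \<rho> \<sigma>" "ck_at i \<rho> \<sigma>'"
  shows "\<sigma> = \<sigma>'"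
proof -
  obtain A T T' B where 1: "length A = i" "\<rho> = A @ T @ B" "\<sigma> = A @ T' @ B" "ck_triple T T'"
    using assms(1) by (auto simp: ck_at_def)
  obtain A2 T2 T2' B2 where 2: "length A2 = i" "\<rho> = A2 @ T2 @ B2" "\<sigma>' = A2 @ T2' @ B2" "ck_triple T2 T2'"
    using assms(2) by (auto simp: ck_at_def)
  have "A = A2 \<and> T = T2 \<and> B = B2"
    using 1 2 ck_triple_length[OF 1(4)] ck_triple_length[OF 2(4)] by auto
  then show ?thesis using 1 2 ck_triple_functional by blast
qed

lemma ck_at_props:
  assumes "ck_at i \<rho> \<sigma>"
  shows "word_perm \<rho> = word_perm \<sigma>" "set \<rho> = set \<sigma>" "length \<rho> = length \<sigma>"
    "reduced_word \<rho> \<longleftrightarrow> reduced_word \<sigma>"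
proof -
  obtain A T T' B where 1: "length A = i" "\<rho> = A @ T @ B" "\<sigma> = A @ T' @ B" "ck_triple T T'"
    using assms by (auto simp: ck_at_def)
  show "word_perm \<rho> = word_perm \<sigma>" "set \<rho> = set \<sigma>" "length \<rho> = length \<sigma>"
    using 1 ck_triple_word_perm[OF 1(4)] ck_triple_set[OF 1(4)] ck_triple_length[OF 1(4)]
    by (auto simp: word_perm_append)
  then show "reduced_word \<rho> \<longleftrightarrow> reduced_word \<sigma>" by (simp add: reduced_word_iff)
qed

lemma ck_d_triple:
  assumes "\<rho> = A @ [p, q, r] @ B"
  shows "ck_d (length B + 2) \<rho> = (if \<exists>T'. ck_triple [p, q, r] T' then A @ (THE T'. ck_triple [p, q, r] T') @ B else \<rho>)"
proof -
  have l: "letter \<rho> (length B + 3) = p" "letter \<rho> (length B + 2) = q" "letter \<rho> (length B + 1) = r"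
    unfolding letter_def assms by (auto simp: nth_append)
  have s: "set_letter (length B + 3) x (A @ a # b # c # B) = A @ x # b # c # B"
    "set_letter (length B + 2) x (A @ a # b # c # B) = A @ a # x # c # B"
    "set_letter (length B + 1 + 1) x (A @ a # b # c # B) = A @ a # x # c # B"
    "set_letter (length B + 1) x (A @ a # b # c # B) = A @ a # b # x # B" for x a b c
    unfolding set_letter_def by (auto simp: list_update_append)
  have n: "Suc (length B + 2) = length B + 3" "length B + 2 + 1 = length B + 3" "length B + 2 - 1 = length B + 1" by auto
  have the: "(\<exists>T'. ck_triple [p, q, r] T') \<and> (THE T'. ck_triple [p, q, r] T') = T'" if "ck_triple [p, q, r] T'" for T'
    using that ck_triple_functional by blast
  have none: "\<not> ck_triple [p, q, r] T'" if "\<not> (p = r \<and> (r = q + 1 \<or> q = r + 1))" "\<not> (r > p \<and> p > q \<or> r < p \<and> p < q)"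
    "\<not> (p > r \<and> r > q \<or> p < r \<and> r < q)" for T'
    using that by (auto elim!: ck_triple.cases)
  have l1: "letter \<rho> (length B + 1 + 1) = q" using l by (simp add: numeral_2_eq_2)
  consider "p = r \<and> (r = q + 1 \<or> q = r + 1)"
    | "\<not> (p = r \<and> (r = q + 1 \<or> q = r + 1))" "r > p \<and> p > q \<or> r < p \<and> p < q"
    | "\<not> (p = r \<and> (r = q + 1 \<or> q = r + 1))" "\<not> (r > p \<and> p > q \<or> r < p \<and> p < q)" "p > r \<and> r > q \<or> p < r \<and> r < q"
    | "\<not> (p = r \<and> (r = q + 1 \<or> q = r + 1))" "\<not> (r > p \<and> p > q \<or> r < p \<and> p < q)" "\<not> (p > r \<and> r > q \<or> p < r \<and> r < q)"
    by blast
  then show ?thesis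
  proof cases
    case 1
    then have "ck_triple [p, q, r] [q, p, q]" by (auto intro: ck_triple.intros)
    moreover have "ck_d (length B + 2) \<rho> = A @ [q, p, q] @ B"
      using 1 unfolding ck_d_def Let_def n l ck_b_def by (simp add: assms s del: One_nat_def add_2_eq_Suc')
    ultimately show ?thesis using the by auto
  next
    case 2
    then have "ck_triple [p, q, r] [p, r, q]" by (auto intro: ck_triple.intros)
    moreover have "ck_d (length B + 2) \<rho> = A @ [p, r, q] @ B"
      using 2 unfolding ck_d_def Let_def n l ck_c_def l1 by (auto simp: assms s numeral_2_eq_2[symmetric] simp del: One_nat_def add_Suc_right add_2_eq_Suc')
    ultimately show ?thesis using the by auto
  next
    case 3
    then have "ck_triple [p, q, r] [q, p, r]" by (auto intro: ck_triple.intros)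
    moreover have "ck_d (length B + 2) \<rho> = A @ [q, p, r] @ B"
      using 3 unfolding ck_d_def Let_def n l ck_c_def by (auto simp: assms s simp del: One_nat_def add_Suc_right add_2_eq_Suc')
    ultimately show ?thesis using the by auto
  next
    case 4
    then have "ck_d (length B + 2) \<rho> = \<rho>" unfolding ck_d_def Let_def n l by auto
    then show ?thesis using none 4 by auto
  qed
qed

lemma split_at_window:
  assumes "Suc (Suc k) < length \<rho>"
  obtains A p q r B where "\<rho> = A @ [p, q, r] @ B" "length A = k"
proof (rule that)
  have d: "drop k \<rho> = \<rho> ! k # drop (Suc k) \<rho>" "drop (Suc k) \<rho> = \<rho> ! Suc k # drop (Suc (Suc k)) \<rho>"
    "drop (Suc (Suc k)) \<rho> = \<rho> ! Suc (Suc k) # drop (Suc (Suc (Suc k))) \<rho>"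
    by (rule Cons_nth_drop_Suc[symmetric], use assms in linarith)+
  have "\<rho> = take k \<rho> @ drop k \<rho>" by simp
  also have "drop k \<rho> = [\<rho> ! k, \<rho> ! Suc k, \<rho> ! Suc (Suc k)] @ drop (Suc (Suc (Suc k))) \<rho>"
    unfolding append_Cons append_Nil by (subst d(1), subst d(2), subst d(3)) (rule refl)
  finally show "\<rho> = take k \<rho> @ [\<rho> ! k, \<rho> ! Suc k, \<rho> ! Suc (Suc k)] @ drop (Suc (Suc (Suc k))) \<rho>" .
  show "length (take k \<rho>) = k" using assms by simp
qed

lemma ck_equiv_eq: "ck_equiv = (\<lambda>\<rho> \<sigma>. \<exists>i. ck_at i \<rho> \<sigma>)\<^sup>*\<^sup>*"
proof -
  let ?R = "\<lambda>\<rho> \<sigma>. \<exists>i. 1 < i \<and> i < length \<rho> \<and> \<sigma> = ck_d i \<rho>" and ?S = "\<lambda>\<rho> \<sigma>. \<exists>i. ck_at i \<rho> \<sigma>"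
  have S: "?S\<^sup>*\<^sup>* \<rho> \<sigma>" if i: "1 < i" "i < length \<rho>" "\<sigma> = ck_d i \<rho>" for \<rho> \<sigma> i
  proof -
    have "Suc (Suc (length \<rho> - i - 1)) < length \<rho>" using i by linarith
    then obtain A p q r B where \<rho>: "\<rho> = A @ [p, q, r] @ B" and A: "length A = length \<rho> - i - 1"
      using split_at_window by blast
    have "length \<rho> = length A + 3 + length B" using \<rho> by simp
    then have "i = length B + 2" using A i by linarith
    then have \<sigma>: "\<sigma> = (if \<exists>T'. ck_triple [p, q, r] T' then A @ (THE T'. ck_triple [p, q, r] T') @ B else \<rho>)"
      using ck_d_triple[OF \<rho>] i by simp
    show ?thesis
    proof (cases "\<exists>T'. ck_triple [p, q, r] T'")
      case True
      then obtain T' where T': "ck_triple [p, q, r] T'" by blast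
      have "(THE T'. ck_triple [p, q, r] T') = T'"
        by (rule the_equality, rule T', erule ck_triple_functional, rule T')
      then have "\<sigma> = A @ T' @ B" using True \<sigma> by simp
      then have "ck_at (length A) \<rho> \<sigma>" using T' \<rho> unfolding ck_at_def by blast
      then show ?thesis by blast
    qed (use \<sigma> in simp)
  qed
  have R: "?R \<rho> \<sigma>" if ck: "ck_at i \<rho> \<sigma>" for i \<rho> \<sigma>
  proof -
    obtain A T T' B where 1: "\<rho> = A @ T @ B" "\<sigma> = A @ T' @ B" "ck_triple T T'"
      using ck by (auto simp: ck_at_def)
    have "length T = Suc (Suc (Suc 0))" using ck_triple_length[OF 1(3)] by simp
    then obtain p q r where T: "T = [p, q, r]" by (auto simp only: length_Suc_conv length_0_conv)
    have "(THE T'. ck_triple T T') = T'" by (rule the_equality, rule 1(3), erule ck_triple_functional, rule 1(3))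
    then have "\<sigma> = ck_d (length B + 2) \<rho>" using ck_d_triple[of \<rho> A p q r B] 1 T by auto
    moreover have "length B + 2 < length \<rho>" using 1 T by simp
    ultimately show ?thesis by (intro exI[of _ "length B + 2"]) simp
  qed
  have "?R \<le> ?S\<^sup>*\<^sup>*" using S by (intro predicate2I) blast
  then have "?R\<^sup>*\<^sup>* \<le> ?S\<^sup>*\<^sup>*" using rtranclp_mono[of ?R "?S\<^sup>*\<^sup>*"] by simp
  moreover have "?S\<^sup>*\<^sup>* \<le> ?R\<^sup>*\<^sup>*" using R by (intro rtranclp_mono predicate2I) blast
  ultimately show ?thesis unfolding ck_equiv_def by (rule antisym)
qed

lemma ck_equiv_refl [simp]: "ck_equiv \<rho> \<rho>"
  by (simp add: ck_equiv_eq)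

lemma ck_equiv_trans: "ck_equiv \<rho> \<sigma> \<Longrightarrow> ck_equiv \<sigma> \<tau> \<Longrightarrow> ck_equiv \<rho> \<tau>"
  unfolding ck_equiv_eq by (rule rtranclp_trans)

lemma ck_equiv_step: "ck_at i \<rho> \<sigma> \<Longrightarrow> ck_equiv \<rho> \<sigma>"
  unfolding ck_equiv_eq by (rule r_into_rtranclp) (rule exI)

lemma ck_equiv_induct [consumes 1, case_names refl step]:
  assumes "ck_equiv \<rho> \<sigma>" "P \<rho>"
    and "\<And>\<sigma> \<tau> i. ck_equiv \<rho> \<sigma> \<Longrightarrow> ck_at i \<sigma> \<tau> \<Longrightarrow> P \<sigma> \<Longrightarrow> P \<tau>"
  shows "P \<sigma>"
  using assms(1)[unfolded ck_equiv_eq]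
proof (induction rule: rtranclp_induct)
  case (step y z)
  from step(2) obtain i where "ck_at i y z" ..
  moreover have "ck_equiv \<rho> y" using step(1) unfolding ck_equiv_eq .
  ultimately show ?case using step(3) assms(3) by simp
qed (rule assms(2))

lemma ck_equiv_sym: "ck_equiv \<rho> \<sigma> \<Longrightarrow> ck_equiv \<sigma> \<rho>"
proof (induction rule: ck_equiv_induct)
  case (step \<sigma> \<tau> i)
  then show ?case using ck_at_sym ck_equiv_step ck_equiv_trans by blast
qed simp

lemma ck_equiv_props:
  assumes "ck_equiv \<rho> \<sigma>"
  shows "word_perm \<rho> = word_perm \<sigma>" "set \<rho> = set \<sigma>" "length \<rho> = length \<sigma>"
    "reduced_word \<rho> \<longleftrightarrow> reduced_word \<sigma>"
proof -
  have "word_perm \<rho> = word_perm \<sigma> \<and> set \<rho> = set \<sigma> \<and> length \<rho> = length \<sigma> \<and>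
    (reduced_word \<rho> \<longleftrightarrow> reduced_word \<sigma>)"
    using assms
  proof (induction rule: ck_equiv_induct)
    case (step \<sigma> \<tau> i)
    then show ?case using ck_at_props[OF step(2)] by simp
  qed simp
  then show "word_perm \<rho> = word_perm \<sigma>" "set \<rho> = set \<sigma>" "length \<rho> = length \<sigma>"
    "reduced_word \<rho> \<longleftrightarrow> reduced_word \<sigma>" by blast+
qed

lemma ck_equiv_context:
  assumes "ck_equiv \<rho> \<sigma>"
  shows "ck_equiv (A @ \<rho> @ B) (A @ \<sigma> @ B)"
  using assms
proof (induction rule: ck_equiv_induct)
  case (step \<sigma> \<tau> i)
  obtain C T T' D where "\<sigma> = C @ T @ D" "\<tau> = C @ T' @ D" "ck_triple T T'"
    using step(2) by (auto simp: ck_at_def)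
  then have "ck_at (length (A @ C)) (A @ \<sigma> @ B) (A @ \<tau> @ B)"
    unfolding ck_at_def by (intro exI[of _ "A @ C"] exI[of _ T] exI[of _ T'] exI[of _ "D @ B"]) simp
  then show ?case using step(3) ck_equiv_step ck_equiv_trans by blast
qed simp

lemma ck_equiv_Cons: "ck_equiv \<rho> \<sigma> \<Longrightarrow> ck_equiv (a # \<rho>) (a # \<sigma>)"
  using ck_equiv_context[of \<rho> \<sigma> "[a]" "[]"] by simp

lemma ck_equiv_append: "ck_equiv \<rho> \<sigma> \<Longrightarrow> ck_equiv (\<rho> @ B) (\<sigma> @ B)"
  using ck_equiv_context[of \<rho> \<sigma> "[]" B] by simp

lemma ck_equiv_triple: "ck_triple T T' \<Longrightarrow> ck_equiv (A @ T @ B) (A @ T' @ B)"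
  by (rule ck_equiv_step[of "length A"]) (auto simp: ck_at_def)

lemma ck_triple_exists:
  assumes "reduced_word (A @ [p, q, r] @ B)" "p > q \<and> q < r \<or> p < q \<and> q > r"
  shows "\<exists>T'. ck_triple [p, q, r] T'"
proof (cases "p = r")
  case True
  have "\<not> (Suc q < p \<or> Suc p < q)"
  proof
    assume *: "Suc q < p \<or> Suc p < q"
    then have "reduced_word (A @ q # p # r # B)"
      using assms(1) reduced_word_far_swap[of p q A "r # B"] by auto
    then show False using not_reduced_word_repeat[of "A @ [q]" p B] True by simp
  qed
  then have "p = Suc q \<or> q = Suc p" using assms(2) by auto
  then show ?thesis using True ck_triple.intros(5,6) by blast
next
  case False
  then consider "q < p" "p < r" | "q < r" "r < p" | "r < p" "p < q" | "p < r" "r < q"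
    using assms(2) by linarith
  then show ?thesis
  proof cases
    case 1 then show ?thesis by (intro exI) (rule ck_triple.intros(1))
  next
    case 2 then show ?thesis by (intro exI) (rule ck_triple.intros(4))
  next
    case 3 then show ?thesis by (intro exI) (rule ck_triple.intros(2))
  next
    case 4 then show ?thesis by (intro exI) (rule ck_triple.intros(3))
  qed
qed

section \<open>Row insertion and exchange of two increasing runs\<close>

abbreviation increasing :: "nat list \<Rightarrow> bool" where
  "increasing \<equiv> sorted_wrt (<)"

lemma increasing_eqI:
  "increasing u \<Longrightarrow> increasing v \<Longrightarrow> set u = set v \<Longrightarrow> u = v"
  by (rule strict_sorted_equal)

lemma increasing_list_of_set: "finite S \<Longrightarrow> \<exists>u. increasing u \<and> set u = S"
  by (intro exI[of _ "sorted_list_of_set S"]) simp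

text \<open>Inserting \<open>x\<close> into the increasing row \<open>u\<close> pushes \<open>y\<close> out and leaves the row \<open>u'\<close>
  (Edelman--Greene insertion: if \<open>x\<close> already occurs, then so does \<open>x + 1\<close>, and the row does not change).\<close>

definition row_bump :: "nat list \<Rightarrow> nat \<Rightarrow> nat \<Rightarrow> nat list \<Rightarrow> bool" where
  "row_bump u x y u' \<longleftrightarrow> increasing u \<and> increasing u' \<and> x < y \<and> y \<in> set u \<and>
     (\<forall>a\<in>set u. \<not> (x < a \<and> a < y)) \<and>
     (if x \<in> set u then y = Suc x \<and> set u' = set u else set u' = insert x (set u - {y}))"

lemma row_bump_reverse:
  "row_bump u x y u' \<longleftrightarrow> increasing u \<and> increasing u' \<and> x < y \<and> x \<in> set u' \<and>
     (\<forall>a\<in>set u'. \<not> (x < a \<and> a < y)) \<and>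
     (if y \<in> set u' then y = Suc x \<and> set u = set u' else set u = insert y (set u' - {x}))"
proof (cases "x \<in> set u")
  case True
  then show ?thesis unfolding row_bump_def by auto
next
  case False
  then show ?thesis unfolding row_bump_def by (auto split: if_splits)
qed

lemma row_bump_functional:
  assumes "row_bump u x y u'" "row_bump u x y2 u2"
  shows "y = y2" "u' = u2"
proof -
  show "y = y2" using assms unfolding row_bump_def by (metis linorder_neqE_nat)
  then show "u' = u2" using assms unfolding row_bump_def by (metis increasing_eqI)
qed

lemma row_bump_injective:
  assumes "row_bump u x y u'" "row_bump u2 x2 y u'"
  shows "x = x2" "u = u2"
proof -
  show "x = x2" using assms unfolding row_bump_reverse by (metis linorder_neqE_nat)
  then show "u = u2" using assms unfolding row_bump_reverse by (metis increasing_eqI)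
qed

lemma row_bump_less_iff:
  assumes "row_bump u x y u1" "row_bump u1 x2 y2 u2"
  shows "x < x2 \<longleftrightarrow> y < y2"
proof
  assume "x < x2"
  show "y < y2"
  proof (rule ccontr)
    assume "\<not> y < y2"
    then have "y2 \<in> set u1" "x < y2" "y2 \<le> y" "x2 < y2" using assms \<open>x < x2\<close> by (auto simp: row_bump_def)
    then have "y2 = y" using assms(1) unfolding row_bump_reverse by (metis le_neq_implies_less)
    then have "y = Suc x" using assms(1) \<open>y2 \<in> set u1\<close> unfolding row_bump_reverse by metis
    then show False using \<open>x < x2\<close> \<open>x2 < y2\<close> \<open>y2 = y\<close> by simp
  qed
next
  assume "y < y2"
  show "x < x2"
  proof (rule ccontr)
    assume "\<not> x < x2"
    have x: "x \<in> set u1" "x < y" using assms(1) unfolding row_bump_reverse by auto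
    have "\<not> (x2 < x \<and> x < y2)" using assms(2) x unfolding row_bump_def by blast
    then have "x2 = x" using \<open>\<not> x < x2\<close> x \<open>y < y2\<close> by linarith
    then have "y2 = Suc x" using assms(2) x unfolding row_bump_def by metis
    then show False using x \<open>y < y2\<close> by simp
  qed
qed

lemma row_bump_length: "row_bump u x y u' \<Longrightarrow> length u' = length u"
proof -
  assume *: "row_bump u x y u'"
  have "card (set u') = card (set u)"
  proof (cases "x \<in> set u")
    case False
    have "card (insert x (set u - {y})) = Suc (card (set u - {y}))" using False by simp
    also have "\<dots> = card (set u)" using * by (intro card_Suc_Diff1) (auto simp: row_bump_def)
    finally show ?thesis using * False by (simp add: row_bump_def)
  qed (use * in \<open>auto simp: row_bump_def\<close>)
  then show ?thesis using * by (simp add: row_bump_def distinct_card strict_sorted_iff)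
qed

lemma ck_equiv_move_left_above:
  assumes "increasing (a # s)" "x < a"
  shows "ck_equiv (a # s @ [x]) (a # x # s)"
  using assms
proof (induction s arbitrary: a)
  case (Cons b s)
  have "ck_equiv (a # b # s @ [x]) (a # b # x # s)"
    using Cons by (intro ck_equiv_Cons Cons.IH) auto
  moreover have "ck_equiv ([] @ [a, b, x] @ s) ([] @ [a, x, b] @ s)"
    using Cons.prems by (intro ck_equiv_triple ck_triple.intros(2)) auto
  ultimately show ?case using ck_equiv_trans by auto
qed simp

lemma ck_equiv_move_left_below:
  assumes "increasing (p @ [x])" "x < a"
  shows "ck_equiv (p @ [a, x]) (a # p @ [x])"
  using assms
proof (induction p)
  case (Cons c p)
  have 1: "ck_equiv (c # p @ [a, x]) (c # a # p @ [x])"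
    using Cons by (intro ck_equiv_Cons Cons.IH) auto
  obtain d q where dq: "p @ [x] = d # q" by (cases "p @ [x]") auto
  then have "d \<in> set (p @ [x])" by simp
  then have "c < d" "d < a" using Cons.prems by (auto simp: sorted_wrt_append)
  then have "ck_equiv ([] @ [c, a, d] @ q) ([] @ [a, c, d] @ q)"
    by (intro ck_equiv_triple ck_triple.intros(3))
  then have "ck_equiv (c # a # p @ [x]) (a # c # p @ [x])" using dq by simp
  then show ?case using 1 ck_equiv_trans by auto
qed simp

lemma row_bump_ck_equiv:
  assumes "row_bump u x y u'"
  shows "ck_equiv (u @ [x]) (y # u')"
proof -
  have inc: "increasing u" "increasing u'" and xy: "x < y" "y \<in> set u"
    and gap: "\<And>a. a \<in> set u \<Longrightarrow> \<not> (x < a \<and> a < y)"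
    using assms by (auto simp: row_bump_def)
  obtain p s where u: "u = p @ y # s" using xy(2) by (meson split_list)
  have ps: "\<And>c. c \<in> set p \<Longrightarrow> c < y" "\<And>c. c \<in> set s \<Longrightarrow> y < c" "increasing p" "increasing (y # s)"
    using inc u by (auto simp: sorted_wrt_append)
  have px: "c \<le> x" if "c \<in> set p" for c using gap[of c] ps(1)[OF that] that u by auto
  show ?thesis
  proof (cases "x \<in> set u")
    case False
    then have px': "c < x" if "c \<in> set p" for c using px[OF that] that u by (cases "c = x") auto
    have incp: "increasing (p @ [x])" using ps px' by (auto simp: sorted_wrt_append)
    have "set u' = set (p @ x # s)" using assms False u ps px' by (auto simp: row_bump_def)
    moreover have "increasing (p @ x # s)"
      using ps px' xy by (fastforce simp: sorted_wrt_append)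
    ultimately have u': "u' = p @ x # s" using inc increasing_eqI by blast
    have "ck_equiv (p @ (y # s @ [x]) @ []) (p @ (y # x # s) @ [])"
      using ps xy by (intro ck_equiv_context ck_equiv_move_left_above)
    moreover have "ck_equiv ((p @ [y, x]) @ s) ((y # p @ [x]) @ s)"
      using incp xy by (intro ck_equiv_append ck_equiv_move_left_below)
    ultimately show ?thesis using u u' ck_equiv_trans by auto
  next
    case True
    then have y: "y = Suc x" and u': "u' = u" using assms inc increasing_eqI by (auto simp: row_bump_def)
    have "x \<in> set p" using True u xy ps by fastforce
    then obtain p1 p2 where p: "p = p1 @ x # p2" by (meson split_list)
    have "p2 = []"
    proof (cases p2)
      case (Cons a l)
      have "a \<le> x" using px[of a] p Cons by simp
      moreover have "x < a" using ps(3) p Cons by (simp add: sorted_wrt_append)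
      ultimately show ?thesis by simp
    qed
    then have p: "p = p1 @ [x]" using p by simp
    have "ck_equiv (p @ (y # s @ [x]) @ []) (p @ (y # x # s) @ [])"
      using ps xy by (intro ck_equiv_context ck_equiv_move_left_above)
    then have 1: "ck_equiv (u @ [x]) (p1 @ [x, y, x] @ s)" using u p by simp
    have 2: "ck_equiv (p1 @ [x, y, x] @ s) (p1 @ [y, x, y] @ s)"
      by (intro ck_equiv_triple ck_triple.intros(5) y)
    have "ck_equiv ((p1 @ [y, x]) @ y # s) ((y # p1 @ [x]) @ y # s)"
      using ps xy p by (intro ck_equiv_append ck_equiv_move_left_below) auto
    then have "ck_equiv (p1 @ [y, x, y] @ s) (y # u)" using u p by simp
    then show ?thesis using 1 2 u' ck_equiv_trans by blast
  qed
qed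

lemma row_bump_exists:
  assumes "increasing u" "reduced_word (u @ [x])" "\<not> increasing (u @ [x])"
  shows "\<exists>y u'. row_bump u x y u'"
proof -
  obtain c where c: "c \<in> set u" "x \<le> c" using assms(1,3) by (force simp: sorted_wrt_append)
  show ?thesis
  proof (cases "x \<in> set u")
    case True
    then obtain p s where u: "u = p @ x # s" by (meson split_list)
    have s: "increasing (x # s)" using assms(1) u by (simp add: sorted_wrt_append)
    have "Suc x \<in> set s"
    proof (rule ccontr)
      assume *: "Suc x \<notin> set s"
      have "\<not> reduced_word (x # s @ [x])" using s *
      proof (induction s)
        case Nil
        show ?case using not_reduced_word_repeat[of "[]" x "[]"] by simp
      next
        case (Cons b s)
        then have "Suc x < b" by (auto simp: Suc_lessI)
        then have "reduced_word (x # b # s @ [x]) \<longleftrightarrow> reduced_word (b # x # s @ [x])"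
          using reduced_word_far_swap[of x b "[]" "s @ [x]"] by simp
        then show ?case using Cons by (auto simp: reduced_word_Cons)
      qed
      then show False using assms(2) u reduced_word_appendD2[of p "x # s @ [x]"] by simp
    qed
    then have "row_bump u x (Suc x) u" using assms(1) u True by (auto simp: row_bump_def)
    then show ?thesis by blast
  next
    case False
    define y where "y = Min {a \<in> set u. x < a}"
    have "x < c" using c False by (cases "c = x") auto
    then have ne: "finite {a \<in> set u. x < a}" "{a \<in> set u. x < a} \<noteq> {}" using c by auto
    have y: "y \<in> set u" "x < y" using Min_in[OF ne] by (auto simp: y_def)
    have "\<not> (x < a \<and> a < y)" if "a \<in> set u" for a
    proof
      assume "x < a \<and> a < y"
      then have "y \<le> a" unfolding y_def using that by (intro Min_le) auto
      then show False using \<open>x < a \<and> a < y\<close> by simp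
    qed
    moreover obtain u' where "increasing u'" "set u' = insert x (set u - {y})"
      using increasing_list_of_set[of "insert x (set u - {y})"] by auto
    ultimately have "row_bump u x y u'"
      using y False assms(1) by (auto simp: row_bump_def)
    then show ?thesis by blast
  qed
qed

lemma row_bump_reverse_exists:
  assumes "increasing u'" "reduced_word (y # u')" "c \<in> set u'" "c < y"
  shows "\<exists>x u. row_bump u x y u'"
proof -
  define x where "x = Max {a \<in> set u'. a < y}"
  have ne: "finite {a \<in> set u'. a < y}" "{a \<in> set u'. a < y} \<noteq> {}" using assms by auto
  have x: "x \<in> set u'" "x < y" using Max_in[OF ne] by (auto simp: x_def)
  have gap: "\<not> (x < a \<and> a < y)" if "a \<in> set u'" for a
  proof
    assume "x < a \<and> a < y"
    then have "a \<le> x" unfolding x_def using that by (intro Max_ge) auto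
    then show False using \<open>x < a \<and> a < y\<close> by simp
  qed
  show ?thesis
  proof (cases "y \<in> set u'")
    case True
    then obtain p s where u: "u' = p @ y # s" by (meson split_list)
    have p: "increasing (p @ [y])" using assms(1) u by (simp add: sorted_wrt_append)
    have "y - 1 \<in> set p"
    proof (rule ccontr)
      assume *: "y - 1 \<notin> set p"
      have "\<not> reduced_word (y # p @ [y])" using p *
      proof (induction p rule: rev_induct)
        case Nil
        show ?case using not_reduced_word_repeat[of "[]" y "[]"] by simp
      next
        case (snoc b p)
        then have "Suc b < y" by (auto simp: sorted_wrt_append)
        then have "reduced_word (y # p @ [b, y]) \<longleftrightarrow> reduced_word (y # p @ [y, b])"
          using reduced_word_far_swap[of b y "y # p" "[]"] by simp
        moreover have "\<not> reduced_word (y # p @ [y])" using snoc by (auto simp: sorted_wrt_append)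
        ultimately show ?case using reduced_word_appendD1[of "y # p @ [y]" "[b]"] by auto
      qed
      then show False using assms(2) u reduced_word_appendD1[of "y # p @ [y]" s] by simp
    qed
    then have "x = y - 1" using gap[of "y - 1"] x u by fastforce
    then have "y = Suc x" using x by simp
    then have "row_bump u' x y u'" using assms(1) x True unfolding row_bump_reverse by auto
    then show ?thesis by blast
  next
    case False
    moreover obtain u where "increasing u" "set u = insert y (set u' - {x})"
      using increasing_list_of_set[of "insert y (set u' - {x})"] by auto
    ultimately have "row_bump u x y u'"
      using x gap assms(1) unfolding row_bump_reverse by auto
    then show ?thesis by blast
  qed
qed

inductive row_bumps :: "nat list \<Rightarrow> nat list \<Rightarrow> nat list \<Rightarrow> nat list \<Rightarrow> bool" where
  Nil: "row_bumps u [] [] u"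
| Cons: "row_bump u x y u1 \<Longrightarrow> row_bumps u1 v Y Z \<Longrightarrow> row_bumps u (x # v) (y # Y) Z"

inductive_cases row_bumps_NilE: "row_bumps u [] Y Z"
inductive_cases row_bumps_ConsE: "row_bumps u (x # v) Y Z"
inductive_cases row_bumps_Cons2E: "row_bumps u v (y # Y) Z"
inductive_cases row_bumps_Nil2E: "row_bumps u v [] Z"

lemma row_bumps_length:
  "row_bumps u v Y Z \<Longrightarrow> length Y = length v" "row_bumps u v Y Z \<Longrightarrow> length Z = length u"
  by (induction rule: row_bumps.induct) (auto simp: row_bump_length)

lemma row_bumps_increasing: "row_bumps u v Y Z \<Longrightarrow> increasing u \<longleftrightarrow> increasing Z"
  by (induction rule: row_bumps.induct) (auto simp: row_bump_def)

lemma row_bumps_ck_equiv: "row_bumps u v Y Z \<Longrightarrow> ck_equiv (u @ v) (Y @ Z)"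
proof (induction rule: row_bumps.induct)
  case (Cons u x y u1 v Y Z)
  have "ck_equiv ((u @ [x]) @ v) ((y # u1) @ v)"
    using Cons row_bump_ck_equiv ck_equiv_append by blast
  moreover have "ck_equiv (y # u1 @ v) (y # Y @ Z)" using Cons ck_equiv_Cons by blast
  ultimately show ?case using ck_equiv_trans by auto
qed simp

lemma row_bumps_functional:
  "row_bumps u v Y Z \<Longrightarrow> row_bumps u v Y' Z' \<Longrightarrow> Y = Y' \<and> Z = Z'"
proof (induction arbitrary: Y' Z' rule: row_bumps.induct)
  case (Cons u x y u1 v Y Z)
  from Cons.prems obtain y' u1' Y1 where "Y' = y' # Y1" "row_bump u x y' u1'" "row_bumps u1' v Y1 Z'"
    by (rule row_bumps_ConsE)
  then show ?case using Cons row_bump_functional by blast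
qed (auto elim: row_bumps_NilE)

lemma row_bumps_injective:
  "row_bumps u v Y Z \<Longrightarrow> row_bumps u' v' Y Z \<Longrightarrow> u = u' \<and> v = v'"
proof (induction arbitrary: u' v' rule: row_bumps.induct)
  case (Cons u x y u1 v Y Z)
  from Cons.prems obtain x' u1' v1 where *: "v' = x' # v1" "row_bump u' x' y u1'" "row_bumps u1' v1 Y Z"
    by (rule row_bumps_Cons2E)
  then have "u1 = u1'" "v = v1" using Cons.IH by auto
  then show ?case using * row_bump_injective[OF Cons.hyps(1)] by auto
qed (auto elim: row_bumps_Nil2E)

lemma row_bumps_increasing_iff:
  assumes "row_bumps u v Y Z"
  shows "increasing v \<longleftrightarrow> increasing Y"
proof -
  have "successively (<) v \<longleftrightarrow> successively (<) Y"
    using assms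
  proof (induction rule: row_bumps.induct)
    case (Cons u x y u1 v Y Z)
    show ?case
      using Cons.hyps(2)
    proof (cases rule: row_bumps.cases)
      case (Cons x2 y2 u2 v2 Y2)
      then show ?thesis using Cons.IH row_bump_less_iff[OF Cons.hyps(1)] by simp
    qed auto
  qed simp
  then show ?thesis by (simp add: successively_conv_sorted_wrt)
qed

lemma row_bumps_snoc:
  "row_bumps u v Y Z1 \<Longrightarrow> row_bump Z1 x y Z \<Longrightarrow> row_bumps u (v @ [x]) (Y @ [y]) Z"
  by (induction rule: row_bumps.induct) (auto intro: row_bumps.intros)

lemma row_bump_keeps:
  assumes "row_bump u x y u'"
  shows "x \<in> set u'" "z < x \<Longrightarrow> z \<in> set u \<Longrightarrow> z \<in> set u'"
  using assms by (auto simp: row_bump_def split: if_splits)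

lemma row_bumps_keeps:
  assumes "row_bumps u v Y Z" "increasing v" "\<forall>x\<in>set v. z < x" "z \<in> set u"
  shows "z \<in> set Z"
  using assms
proof (induction rule: row_bumps.induct)
  case (Cons u x y u1 v Y Z)
  then show ?case using row_bump_keeps(2)[OF Cons.hyps(1)] by simp
qed

lemma row_bumps_subset:
  assumes "row_bumps u v Y Z" "increasing v"
  shows "set v \<subseteq> set Z"
  using assms
proof (induction rule: row_bumps.induct)
  case (Cons u x y u1 v Y Z)
  then have "x \<in> set Z" using row_bumps_keeps[OF Cons.hyps(2), of x] row_bump_keeps(1)[OF Cons.hyps(1)] by simp
  then show ?case using Cons by simp
qed simp

lemma row_bumps_list_all2: "row_bumps u v Y Z \<Longrightarrow> list_all2 (<) v Y"
  by (induction rule: row_bumps.induct) (auto simp: row_bump_def)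

text \<open>\<open>Z\<close> is the first row and \<open>Y\<close> the second: \<open>Y ! i\<close> exceeds \<open>Z ! 0, \<dots>, Z ! i\<close>.\<close>

definition column_strict :: "nat list \<Rightarrow> nat list \<Rightarrow> bool" where
  "column_strict Y Z \<longleftrightarrow> (\<forall>i<length Y. Suc i \<le> length (takeWhile (\<lambda>z. z < Y ! i) Z))"

lemma card_below:
  assumes "increasing Z"
  shows "length (takeWhile (\<lambda>z. z < c) Z) = card {z \<in> set Z. z < c}"
proof -
  have "{z \<in> set Z. z < c} = set (takeWhile (\<lambda>z. z < c) Z)"
    using assms by (induction Z) auto
  moreover have "distinct (takeWhile (\<lambda>z. z < c) Z)"
    using assms by (simp add: strict_sorted_iff distinct_takeWhile)
  ultimately show ?thesis by (simp add: distinct_card)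
qed

lemma row_bumps_column_strict:
  assumes "row_bumps u v Y Z" "increasing v" "increasing u"
  shows "column_strict Y Z"
  unfolding column_strict_def
proof (intro allI impI)
  fix i assume i: "i < length Y"
  have Z: "increasing Z" using assms row_bumps_increasing by blast
  have len: "length v = length Y" using row_bumps_length(1)[OF assms(1)] by simp
  have "set (take (Suc i) v) \<subseteq> {z \<in> set Z. z < Y ! i}"
  proof
    fix z assume "z \<in> set (take (Suc i) v)"
    then obtain k where k: "k \<le> i" "z = v ! k" "k < length v" by (auto simp: in_set_conv_nth less_Suc_eq_le)
    have "v ! k \<le> v ! i" using assms(2) k i len
      by (metis le_neq_implies_less less_imp_le order_refl sorted_wrt_nth_less)
    also have "v ! i < Y ! i" using row_bumps_list_all2[OF assms(1)] i len by (simp add: list_all2_conv_all_nth)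
    finally show "z \<in> {z \<in> set Z. z < Y ! i}" using row_bumps_subset[OF assms(1,2)] k by auto
  qed
  then have "card (set (take (Suc i) v)) \<le> card {z \<in> set Z. z < Y ! i}" by (intro card_mono) auto
  moreover have "card (set (take (Suc i) v)) = Suc i"
    using assms(2) i len by (simp add: distinct_card strict_sorted_iff)
  ultimately show "Suc i \<le> length (takeWhile (\<lambda>z. z < Y ! i) Z)" using card_below[OF Z] by simp
qed

lemma row_bumps_reverse_exists:
  assumes "increasing Y" "increasing Z" "column_strict Y Z" "reduced_word (Y @ Z)"
  shows "\<exists>u v. row_bumps u v Y Z"
  using assms
proof (induction Y arbitrary: Z rule: rev_induct)
  case (snoc y Y)
  have "Suc (length Y) \<le> length (takeWhile (\<lambda>z. z < y) Z)"
    using snoc.prems(3)[unfolded column_strict_def, rule_format, of "length Y"] by simp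
  then have big: "Suc (length Y) \<le> card {z \<in> set Z. z < y}" using card_below snoc.prems(2) by simp
  have "{z \<in> set Z. z < y} \<noteq> {}"
  proof
    assume e: "{z \<in> set Z. z < y} = {}"
    show False using big unfolding e by simp
  qed
  then obtain c where "c \<in> set Z" "c < y" by blast
  moreover have "reduced_word (y # Z)" using snoc.prems(4) reduced_word_appendD2[of Y "y # Z"] by simp
  ultimately obtain x Z1 where b: "row_bump Z1 x y Z" using row_bump_reverse_exists snoc.prems(2) by blast
  have Z1: "increasing Z1" using b by (simp add: row_bump_def)
  have below: "\<And>a. a \<in> set Z \<Longrightarrow> a < y \<Longrightarrow> a \<le> x" using b unfolding row_bump_reverse by fastforce
  have sub: "set Z - {x} \<subseteq> set Z1" using b unfolding row_bump_reverse by (auto split: if_splits)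
  have "column_strict Y Z1" unfolding column_strict_def
  proof (intro allI impI)
    fix i assume i: "i < length Y"
    have "Y ! i \<in> set Y" using i by simp
    then have Yi: "Y ! i < y" using snoc.prems(1) by (auto simp: sorted_wrt_append)
    have "Suc i \<le> length (takeWhile (\<lambda>z. z < Y ! i) Z)"
      using snoc.prems(3)[unfolded column_strict_def, rule_format, of i] i by (simp add: nth_append)
    then have ci: "Suc i \<le> card {z \<in> set Z. z < Y ! i}" using card_below snoc.prems(2) by simp
    have "Suc i \<le> card ({z \<in> set Z. z < Y ! i} - {x})"
    proof (cases "x < Y ! i")
      case True
      have "{z \<in> set Z. z < Y ! i} = {z \<in> set Z. z < y}" using below True Yi by fastforce
      then have "Suc (length Y) \<le> card {z \<in> set Z. z < Y ! i}" using big by simp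
      moreover have "card {z \<in> set Z. z < Y ! i} - 1 \<le> card ({z \<in> set Z. z < Y ! i} - {x})"
        using diff_card_le_card_Diff[of "{x}" "{z \<in> set Z. z < Y ! i}"] by simp
      ultimately show ?thesis using i by linarith
    next
      case False
      then have "{z \<in> set Z. z < Y ! i} - {x} = {z \<in> set Z. z < Y ! i}" by auto
      then show ?thesis using ci by simp
    qed
    also have "\<dots> \<le> card {z \<in> set Z1. z < Y ! i}" using sub by (intro card_mono) auto
    finally show "Suc i \<le> length (takeWhile (\<lambda>z. z < Y ! i) Z1)" using card_below[OF Z1] by simp
  qed
  moreover have "increasing Y" using snoc.prems(1) by (simp add: sorted_wrt_append)
  moreover have "reduced_word (Y @ Z1)"
  proof -
    have "ck_equiv (Y @ (Z1 @ [x]) @ []) (Y @ (y # Z) @ [])" using row_bump_ck_equiv[OF b] by (rule ck_equiv_context)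
    then have "reduced_word (Y @ Z1 @ [x])" using ck_equiv_props(4) snoc.prems(4) by auto
    then show ?thesis using reduced_word_appendD1[of "Y @ Z1" "[x]"] by simp
  qed
  ultimately obtain u v where "row_bumps u v Y Z1" using snoc.IH Z1 by blast
  then show ?case using row_bumps_snoc b by blast
qed (auto intro: row_bumps.intros)

lemma takeWhile_take: "takeWhile P (take n xs) = take n (takeWhile P xs)"
proof (induction xs arbitrary: n)
  case (Cons a xs)
  then show ?case by (cases n) auto
qed simp

text \<open>The pair \<open>(u, v)\<close> of rows has the insertion tableau with rows \<open>Y\<close> and \<open>Z\<close>: first letters of \<open>v\<close> bump,
  then letters of \<open>v\<close> are appended.\<close>

definition two_row_tableau :: "nat list \<Rightarrow> nat list \<Rightarrow> nat list \<Rightarrow> nat list \<Rightarrow> bool" where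
  "two_row_tableau u v Y Z \<longleftrightarrow> increasing u \<and> increasing v \<and> increasing Z \<and>
     (\<exists>v1 v2 Z1. v = v1 @ v2 \<and> Z = Z1 @ v2 \<and> row_bumps u v1 Y Z1)"

lemma two_row_tableau_exists:
  assumes "increasing u" "increasing v" "reduced_word (u @ v)"
  shows "\<exists>Y Z. two_row_tableau u v Y Z"
proof -
  have "\<exists>v1 v2 Y Z1. v = v1 @ v2 \<and> row_bumps u v1 Y Z1 \<and> increasing (Z1 @ v2)"
    using assms
  proof (induction v arbitrary: u)
    case Nil
    then show ?case by (auto intro: row_bumps.intros)
  next
    case (Cons x v)
    show ?case
    proof (cases "increasing (u @ [x])")
      case True
      then have "increasing (u @ x # v)" using Cons.prems by (fastforce simp: sorted_wrt_append)
      then show ?thesis by (intro exI[of _ "[]"] exI[of _ "x # v"] exI[of _ u]) (auto intro: row_bumps.intros)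
    next
      case False
      have "reduced_word (u @ [x])" using Cons.prems(3) reduced_word_appendD1[of "u @ [x]" v] by simp
      then obtain y u1 where b: "row_bump u x y u1" using row_bump_exists Cons.prems False by blast
      have "ck_equiv ((u @ [x]) @ v) ((y # u1) @ v)" using row_bump_ck_equiv[OF b] ck_equiv_append by blast
      then have "reduced_word (y # u1 @ v)" using ck_equiv_props(4) Cons.prems(3) by auto
      then have "reduced_word (u1 @ v)" by (simp add: reduced_word_Cons)
      moreover have "increasing u1" "increasing v" using b Cons.prems by (simp_all add: row_bump_def)
      ultimately obtain v1 v2 Y Z1 where "v = v1 @ v2" "row_bumps u1 v1 Y Z1" "increasing (Z1 @ v2)"
        using Cons.IH[of u1] by blast
      then show ?thesis using b
        by (intro exI[of _ "x # v1"] exI[of _ v2] exI[of _ "y # Y"] exI[of _ Z1]) (auto intro: row_bumps.intros)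
    qed
  qed
  then show ?thesis unfolding two_row_tableau_def using assms by blast
qed

lemma row_bumps_prefix_unique:
  assumes "row_bumps u v1 Y Z1" "row_bumps u v1' Y' Z1'" "v1 @ v2 = v1' @ v2'"
    "increasing (Z1 @ v2)" "increasing (Z1' @ v2')"
  shows "v1 = v1'"
  using assms
proof (induction arbitrary: v1' Y' rule: row_bumps.induct)
  case (Nil u)
  show ?case
    using Nil(1)
  proof (cases rule: row_bumps.cases)
    case (Cons x y u1 v Y)
    then have "y \<in> set u" "x < y" "x \<in> set v2" using Nil by (auto simp: row_bump_def)
    moreover from this have "y < x" using Nil(3) by (simp add: sorted_wrt_append)
    ultimately show ?thesis by simp
  qed simp
next
  case (Cons u x y u1 v Y Z)
  from Cons.prems(1) show ?case
  proof (cases rule: row_bumps.cases)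
    case Nil
    then have "y \<in> set Z1'" "x < y" "x \<in> set v2'" using Cons by (auto simp: row_bump_def)
    moreover from this have "y < x" using Cons.prems(4) by (simp add: sorted_wrt_append)
    ultimately show ?thesis by simp
  next
    case *: (Cons x' y' u1' v' Y2)
    then have "x' = x" using Cons.prems(2) by simp
    then have "u1' = u1" using * Cons.hyps(1) row_bump_functional by blast
    then show ?thesis using * Cons \<open>x' = x\<close> by auto
  qed
qed

lemma two_row_tableau_functional:
  assumes "two_row_tableau u v Y Z" "two_row_tableau u v Y' Z'"
  shows "Y = Y' \<and> Z = Z'"
proof -
  obtain v1 v2 Z1 where 1: "v = v1 @ v2" "Z = Z1 @ v2" "row_bumps u v1 Y Z1" "increasing Z"
    using assms(1) by (auto simp: two_row_tableau_def)
  obtain v1' v2' Z1' where 2: "v = v1' @ v2'" "Z' = Z1' @ v2'" "row_bumps u v1' Y' Z1'" "increasing Z'"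
    using assms(2) by (auto simp: two_row_tableau_def)
  have "v1 = v1'" using row_bumps_prefix_unique[OF 1(3) 2(3)] 1 2 by metis
  then show ?thesis using 1 2 row_bumps_functional by blast
qed

lemma two_row_tableau_injective:
  assumes "two_row_tableau u v Y Z" "two_row_tableau u' v' Y Z" "length u = length u'"
  shows "u = u' \<and> v = v'"
proof -
  obtain v1 v2 Z1 where 1: "v = v1 @ v2" "Z = Z1 @ v2" "row_bumps u v1 Y Z1"
    using assms(1) by (auto simp: two_row_tableau_def)
  obtain v1' v2' Z1' where 2: "v' = v1' @ v2'" "Z = Z1' @ v2'" "row_bumps u' v1' Y Z1'"
    using assms(2) by (auto simp: two_row_tableau_def)
  have "length Z1 = length Z1'" using row_bumps_length(2)[OF 1(3)] row_bumps_length(2)[OF 2(3)] assms(3) by simp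
  then have "Z1 = Z1'" "v2 = v2'" using 1 2 by auto
  then show ?thesis using 1 2 row_bumps_injective by blast
qed

lemma two_row_tableau_ck_equiv:
  assumes "two_row_tableau u v Y Z"
  shows "ck_equiv (u @ v) (Y @ Z)"
proof -
  obtain v1 v2 Z1 where 1: "v = v1 @ v2" "Z = Z1 @ v2" "row_bumps u v1 Y Z1"
    using assms(1) by (auto simp: two_row_tableau_def)
  then show ?thesis using ck_equiv_append[OF row_bumps_ck_equiv[OF 1(3)], of v2] by simp
qed

lemma two_row_tableau_swap_lengths:
  assumes "two_row_tableau u v Y Z" "reduced_word (u @ v)"
  shows "\<exists>u' v'. two_row_tableau u' v' Y Z \<and> length u' = length v \<and> length v' = length u"
proof -
  obtain v1 v2 Z1 where 1: "v = v1 @ v2" "Z = Z1 @ v2" "row_bumps u v1 Y Z1" "increasing Z" "increasing v" "increasing u"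
    using assms(1) by (auto simp: two_row_tableau_def)
  have v1: "increasing v1" using 1 by (simp add: sorted_wrt_append)
  have len: "length Y = length v1" "length Z1 = length u" using row_bumps_length[OF 1(3)] by auto
  have Y: "increasing Y" using row_bumps_increasing_iff[OF 1(3)] v1 by simp
  have cs: "column_strict Y Z1" using row_bumps_column_strict[OF 1(3) v1 1(6)] .
  have "column_strict Y (take (length v) Z)"
    unfolding column_strict_def takeWhile_take
  proof (intro allI impI)
    fix i assume i: "i < length Y"
    then have "Suc i \<le> length (takeWhile (\<lambda>z. z < Y ! i) Z1)" using cs by (simp add: column_strict_def)
    also have "\<dots> \<le> length (takeWhile (\<lambda>z. z < Y ! i) Z)" unfolding 1(2)
      by (simp add: takeWhile_append trans_le_add1 length_takeWhile_le)
    finally show "Suc i \<le> length (take (length v) (takeWhile (\<lambda>z. z < Y ! i) Z))"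
      using i len 1(1) by simp
  qed
  moreover have "increasing (take (length v) Z)" using 1(4) by (simp add: sorted_wrt_take)
  moreover have "reduced_word (Y @ take (length v) Z)"
  proof -
    have "reduced_word (Y @ Z)" using two_row_tableau_ck_equiv[OF assms(1)] assms(2) ck_equiv_props(4) by blast
    then have "reduced_word ((Y @ take (length v) Z) @ drop (length v) Z)" by simp
    then show ?thesis by (rule reduced_word_appendD1)
  qed
  ultimately obtain u' v' where 2: "row_bumps u' v' Y (take (length v) Z)"
    using row_bumps_reverse_exists Y by blast
  have len': "length v' = length Y" "length u' = length (take (length v) Z)" using row_bumps_length[OF 2] by auto
  have v': "increasing v'" using row_bumps_increasing_iff[OF 2] Y by simp
  have "increasing (take (length v) Z @ drop (length v) Z)" using 1(4) by simp
  then have "increasing (v' @ drop (length v) Z)"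
    using v' row_bumps_subset[OF 2 v'] by (auto simp only: sorted_wrt_append)
  moreover have "increasing u'" using row_bumps_increasing[OF 2] 1(4) by (simp add: sorted_wrt_take)
  ultimately have "two_row_tableau u' (v' @ drop (length v) Z) Y Z"
    unfolding two_row_tableau_def using 2 1(4) by (metis append_take_drop_id)
  moreover have "length Y \<le> length Z1"
  proof (cases Y rule: rev_cases)
    case (snoc Y' y)
    then have "length Y \<le> length (takeWhile (\<lambda>z. z < Y ! length Y') Z1)"
      using cs[unfolded column_strict_def, rule_format, of "length Y'"] by simp
    then show ?thesis using length_takeWhile_le order.trans by blast
  qed simp
  then have "length u' = length v" "length (v' @ drop (length v) Z) = length u"
    using len len' 1(1,2) by auto
  ultimately show ?thesis by blast
qed

definition exchange_runs :: "nat list \<times> nat list \<Rightarrow> nat list \<times> nat list" where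
  "exchange_runs = (\<lambda>(u, v). SOME (u', v').
     (\<exists>Y Z. two_row_tableau u v Y Z \<and> two_row_tableau u' v' Y Z) \<and> length u' = length v \<and> length v' = length u)"

lemma exchange_runs_eq:
  assumes "increasing u" "increasing v" "reduced_word (u @ v)"
  obtains u' v' Y Z where "exchange_runs (u, v) = (u', v')"
    "two_row_tableau u v Y Z" "two_row_tableau u' v' Y Z" "length u' = length v" "length v' = length u"
proof -
  let ?P = "\<lambda>(u', v'). (\<exists>Y Z. two_row_tableau u v Y Z \<and> two_row_tableau u' v' Y Z) \<and> length u' = length v \<and> length v' = length u"
  obtain Y Z where Y: "two_row_tableau u v Y Z" using two_row_tableau_exists[OF assms] by blast
  then obtain u' v' where "?P (u', v')" using two_row_tableau_swap_lengths[OF Y assms(3)] by blast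
  then have "?P (Eps ?P)" by (rule someI)
  then have "?P (exchange_runs (u, v))" unfolding exchange_runs_def prod.case .
  then show ?thesis using that by (cases "exchange_runs (u, v)") auto
qed

lemma exchange_runs:
  assumes "increasing u" "increasing v" "reduced_word (u @ v)" "exchange_runs (u, v) = (u', v')"
  shows "increasing u'" "increasing v'" "length u' = length v" "length v' = length u"
    "ck_equiv (u @ v) (u' @ v')" "exchange_runs (u', v') = (u, v)"
proof -
  obtain Y Z where *: "two_row_tableau u v Y Z" "two_row_tableau u' v' Y Z" "length u' = length v" "length v' = length u"
    using exchange_runs_eq[OF assms(1-3)] assms(4) by (metis prod.inject)
  show "increasing u'" "increasing v'" "length u' = length v" "length v' = length u"
    using * by (auto simp: two_row_tableau_def)
  show ck: "ck_equiv (u @ v) (u' @ v')"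
    using * two_row_tableau_ck_equiv ck_equiv_sym ck_equiv_trans by blast
  then have red: "reduced_word (u' @ v')" using ck_equiv_props(4) assms(3) by blast
  obtain u2 v2 Y2 Z2 where 2: "exchange_runs (u', v') = (u2, v2)" "two_row_tableau u' v' Y2 Z2"
    "two_row_tableau u2 v2 Y2 Z2" "length u2 = length v'"
    using exchange_runs_eq[OF \<open>increasing u'\<close> \<open>increasing v'\<close> red] by metis
  have "Y2 = Y \<and> Z2 = Z" using 2 * two_row_tableau_functional by blast
  then have "u2 = u \<and> v2 = v" using two_row_tableau_injective * 2 by metis
  then show "exchange_runs (u', v') = (u, v)" using 2 by simp
qed

section \<open>Compatible biwords\<close>

text \<open>A word with a compatible sequence of indices is a list of pairs (index, letter) from left to right:
  the indices decrease weakly, and strictly at every descent of the word.\<close>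

definition before :: "nat \<times> nat \<Rightarrow> nat \<times> nat \<Rightarrow> bool" where
  "before x y \<longleftrightarrow> fst y < fst x \<or> (fst x = fst y \<and> snd x < snd y)"

definition flagged :: "nat \<times> nat \<Rightarrow> bool" where
  "flagged x \<longleftrightarrow> 1 \<le> fst x \<and> fst x \<le> snd x"

definition relaxed :: "nat \<Rightarrow> nat \<times> nat \<Rightarrow> bool" where
  "relaxed p x \<longleftrightarrow> flagged x \<or> x = (Suc p, p)"

definition biwords :: "nat list set \<Rightarrow> (nat \<times> nat \<Rightarrow> bool) \<Rightarrow> (nat \<times> nat) list set" where
  "biwords C F = {b. sorted_wrt before b \<and> map snd b \<in> C \<and> (\<forall>x\<in>set b. F x)}"

definition content :: "(nat \<times> nat) list \<Rightarrow> weak_comp" where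
  "content b = (\<Sum>x\<leftarrow>b. unit_comp (fst x))"

definition genfun :: "(nat \<times> nat) list set \<Rightarrow> zpoly" where
  "genfun S = (\<Sum>b\<in>S. monom (content b))"

definition ck_closed :: "nat list set \<Rightarrow> bool" where
  "ck_closed C \<longleftrightarrow> finite C \<and> (\<forall>\<rho>\<in>C. reduced_word \<rho>) \<and> (\<forall>\<rho>\<in>C. \<forall>\<sigma>. ck_equiv \<rho> \<sigma> \<longrightarrow> \<sigma> \<in> C)"

lemma content_simps [simp]:
  "content [] = 0" "content (x # b) = unit_comp (fst x) + content b"
  "content (b @ c) = content b + content c"
  by (auto simp: content_def)

lemma content_map_Pair [simp]: "content (map (Pair i) u) = Poly_Mapping.single i (length u)"
  by (induction u) (auto simp flip: single_add)

lemma finite_biwords: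
  assumes "finite C" "\<And>x. F x \<Longrightarrow> fst x \<le> Suc (snd x)"
  shows "finite (biwords C F)"
proof (rule finite_subset)
  let ?I = "\<lambda>\<rho>. {is. set is \<subseteq> {..Suc (Max (set \<rho>))} \<and> length is = length \<rho>}"
  show "biwords C F \<subseteq> (\<Union>\<rho>\<in>C. (\<lambda>is. zip is \<rho>) ` ?I \<rho>)"
  proof
    fix b assume b: "b \<in> biwords C F"
    have "b = zip (map fst b) (map snd b)" by (simp add: zip_map_fst_snd)
    moreover have "map fst b \<in> ?I (map snd b)"
    proof -
      have "fst x \<le> Suc (Max (set (map snd b)))" if "x \<in> set b" for x
      proof -
        have "snd x \<le> Max (set (map snd b))" using that by (intro Max_ge) auto
        moreover have "fst x \<le> Suc (snd x)" using b that assms(2) by (auto simp: biwords_def)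
        ultimately show ?thesis by linarith
      qed
      then show ?thesis by auto
    qed
    ultimately show "b \<in> (\<Union>\<rho>\<in>C. (\<lambda>is. zip is \<rho>) ` ?I \<rho>)" using b unfolding biwords_def by blast
  qed
  show "finite (\<Union>\<rho>\<in>C. (\<lambda>is. zip is \<rho>) ` ?I \<rho>)"
    using assms(1) by (intro finite_UN_I finite_imageI finite_lists_length_eq) auto
qed

lemma finite_biwords_flagged: "finite C \<Longrightarrow> finite (biwords C flagged)"
  by (rule finite_biwords) (auto simp: flagged_def)

lemma finite_biwords_relaxed: "finite C \<Longrightarrow> finite (biwords C (relaxed p))"
  by (rule finite_biwords) (auto simp: relaxed_def flagged_def)

lemma sorted_before_split:
  assumes "sorted_wrt before b"
  obtains L u v R where "b = L @ map (Pair (Suc p)) u @ map (Pair p) v @ R"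
    "\<forall>x\<in>set L. Suc p < fst x" "\<forall>x\<in>set R. fst x < p"
proof -
  have "\<exists>L u v R. b = L @ map (Pair (Suc p)) u @ map (Pair p) v @ R \<and>
    (\<forall>x\<in>set L. Suc p < fst x) \<and> (\<forall>x\<in>set R. fst x < p)"
    using assms
  proof (induction b)
    case (Cons x b)
    then obtain L u v R where b: "b = L @ map (Pair (Suc p)) u @ map (Pair p) v @ R"
      "\<forall>x\<in>set L. Suc p < fst x" "\<forall>x\<in>set R. fst x < p" by auto
    have x: "\<forall>y\<in>set b. fst y \<le> fst x" using Cons.prems by (auto simp: before_def)
    consider "Suc p < fst x" | "fst x = Suc p" | "fst x = p" | "fst x < p" by linarith
    then show ?case
    proof cases
      case 1
      then show ?thesis using b
        by (intro exI[of _ "x # L"] exI[of _ u] exI[of _ v] exI[of _ R]) auto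
    next
      case 2
      then have "L = []" using x b by (cases L) auto
      then show ?thesis using b 2
        by (intro exI[of _ "[]"] exI[of _ "snd x # u"] exI[of _ v] exI[of _ R]) (auto intro: prod_eqI)
    next
      case 3
      then have "L = []" "u = []" using x b by (cases L; cases u; auto)+
      then show ?thesis using b 3
        by (intro exI[of _ "[]"] exI[of _ "[]"] exI[of _ "snd x # v"] exI[of _ R]) (auto intro: prod_eqI)
    next
      case 4
      then have "L = []" "u = []" "v = []" using x b by (cases L; cases u; cases v; auto)+
      then show ?thesis using b 4
        by (intro exI[of _ "[]"] exI[of _ "[]"] exI[of _ "[]"] exI[of _ "x # R"]) auto
    qed
  qed (auto intro: exI[of _ "[]"])
  then show ?thesis using that by blast
qed

lemma sorted_before_map_Pair [simp]: "sorted_wrt before (map (Pair i) u) \<longleftrightarrow> increasing u"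
  by (simp add: sorted_wrt_map before_def)

lemma sorted_before_blocks:
  assumes "\<forall>x\<in>set L. Suc p < fst x" "\<forall>x\<in>set R. fst x < p"
  shows "sorted_wrt before (L @ map (Pair (Suc p)) u @ map (Pair p) v @ R) \<longleftrightarrow>
    sorted_wrt before L \<and> increasing u \<and> increasing v \<and> sorted_wrt before R"
  using assms by (fastforce simp: sorted_wrt_append before_def)

definition exchange :: "nat \<Rightarrow> (nat \<times> nat) list \<Rightarrow> (nat \<times> nat) list" where
  "exchange p b = (let (u, v) = exchange_runs (map snd (filter (\<lambda>x. fst x = Suc p) b), map snd (filter (\<lambda>x. fst x = p) b))
     in filter (\<lambda>x. Suc p < fst x) b @ map (Pair (Suc p)) u @ map (Pair p) v @ filter (\<lambda>x. fst x < p) b)"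

lemma exchange_blocks:
  assumes "\<forall>x\<in>set L. Suc p < fst x" "\<forall>x\<in>set R. fst x < p" "exchange_runs (u, v) = (u', v')"
  shows "exchange p (L @ map (Pair (Suc p)) u @ map (Pair p) v @ R) = L @ map (Pair (Suc p)) u' @ map (Pair p) v' @ R"
proof -
  let ?b = "L @ map (Pair (Suc p)) u @ map (Pair p) v @ R"
  have L: "filter (\<lambda>x. Suc p < fst x) L = L" "filter (\<lambda>x. fst x = Suc p) L = []" "filter (\<lambda>x. fst x = p) L = []"
    "filter (\<lambda>x. fst x < p) L = []" using assms(1) by (auto simp: filter_empty_conv filter_id_conv)
  have R: "filter (\<lambda>x. Suc p < fst x) R = []" "filter (\<lambda>x. fst x = Suc p) R = []" "filter (\<lambda>x. fst x = p) R = []"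
    "filter (\<lambda>x. fst x < p) R = R" using assms(2) by (auto simp: filter_empty_conv filter_id_conv)
  have m: "filter P (map (Pair i) w) = (if P' then map (Pair i) w else [])" if "\<And>a. P (i, a) = P'" for P P' i and w :: "nat list"
    using that by (induction w) auto
  have "filter (\<lambda>x. Suc p < fst x) ?b = L" "map snd (filter (\<lambda>x. fst x = Suc p) ?b) = u"
    "map snd (filter (\<lambda>x. fst x = p) ?b) = v" "filter (\<lambda>x. fst x < p) ?b = R"
    using L R m[of "\<lambda>x. Suc p < fst x" _ False] m[of "\<lambda>x. fst x < p" _ False]
    by (auto simp: filter_map comp_def)
  then show ?thesis using assms(3) by (simp add: exchange_def)
qed

lemma exchange:
  assumes b: "b = L @ map (Pair (Suc p)) u @ map (Pair p) v @ R"
    and LR: "\<forall>x\<in>set L. Suc p < fst x" "\<forall>x\<in>set R. fst x < p"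
    and "sorted_wrt before b" "reduced_word (u @ v)"
  obtains u' v' where "exchange p b = L @ map (Pair (Suc p)) u' @ map (Pair p) v' @ R"
    "sorted_wrt before (exchange p b)" "ck_equiv (u @ v) (u' @ v')"
    "content (exchange p b) = swap_parts p (content b)" "exchange p (exchange p b) = b"
    "increasing u'" "increasing v'"
proof -
  obtain u' v' where e: "exchange_runs (u, v) = (u', v')" by (cases "exchange_runs (u, v)")
  have inc: "increasing u" "increasing v" using assms sorted_before_blocks[OF LR] by auto
  note ex = exchange_runs[OF inc assms(5) e]
  have eq: "exchange p b = L @ map (Pair (Suc p)) u' @ map (Pair p) v' @ R"
    unfolding b by (rule exchange_blocks[OF LR e])
  have fixed: "swap_parts p (content c) = content c" if "\<forall>x\<in>set c. fst x \<noteq> p \<and> fst x \<noteq> Suc p" for c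
    using that by (induction c) (auto simp: swap_parts_add transpose_def)
  show ?thesis
  proof (rule that[of u' v'])
    show "exchange p (exchange p b) = b" by (simp only: eq exchange_blocks[OF LR ex(6)] flip: b)
    show "sorted_wrt before (exchange p b)"
      using assms(4)[unfolded b sorted_before_blocks[OF LR]] ex(1,2)
      unfolding eq sorted_before_blocks[OF LR] by simp
    have "swap_parts p (content L) = content L" "swap_parts p (content R) = content R"
      using LR by (auto intro!: fixed)
    then show "content (exchange p b) = swap_parts p (content b)"
      unfolding eq unfolding b by (simp add: swap_parts_add ex ac_simps)
  qed (use eq ex in auto)
qed

lemma ck_closedD:
  assumes "ck_closed C" "\<rho> \<in> C"
  shows "reduced_word \<rho>" "ck_equiv \<rho> \<sigma> \<Longrightarrow> \<sigma> \<in> C"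
  using assms by (auto simp: ck_closed_def)

lemma genfun_symmetric:
  assumes "\<And>b. b \<in> S \<Longrightarrow> exchange p b \<in> S \<and> exchange p (exchange p b) = b \<and>
    content (exchange p b) = swap_parts p (content b)"
  shows "swap_vars p (genfun S) = genfun S"
  unfolding genfun_def swap_vars_sum swap_vars_single
  by (rule sum.reindex_bij_witness[of _ "exchange p" "exchange p"]) (use assms in auto)

lemma genfun_relaxed_symmetric:
  assumes C: "ck_closed C" and p: "1 \<le> p"
  shows "swap_vars p (genfun (biwords C (relaxed p))) = genfun (biwords C (relaxed p))"
proof (rule genfun_symmetric)
  fix b assume "b \<in> biwords C (relaxed p)"
  then have b: "sorted_wrt before b" "map snd b \<in> C" "\<forall>x\<in>set b. relaxed p x" by (auto simp: biwords_def)
  obtain L u v R where eq: "b = L @ map (Pair (Suc p)) u @ map (Pair p) v @ R"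
    and LR: "\<forall>x\<in>set L. Suc p < fst x" "\<forall>x\<in>set R. fst x < p"
    using sorted_before_split[OF b(1)] by blast
  have w: "map snd b = map snd L @ (u @ v) @ map snd R" using eq by (simp add: comp_def)
  have "reduced_word (map snd L @ (u @ v) @ map snd R)" using ck_closedD(1)[OF C b(2)] w by simp
  then have "reduced_word (u @ v)" using reduced_word_appendD1 reduced_word_appendD2 by blast
  from exchange[OF eq LR b(1) this] obtain u' v' where
    e: "exchange p b = L @ map (Pair (Suc p)) u' @ map (Pair p) v' @ R"
    "sorted_wrt before (exchange p b)" "ck_equiv (u @ v) (u' @ v')"
    "content (exchange p b) = swap_parts p (content b)" "exchange p (exchange p b) = b"
    by metis
  have "ck_equiv (map snd L @ (u @ v) @ map snd R) (map snd L @ (u' @ v') @ map snd R)"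
    using e(3) by (rule ck_equiv_context)
  then have "map snd (exchange p b) \<in> C" using ck_closedD(2)[OF C b(2)] w e(1) by (simp add: comp_def)
  moreover have "\<forall>x\<in>set (exchange p b). relaxed p x"
  proof -
    have "p \<le> a" if "a \<in> set u \<union> set v" for a
      using bspec[OF b(3), of "(Suc p, a)"] bspec[OF b(3), of "(p, a)"] that
      unfolding eq by (auto simp: relaxed_def flagged_def)
    then have "p \<le> a" if "a \<in> set u' \<union> set v'" for a
      using that ck_equiv_props(2)[OF e(3)] by auto
    then have "relaxed p (Suc p, a)" "relaxed p (p, a)" if "a \<in> set u' \<union> set v'" for a
      using that p by (fastforce simp: relaxed_def flagged_def)+
    then show ?thesis using b(3) unfolding e(1) unfolding eq by auto
  qed
  ultimately show "exchange p b \<in> biwords C (relaxed p) \<and> exchange p (exchange p b) = b \<and>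
    content (exchange p b) = swap_parts p (content b)" using e by (auto simp: biwords_def)
qed

definition insert_corner :: "nat \<Rightarrow> (nat \<times> nat) list \<Rightarrow> (nat \<times> nat) list" where
  "insert_corner p b = filter (\<lambda>x. Suc p < fst x) b @ (Suc p, p) # filter (\<lambda>x. \<not> Suc p < fst x) b"

definition corner_biwords :: "nat list set \<Rightarrow> nat \<Rightarrow> (nat \<times> nat) list set" where
  "corner_biwords C p = {b. sorted_wrt before b \<and> (\<forall>x\<in>set b. flagged x) \<and> map snd (insert_corner p b) \<in> C}"

lemma insert_corner_blocks:
  assumes "\<forall>x\<in>set L. Suc p < fst x" "\<forall>x\<in>set M. fst x \<le> Suc p"
  shows "insert_corner p (L @ M) = L @ (Suc p, p) # M"
proof -
  have "filter (\<lambda>x. Suc p < fst x) L = L" "filter (\<lambda>x. \<not> Suc p < fst x) L = []"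
    "filter (\<lambda>x. Suc p < fst x) M = []" "filter (\<lambda>x. \<not> Suc p < fst x) M = M"
    using assms by (auto simp: filter_empty_conv filter_id_conv not_less)
  then show ?thesis by (simp add: insert_corner_def)
qed

lemma biwords_relaxed_split:
  assumes p: "1 \<le> p"
  shows "biwords C (relaxed p) = biwords C flagged \<union> insert_corner p ` corner_biwords C p"
    "biwords C flagged \<inter> insert_corner p ` corner_biwords C p = {}"
    "inj_on (insert_corner p) (corner_biwords C p)"
proof -
  show "biwords C flagged \<inter> insert_corner p ` corner_biwords C p = {}"
    by (auto simp: biwords_def insert_corner_def flagged_def)
  show "inj_on (insert_corner p) (corner_biwords C p)"
  proof (rule inj_onI)
    have rem: "remove1 (Suc p, p) (insert_corner p b) = b" if "b \<in> corner_biwords C p" for b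
    proof -
      have b: "sorted_wrt before b" "\<forall>x\<in>set b. flagged x" using that by (auto simp: corner_biwords_def)
      obtain L u v R where eq: "b = L @ map (Pair (Suc p)) u @ map (Pair p) v @ R"
        and LR: "\<forall>x\<in>set L. Suc p < fst x" "\<forall>x\<in>set R. fst x < p"
        using sorted_before_split[OF b(1)] by blast
      have "insert_corner p b = L @ (Suc p, p) # map (Pair (Suc p)) u @ map (Pair p) v @ R"
        unfolding eq using LR by (intro insert_corner_blocks) auto
      moreover have "(Suc p, p) \<notin> set L" using LR(1) by auto
      ultimately show ?thesis unfolding eq by (simp add: remove1_append)
    qed
    fix b c assume "b \<in> corner_biwords C p" "c \<in> corner_biwords C p" "insert_corner p b = insert_corner p c"
    then show "b = c" using rem by metis
  qed
  show "biwords C (relaxed p) = biwords C flagged \<union> insert_corner p ` corner_biwords C p" (is "?A = ?B \<union> ?D")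
  proof (intro equalityI subsetI)
    fix b assume "b \<in> ?A"
    then have b: "sorted_wrt before b" "map snd b \<in> C" "\<forall>x\<in>set b. relaxed p x" by (auto simp: biwords_def)
    show "b \<in> ?B \<union> ?D"
    proof (cases "(Suc p, p) \<in> set b")
      case False
      then have "\<forall>x\<in>set b. flagged x" using b(3) by (auto simp: relaxed_def)
      then show ?thesis using b by (auto simp: biwords_def)
    next
      case True
      obtain L u v R where eq: "b = L @ map (Pair (Suc p)) u @ map (Pair p) v @ R"
        and LR: "\<forall>x\<in>set L. Suc p < fst x" "\<forall>x\<in>set R. fst x < p"
        using sorted_before_split[OF b(1)] by blast
      have inc: "increasing u" "increasing v" "sorted_wrt before L" "sorted_wrt before R"
        using b(1) sorted_before_blocks[OF LR] unfolding eq by auto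
      have "p \<in> set u" using True LR unfolding eq by auto
      moreover have ge: "p \<le> a" if "a \<in> set u" for a
        using bspec[OF b(3), of "(Suc p, a)"] that unfolding eq by (auto simp: relaxed_def flagged_def)
      ultimately obtain u1 where u: "u = p # u1"
        using inc(1) by (cases u) fastforce+
      define c where "c = L @ map (Pair (Suc p)) u1 @ map (Pair p) v @ R"
      have "b = L @ (Suc p, p) # map (Pair (Suc p)) u1 @ map (Pair p) v @ R" unfolding eq u by simp
      moreover have "insert_corner p c = L @ (Suc p, p) # map (Pair (Suc p)) u1 @ map (Pair p) v @ R"
        unfolding c_def using LR by (intro insert_corner_blocks) auto
      ultimately have ic: "insert_corner p c = b" by simp
      have "sorted_wrt before c" using inc unfolding c_def sorted_before_blocks[OF LR] u by simp
      moreover have "\<forall>x\<in>set c. flagged x"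
      proof -
        have "(Suc p, p) \<notin> set c" unfolding c_def using LR inc(1) unfolding u by auto
        moreover have "\<forall>x\<in>set c. relaxed p x" using b(3) unfolding eq u c_def by auto
        ultimately show ?thesis by (auto simp: relaxed_def)
      qed
      ultimately have "c \<in> corner_biwords C p" using ic b(2) by (simp add: corner_biwords_def)
      then show ?thesis using ic by blast
    qed
  next
    fix b assume "b \<in> ?B \<union> ?D"
    then show "b \<in> ?A"
    proof
      assume "b \<in> ?D"
      then obtain c where c: "b = insert_corner p c" "sorted_wrt before c" "\<forall>x\<in>set c. flagged x" "map snd b \<in> C"
        by (auto simp: corner_biwords_def)
      obtain L u v R where eq: "c = L @ map (Pair (Suc p)) u @ map (Pair p) v @ R"
        and LR: "\<forall>x\<in>set L. Suc p < fst x" "\<forall>x\<in>set R. fst x < p"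
        using sorted_before_split[OF c(2)] by blast
      have inc: "increasing u" "increasing v" "sorted_wrt before L" "sorted_wrt before R"
        using c(2) sorted_before_blocks[OF LR] unfolding eq by auto
      have "b = L @ (Suc p, p) # map (Pair (Suc p)) u @ map (Pair p) v @ R"
        unfolding c(1) eq using LR by (intro insert_corner_blocks) auto
      then have b: "b = L @ map (Pair (Suc p)) (p # u) @ map (Pair p) v @ R" by simp
      have "Suc p \<le> a" if "a \<in> set u" for a
        using bspec[OF c(3), of "(Suc p, a)"] that unfolding eq by (auto simp: flagged_def)
      then have "increasing (p # u)" using inc by (auto simp: Suc_le_eq)
      then have "sorted_wrt before b" unfolding b sorted_before_blocks[OF LR] using inc by simp
      moreover have "\<forall>x\<in>set b. relaxed p x" using c(3) unfolding eq b by (auto simp: relaxed_def)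
      ultimately show ?thesis using c by (simp add: biwords_def)
    qed (auto simp: biwords_def relaxed_def)
  qed
qed

lemma content_insert_corner: "content (insert_corner p b) = unit_comp (Suc p) + content b"
proof -
  have "content (filter P b) + content (filter (\<lambda>x. \<not> P x) b) = content b" for P
  proof (induction b)
    case (Cons x b)
    show ?case by (cases "P x") (simp_all add: Cons.IH[symmetric] ac_simps)
  qed simp
  then show ?thesis unfolding insert_corner_def by (simp add: ac_simps)
qed

lemma genfun_relaxed:
  assumes "finite C" "1 \<le> p"
  shows "genfun (biwords C (relaxed p)) = genfun (biwords C flagged) + X (Suc p) * genfun (corner_biwords C p)"
proof -
  note split = biwords_relaxed_split[OF assms(2), of C]
  have fin: "finite (biwords C flagged \<union> insert_corner p ` corner_biwords C p)"
    using finite_biwords_relaxed[OF assms(1), of p] split by simp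
  have "genfun (insert_corner p ` corner_biwords C p) = (\<Sum>b\<in>corner_biwords C p. monom (content (insert_corner p b)))"
    unfolding genfun_def using split(3) by (simp add: sum.reindex)
  also have "\<dots> = X (Suc p) * genfun (corner_biwords C p)"
    unfolding genfun_def sum_distrib_left
    by (simp add: content_insert_corner X_def mult_single)
  finally show ?thesis unfolding split(1) unfolding genfun_def
    using fin split(2) by (subst sum.union_disjoint) auto
qed

lemma genfun_corner_symmetric:
  assumes C: "ck_closed C" and p: "1 \<le> p"
  shows "swap_vars p (genfun (corner_biwords C p)) = genfun (corner_biwords C p)"
proof (rule genfun_symmetric)
  fix b assume "b \<in> corner_biwords C p"
  then have b: "sorted_wrt before b" "map snd (insert_corner p b) \<in> C" "\<forall>x\<in>set b. flagged x"
    by (auto simp: corner_biwords_def)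
  obtain L u v R where eq: "b = L @ map (Pair (Suc p)) u @ map (Pair p) v @ R"
    and LR: "\<forall>x\<in>set L. Suc p < fst x" "\<forall>x\<in>set R. fst x < p"
    using sorted_before_split[OF b(1)] by blast
  have ic: "insert_corner p b = L @ (Suc p, p) # map (Pair (Suc p)) u @ map (Pair p) v @ R"
    unfolding eq using LR by (intro insert_corner_blocks) auto
  have w: "map snd (insert_corner p b) = (map snd L @ [p]) @ (u @ v) @ map snd R" unfolding ic by (simp add: comp_def)
  have "reduced_word ((map snd L @ [p]) @ (u @ v) @ map snd R)" using ck_closedD(1)[OF C b(2)] w by simp
  then have "reduced_word (u @ v)" using reduced_word_appendD1 reduced_word_appendD2 by blast
  from exchange[OF eq LR b(1) this] obtain u' v' where
    e: "exchange p b = L @ map (Pair (Suc p)) u' @ map (Pair p) v' @ R"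
    "sorted_wrt before (exchange p b)" "ck_equiv (u @ v) (u' @ v')"
    "content (exchange p b) = swap_parts p (content b)" "exchange p (exchange p b) = b" "increasing u'"
    by metis
  have ic': "insert_corner p (exchange p b) = L @ (Suc p, p) # map (Pair (Suc p)) u' @ map (Pair p) v' @ R"
    unfolding e(1) using LR by (intro insert_corner_blocks) auto
  have "ck_equiv ((map snd L @ [p]) @ (u @ v) @ map snd R) ((map snd L @ [p]) @ (u' @ v') @ map snd R)"
    using e(3) by (rule ck_equiv_context)
  then have inC: "map snd (insert_corner p (exchange p b)) \<in> C"
    using ck_closedD(2)[OF C b(2)] w ic' by (simp add: comp_def)
  have "p \<le> a" if "a \<in> set u \<union> set v" for a
    using bspec[OF b(3), of "(Suc p, a)"] bspec[OF b(3), of "(p, a)"] that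
    unfolding eq by (auto simp: flagged_def)
  then have ge: "p \<le> a" if "a \<in> set u' \<union> set v'" for a
    using that ck_equiv_props(2)[OF e(3)] by auto
  have "p \<notin> set u'"
  proof
    assume "p \<in> set u'"
    then obtain u1 where "u' = p # u1" using ge e(6) by (cases u') fastforce+
    then have "map snd (insert_corner p (exchange p b)) = map snd L @ p # p # u1 @ v' @ map snd R"
      unfolding ic' by (simp add: comp_def)
    then show False using ck_closedD(1)[OF C inC] not_reduced_word_repeat by metis
  qed
  then have "Suc p \<le> a" if "a \<in> set u'" for a
    using ge[of a] that by (cases "a = p") auto
  then have "\<forall>x\<in>set (exchange p b). flagged x"
    using b(3) ge p unfolding e(1) unfolding eq by (auto simp: flagged_def)
  then show "exchange p b \<in> corner_biwords C p \<and> exchange p (exchange p b) = b \<and>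
    content (exchange p b) = swap_parts p (content b)" using e inC by (auto simp: corner_biwords_def)
qed

lemma swap_vars_genfun_flagged:
  assumes "ck_closed C" "1 \<le> p"
  shows "swap_vars p (genfun (biwords C flagged)) =
    genfun (biwords C (relaxed p)) - X p * genfun (corner_biwords C p)"
proof -
  have "finite C" using assms by (simp add: ck_closed_def)
  then have "genfun (biwords C flagged) = genfun (biwords C (relaxed p)) - X (Suc p) * genfun (corner_biwords C p)"
    using genfun_relaxed assms(2) by simp
  then show ?thesis
    using genfun_relaxed_symmetric[OF assms] genfun_corner_symmetric[OF assms]
    by (simp add: swap_vars_diff swap_vars_mult swap_vars_X)
qed

lemma demazure_op_genfun:
  assumes "ck_closed C" "1 \<le> p"
  shows "demazure_op p (genfun (biwords C flagged)) = genfun (biwords C (relaxed p))"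
proof (rule demazure_op_eqI)
  have "finite C" using assms by (simp add: ck_closed_def)
  show "(X p - X (Suc p)) * genfun (biwords C (relaxed p)) =
    X p * genfun (biwords C flagged) - X (Suc p) * swap_vars p (genfun (biwords C flagged))"
    unfolding swap_vars_genfun_flagged[OF assms] genfun_relaxed[OF \<open>finite C\<close> assms(2)]
    by (simp add: algebra_simps)
qed

lemma divdiff_genfun:
  assumes "ck_closed C" "1 \<le> p"
  shows "divdiff p (genfun (biwords C flagged)) = genfun (corner_biwords C p)"
proof (rule divdiff_eqI)
  have "finite C" using assms by (simp add: ck_closed_def)
  show "(X p - X (Suc p)) * genfun (corner_biwords C p) =
    genfun (biwords C flagged) - swap_vars p (genfun (biwords C flagged))"
    unfolding swap_vars_genfun_flagged[OF assms] genfun_relaxed[OF \<open>finite C\<close> assms(2)]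
    by (simp add: algebra_simps)
qed

section \<open>Schubert polynomials as sums over compatible biwords\<close>

lemma word_perm_move_left:
  assumes "\<forall>a\<in>set L. Suc p < a"
  shows "word_perm (L @ p # M) = word_perm (p # L @ M)"
  using assms
proof (induction L)
  case (Cons a L)
  have "word_perm (L @ p # M) = word_perm (p # L @ M)" using Cons by simp
  then have "word_perm ((a # L) @ p # M) = word_perm (a # p # L @ M)"
    by (simp only: append_Cons word_perm_Cons[of a])
  also have "\<dots> = word_perm ([a, p] @ L @ M)" by simp
  also have "\<dots> = word_perm ([p, a] @ L @ M)"
    using word_perm_context[OF word_perm_far_commute[of a p], of "[]" "L @ M"] Cons.prems by simp
  finally show ?case by simp
qed simp

lemma finite_reduced_words:
  assumes "w permutes {1..n}"
  shows "finite (reduced_words w)"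
proof (rule finite_subset)
  show "reduced_words w \<subseteq> {xs. set xs \<subseteq> {..<n} \<and> length xs = num_inversions w}"
    using reduced_word_letter_less assms by (auto simp: reduced_words_iff reduced_word_iff)
qed (simp add: finite_lists_length_eq)

lemma ck_closed_reduced_words:
  assumes "w permutes {1..n}"
  shows "ck_closed (reduced_words w)"
  unfolding ck_closed_def using finite_reduced_words[OF assms] ck_equiv_props by (auto simp: reduced_words_iff)

lemma corner_biwords_reduced_words:
  assumes "1 \<le> p" "w (Suc p) < w p"
  shows "corner_biwords (reduced_words w) p = biwords (reduced_words (w \<circ> simple_transp p)) flagged"
proof -
  have "map snd (insert_corner p b) \<in> reduced_words w \<longleftrightarrow> map snd b \<in> reduced_words (w \<circ> simple_transp p)"
    if b: "sorted_wrt before b" "\<forall>x\<in>set b. flagged x" for b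
  proof -
    obtain L u v R where eq: "b = L @ map (Pair (Suc p)) u @ map (Pair p) v @ R"
      and LR: "\<forall>x\<in>set L. Suc p < fst x" "\<forall>x\<in>set R. fst x < p"
      using sorted_before_split[OF b(1)] by blast
    let ?L = "map snd L" and ?M = "u @ v @ map snd R"
    have "insert_corner p b = L @ (Suc p, p) # map (Pair (Suc p)) u @ map (Pair p) v @ R"
      unfolding eq using LR by (intro insert_corner_blocks) auto
    then have w: "map snd (insert_corner p b) = ?L @ p # ?M" by (simp add: comp_def)
    have w': "map snd b = ?L @ ?M" unfolding eq by (simp add: comp_def)
    have "Suc p < snd x" if "x \<in> set L" for x
      using bspec[OF LR(1) that] bspec[OF b(2), of x] that unfolding eq flagged_def by simp
    then have "\<forall>a\<in>set ?L. Suc p < a" by auto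
    then have m: "word_perm (?L @ p # ?M) = word_perm (?L @ ?M) \<circ> simple_transp p"
      using word_perm_move_left by (simp add: word_perm_Cons)
    have red: "reduced_word (?L @ p # ?M) \<longleftrightarrow> reduced_word (p # ?L @ ?M)"
      using m by (auto simp: reduced_word_iff word_perm_Cons)
    have inv: "w \<circ> simple_transp p \<circ> simple_transp p = w" for w :: "nat \<Rightarrow> nat" by (simp add: fun_eq_iff)
    have "word_perm (?L @ ?M) \<circ> simple_transp p = w \<longleftrightarrow> word_perm (?L @ ?M) = w \<circ> simple_transp p"
      using inv by metis
    moreover have "word_perm (?L @ ?M) p < word_perm (?L @ ?M) (Suc p)" if "word_perm (?L @ ?M) = w \<circ> simple_transp p"
      unfolding that using assms by simp
    ultimately show ?thesis
      unfolding w w' reduced_words_iff red m reduced_word_Cons using assms(1) by blast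
  qed
  then show ?thesis unfolding corner_biwords_def biwords_def by blast
qed

lemma divdiff_genfun_reduced_words:
  assumes "w permutes {1..n}" "1 \<le> p" "w (Suc p) < w p"
  shows "divdiff p (genfun (biwords (reduced_words w) flagged)) =
    genfun (biwords (reduced_words (w \<circ> simple_transp p)) flagged)"
  using divdiff_genfun[OF ck_closed_reduced_words[OF assms(1)] assms(2)] corner_biwords_reduced_words[OF assms(2,3)]
  by simp

definition staircase :: "nat \<Rightarrow> (nat \<times> nat) set" where
  "staircase n = (SIGMA i:{1..n}. {i..<n})"

fun staircase_biword :: "nat \<Rightarrow> (nat \<times> nat) list" where
  "staircase_biword 0 = []"
| "staircase_biword (Suc n) = map (map_prod Suc Suc) (staircase_biword n) @ map (Pair 1) [1..<Suc n]"

lemma set_staircase_biword: "set (staircase_biword n) = staircase n"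
proof (induction n)
  case 0
  show ?case by (auto simp: staircase_def)
next
  case (Suc n)
  have "(i, a) \<in> map_prod Suc Suc ` staircase n \<union> Pair 1 ` {1..<Suc n} \<longleftrightarrow> (i, a) \<in> staircase (Suc n)" for i a
  proof (cases "i = 1")
    case True
    then show ?thesis by (auto simp: staircase_def map_prod_def)
  next
    case False
    have "(i, a) \<in> map_prod Suc Suc ` staircase n" if "(i, a) \<in> staircase (Suc n)"
      using that False by (intro image_eqI[of _ _ "(i - 1, a - 1)"]) (auto simp: staircase_def)
    moreover have "(i, a) \<in> staircase (Suc n)" if "(i, a) \<in> map_prod Suc Suc ` staircase n"
      using that by (auto simp: staircase_def)
    ultimately show ?thesis using False by auto
  qed
  then show ?case using Suc by (simp only: staircase_biword.simps set_append set_map set_upt) auto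
qed

lemma sorted_staircase_biword: "sorted_wrt before (staircase_biword n)"
proof (induction n)
  case (Suc n)
  have "before (map_prod Suc Suc x) (map_prod Suc Suc y) \<longleftrightarrow> before x y" for x y
    by (simp add: before_def)
  then have "sorted_wrt before (map (map_prod Suc Suc) (staircase_biword n))"
    using Suc by (simp add: sorted_wrt_map)
  moreover have "before (map_prod Suc Suc x) (1, a)" if "x \<in> set (staircase_biword n)" for x a
    using that unfolding set_staircase_biword by (auto simp: staircase_def before_def)
  ultimately show ?case by (auto simp: sorted_wrt_append simp del: upt_Suc)
qed simp

lemma word_perm_map_Suc: "word_perm (map Suc xs) i = (if i = 0 then 0 else Suc (word_perm xs (i - 1)))"
proof (induction xs arbitrary: i)
  case (Cons a xs)
  have "simple_transp (Suc a) i = (if i = 0 then 0 else Suc (simple_transp a (i - 1)))"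
    by (cases i) (auto simp: transpose_def)
  then show ?case using Cons by (simp add: word_perm_Cons)
qed simp

lemma word_perm_upt: "a \<le> m \<Longrightarrow> word_perm [a..<m] i = (if i = a then m else if a < i \<and> i \<le> m then i - 1 else i)"
proof (induction m)
  case (Suc m)
  show ?case
  proof (cases "a = Suc m")
    case False
    then have "a \<le> m" using Suc.prems by simp
    then show ?thesis using Suc.IH
      by (simp only: upt_Suc_append[OF \<open>a \<le> m\<close>] word_perm_snoc) (auto simp: transpose_def)
  qed auto
qed auto

lemma word_perm_staircase_biword: "word_perm (map snd (staircase_biword n)) = longest_perm n"
proof (induction n)
  case 0
  show ?case by (auto simp: longest_perm_def)
next
  case (Suc n)
  define xs where "xs = map snd (staircase_biword n)"
  have "map snd (staircase_biword (Suc n)) = map Suc xs @ [1..<Suc n]"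
    by (simp add: comp_def xs_def del: upt_Suc)
  moreover have "word_perm (map Suc xs @ [1..<Suc n]) i = longest_perm (Suc n) i" for i
  proof -
    have "word_perm (map Suc xs) i = (if i = 0 then 0 else Suc (longest_perm n (i - 1)))"
      unfolding word_perm_map_Suc using Suc by (simp add: xs_def)
    then show ?thesis
      unfolding word_perm_append comp_apply by (subst word_perm_upt) (auto simp: longest_perm_def)
  qed
  ultimately show ?case by (simp add: fun_eq_iff)
qed

lemma longest_perm_permutes: "longest_perm n permutes {1..n}"
  unfolding word_perm_staircase_biword[symmetric]
  by (rule word_perm_permutes) (auto simp: set_staircase_biword staircase_def)

lemma distinct_before: "sorted_wrt before b \<Longrightarrow> distinct b"
  by (induction b) (auto simp: before_def)

lemma reduced_staircase_biword: "map snd (staircase_biword n) \<in> reduced_words (longest_perm n)"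
proof -
  have "bij_betw (map_prod id Suc) (staircase n) (inversions (longest_perm n))"
    by (rule bij_betw_byWitness[of _ "map_prod id (\<lambda>j. j - 1)"])
      (auto simp: staircase_def inversions_def longest_perm_def split: if_splits)
  then have "card (staircase n) = num_inversions (longest_perm n)"
    unfolding num_inversions_inversions by (rule bij_betw_same_card)
  moreover have "length (staircase_biword n) = card (staircase n)"
    using distinct_card[OF distinct_before[OF sorted_staircase_biword]] by (simp add: set_staircase_biword)
  ultimately show ?thesis
    by (auto simp: reduced_words_def word_perm_staircase_biword set_staircase_biword staircase_def)
qed

lemma sorted_before_unique:
  assumes "sorted_wrt before b" "sorted_wrt before c" "set b = set c"
  shows "b = c"
  using assms
proof (induction b arbitrary: c)
  case (Cons x b)
  then obtain y c' where c: "c = y # c'" by (cases c) auto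
  have "x = y"
  proof (rule ccontr)
    assume "x \<noteq> y"
    then have "y \<in> set b" "x \<in> set c'" using Cons.prems(3) c by auto
    then have "before x y" "before y x" using Cons.prems c by auto
    then show False by (auto simp: before_def)
  qed
  moreover have "x \<notin> set b" "y \<notin> set c'" using distinct_before Cons.prems c by fastforce+
  ultimately have "set b = set c'" using Cons.prems(3) c by auto
  then show ?case using Cons c \<open>x = y\<close> by simp
qed simp

lemma monom_sum: "finite A \<Longrightarrow> monom (sum f A) = (\<Prod>x\<in>A. monom (f x))"
proof (induction A rule: finite_induct)
  case (insert x A)
  have "monom (f x + sum f A) = monom (f x) * monom (sum f A)" by (simp add: mult_single)
  then show ?case using insert by simp
qed simp

lemma content_eq_sum: "sorted_wrt before b \<Longrightarrow> content b = (\<Sum>x\<in>set b. unit_comp (fst x))"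
  unfolding content_def by (simp add: sum_list_distinct_conv_sum_set distinct_before)

lemma genfun_longest_perm:
  "genfun (biwords (reduced_words (longest_perm n)) flagged) = (\<Prod>i = 1..n. X i ^ (n - i))"
proof -
  have fl: "flagged x" if "x \<in> staircase n" for x using that by (auto simp: staircase_def flagged_def)
  have "b = staircase_biword n" if "b \<in> biwords (reduced_words (longest_perm n)) flagged" for b
  proof -
    have b: "sorted_wrt before b" "map snd b \<in> reduced_words (longest_perm n)" "\<forall>x\<in>set b. flagged x"
      using that by (auto simp: biwords_def)
    have "set b \<subseteq> staircase n"
    proof
      fix x assume x: "x \<in> set b"
      have "snd x < n"
        using reduced_word_letter_less[of "map snd b" n "snd x"] b(2) x longest_perm_permutes
        by (auto simp: reduced_words_iff)
      then show "x \<in> staircase n" using b(3) x by (cases x) (auto simp: staircase_def flagged_def)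
    qed
    moreover have "card (set b) = card (staircase n)"
    proof -
      have "length b = length (staircase_biword n)"
        using b(2) reduced_staircase_biword[of n] by (auto simp: reduced_words_def dest: sym)
      then show ?thesis
        using distinct_card[OF distinct_before[OF b(1)]]
          distinct_card[OF distinct_before[OF sorted_staircase_biword[of n]]]
        by (simp add: set_staircase_biword)
    qed
    moreover have "finite (staircase n)" unfolding set_staircase_biword[symmetric] by simp
    ultimately have "set b = staircase n" by (simp add: card_subset_eq)
    then show ?thesis
      using b(1) sorted_staircase_biword by (intro sorted_before_unique) (auto simp: set_staircase_biword)
  qed
  moreover have "staircase_biword n \<in> biwords (reduced_words (longest_perm n)) flagged"
    using fl reduced_staircase_biword sorted_staircase_biword by (auto simp: biwords_def set_staircase_biword)
  ultimately have "biwords (reduced_words (longest_perm n)) flagged = {staircase_biword n}" by blast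
  then have "genfun (biwords (reduced_words (longest_perm n)) flagged) = monom (content (staircase_biword n))"
    by (simp add: genfun_def)
  also have "\<dots> = (\<Prod>x\<in>staircase n. X (fst x))"
    by (simp only: content_eq_sum[OF sorted_staircase_biword] set_staircase_biword X_def,
        subst monom_sum) (auto simp: staircase_def)
  also have "\<dots> = (\<Prod>i = 1..n. \<Prod>a = i..<n. X i)"
    unfolding staircase_def by (subst prod.Sigma) (auto simp: case_prod_beta)
  finally show ?thesis by simp
qed

lemma num_inversions_bound:
  assumes "w permutes {1..n}"
  shows "num_inversions w \<le> n * n"
proof -
  have "inversions w \<subseteq> {1..n} \<times> {1..n}"
  proof clarify
    fix i j assume "(i, j) \<in> inversions w"
    then have ij: "i < j" "w j < w i" by (auto simp: inversions_def)
    have out: "w k = k" if "k \<notin> {1..n}" for k using assms that by (auto simp: permutes_def)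
    have "j \<in> {1..n}"
    proof (rule ccontr)
      assume "j \<notin> {1..n}"
      then have "n < j" "w j = j" using ij out by auto
      then have "w i \<notin> {1..n}" using ij by auto
      then have "i \<notin> {1..n}" using assms by (meson permutes_in_image)
      then show False using ij out \<open>w j = j\<close> by simp
    qed
    moreover have "i \<in> {1..n}"
    proof (rule ccontr)
      assume "i \<notin> {1..n}"
      then have "w i = 0" using out ij \<open>j \<in> {1..n}\<close> by fastforce
      then show False using ij by simp
    qed
    ultimately show "i \<in> {1..n} \<and> j \<in> {1..n}" by blast
  qed
  then show ?thesis unfolding num_inversions_inversions
    using card_mono[of "{1..n} \<times> {1..n}" "inversions w"] by simp
qed

lemma num_inversions_ascent:
  assumes "w permutes {1..n}" "1 \<le> i" "i < n" "w i < w (Suc i)"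
  shows "w \<circ> simple_transp i permutes {1..n}" "num_inversions w < num_inversions (w \<circ> simple_transp i)"
proof -
  show p: "w \<circ> simple_transp i permutes {1..n}"
    using assms by (intro permutes_compose permutes_swap_id) auto
  show "num_inversions w < num_inversions (w \<circ> simple_transp i)"
    using assms(4) finite_inversions[OF assms(1)] finite_inversions[OF p]
    by (intro num_inversions_transpose_gt) auto
qed

lemma longest_permI:
  assumes "w permutes {1..n}" "\<And>i. 1 \<le> i \<Longrightarrow> i < n \<Longrightarrow> w (Suc i) < w i"
  shows "w = longest_perm n"
proof -
  have lower: "n + 1 - i \<le> w i" if "1 \<le> i" "i \<le> n" for i
    using that(2,1)
  proof (induction i rule: inc_induct)
    case base
    then show ?case using permutes_in_image[OF assms(1), of n] by simp
  next
    case (step k)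
    then show ?case using assms(2)[of k] by simp
  qed
  have upper: "w i \<le> n + 1 - i" if "1 \<le> i" "i \<le> n" for i
    using that
  proof (induction i rule: dec_induct)
    case base
    then show ?case using permutes_in_image[OF assms(1), of 1] by simp
  next
    case (step k)
    then show ?case using assms(2)[of k] by simp
  qed
  show ?thesis
  proof
    fix i show "w i = longest_perm n i"
      using lower[of i] upper[of i] assms(1) by (auto simp: longest_perm_def permutes_def)
  qed
qed

lemma ascent_induct [consumes 1, case_names longest ascent]:
  assumes "w permutes {1..n}" "P (longest_perm n)"
    and "\<And>w i. w permutes {1..n} \<Longrightarrow> 1 \<le> i \<Longrightarrow> i < n \<Longrightarrow> w i < w (Suc i) \<Longrightarrow>
      (\<And>j. j < i \<Longrightarrow> 1 \<le> j \<Longrightarrow> w (Suc j) < w j) \<Longrightarrow> P (w \<circ> simple_transp i) \<Longrightarrow> P w"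
  shows "P w"
  using assms(1)
proof (induction "n * n - num_inversions w" arbitrary: w rule: less_induct)
  case less
  show ?case
  proof (cases "\<exists>i. 1 \<le> i \<and> i < n \<and> w i < w (Suc i)")
    case False
    have "w (Suc i) < w i" if "1 \<le> i" "i < n" for i
    proof -
      have "w (Suc i) \<noteq> w i" using less.prems by (metis n_not_Suc_n permutes_inj injD)
      then show ?thesis using False that by (meson linorder_neqE_nat)
    qed
    then have "w = longest_perm n" using less.prems by (intro longest_permI)
    then show ?thesis using assms(2) by simp
  next
    case True
    define i where "i = (LEAST i. 1 \<le> i \<and> i < n \<and> w i < w (Suc i))"
    have i: "1 \<le> i" "i < n" "w i < w (Suc i)" using LeastI_ex[OF True] by (auto simp: i_def)
    have min: "w (Suc j) < w j" if "j < i" "1 \<le> j" for j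
    proof -
      have "\<not> (1 \<le> j \<and> j < n \<and> w j < w (Suc j))" using not_less_Least that(1) unfolding i_def by blast
      moreover have "w (Suc j) \<noteq> w j" using less.prems by (metis n_not_Suc_n permutes_inj injD)
      ultimately show ?thesis using that i by linarith
    qed
    note a = num_inversions_ascent[OF less.prems i]
    have "P (w \<circ> simple_transp i)"
      using a num_inversions_bound[OF a(1)] by (intro less.hyps) auto
    then show ?thesis using assms(3) less.prems i min by blast
  qed
qed

lemma schubert_eq_genfun:
  assumes "w permutes {1..n}"
  shows "schubert n w = genfun (biwords (reduced_words w) flagged)"
proof -
  have unique: "f = genfun (biwords (reduced_words w) flagged) \<and> w permutes {1..n}" if "schubert_rel n w f" for w f
    using that
  proof (induction rule: schubert_rel.induct)
    case longest
    then show ?case using longest_perm_permutes[of n] by (simp add: genfun_longest_perm)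
  next
    case (step w f i)
    then have "w \<circ> simple_transp i permutes {1..n}" by (intro permutes_compose permutes_swap_id) auto
    then show ?case using step divdiff_genfun_reduced_words[of w n i] by metis
  qed
  have "\<exists>f. schubert_rel n w f"
    using assms
  proof (induction rule: ascent_induct)
    case longest
    then show ?case using schubert_rel.longest by blast
  next
    case (ascent w i)
    then obtain f where "schubert_rel n (w \<circ> simple_transp i) f" by blast
    then have "schubert_rel n (w \<circ> simple_transp i \<circ> simple_transp i) (divdiff i f)"
      using ascent by (intro schubert_rel.step) auto
    moreover have "w \<circ> simple_transp i \<circ> simple_transp i = w" by (simp add: fun_eq_iff)
    ultimately show ?case by auto
  qed
  then obtain f where f: "schubert_rel n w f" by blast
  then have "(THE f. schubert_rel n w f) = f" using unique by blast
  then show ?thesis unfolding schubert_def using unique f by simp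
qed

section \<open>Dominant permutations\<close>

text \<open>Equivalently, \<open>w\<close> avoids the pattern 132.\<close>

definition dominant :: "(nat \<Rightarrow> nat) \<Rightarrow> bool" where
  "dominant w \<longleftrightarrow> (\<forall>r s. 1 \<le> r \<and> Suc r < s \<longrightarrow> \<not> (w r < w s \<and> w s < w (Suc r)))"

abbreviation code :: "(nat \<Rightarrow> nat) \<Rightarrow> nat \<Rightarrow> nat" where
  "code w i \<equiv> card {j. i < j \<and> w j < w i}"

lemma finite_code: "w permutes A \<Longrightarrow> finite {j. i < j \<and> w j < (c::nat)}"
proof -
  assume "w permutes A"
  then have "finite (w -` {..<c})" by (intro finite_vimageI permutes_inj) auto
  then show ?thesis by (rule finite_subset[rotated]) auto
qed

lemma genfun_dominant:
  assumes "w permutes {1..n}" "dominant w"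
  shows "\<exists>a. genfun (biwords (reduced_words w) flagged) = monom a \<and> part a 0 = 0 \<and> (\<forall>i\<ge>1. part a i = code w i)"
  using assms
proof (induction rule: ascent_induct)
  case longest
  let ?a = "\<Sum>i = 1..n. Poly_Mapping.single i (n - i)"
  have "genfun (biwords (reduced_words (longest_perm n)) flagged) = (\<Prod>i = 1..n. monom (Poly_Mapping.single i (n - i)))"
    unfolding genfun_longest_perm single_eq_times_X ..
  also have "\<dots> = monom ?a" by (subst monom_sum) auto
  finally have 1: "genfun (biwords (reduced_words (longest_perm n)) flagged) = monom ?a" .
  have p: "part ?a i = (if i \<in> {1..n} then n - i else 0)" for i
    by (simp add: lookup_sum lookup_single when_def)
  have c: "code (longest_perm n) i = (if i \<in> {1..n} then n - i else 0)" if "1 \<le> i" for i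
  proof (cases "i \<in> {1..n}")
    case True
    then have e: "{j. i < j \<and> longest_perm n j < longest_perm n i} = {i<..n}" by (auto simp: longest_perm_def)
    show ?thesis unfolding e using True by simp
  next
    case False
    then have e: "{j. i < j \<and> longest_perm n j < longest_perm n i} = {}" using that by (auto simp: longest_perm_def)
    show ?thesis unfolding e card.empty if_not_P[OF False] ..
  qed
  show ?case using 1 p c by (intro exI[of _ ?a]) auto
next
  case (ascent w i)
  let ?w = "w \<circ> simple_transp i"
  have pw: "?w permutes {1..n}" using num_inversions_ascent ascent by blast
  have dom: "\<not> (w r < w s \<and> w s < w (Suc r))" if "1 \<le> r" "Suc r < s" for r s
    using ascent.prems that unfolding dominant_def by blast
  have "dominant ?w" unfolding dominant_def
  proof (intro allI impI notI)
    fix r s assume rs: "1 \<le> r \<and> Suc r < s" and bad: "?w r < ?w s \<and> ?w s < ?w (Suc r)"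
    consider "r = i" | "Suc r = i" | "r = Suc i" | "r \<noteq> i" "Suc r \<noteq> i" "r \<noteq> Suc i" by blast
    then show False
    proof cases
      case 1
      then show False using bad ascent.hyps by (simp add: transpose_def)
    next
      case 2
      then have "w i < w r" using ascent.hyps(5)[of r] rs by simp
      moreover have "?w r = w r" "?w (Suc r) = w (Suc i)" using 2 by (auto simp: transpose_def)
      moreover have "s = Suc i \<or> Suc i < s" using rs 2 by auto
      ultimately show False using bad dom[of i s] ascent.hyps(2) 2 rs by (auto simp: transpose_def)
    next
      case 3
      then have "?w r = w i" "?w (Suc r) = w (Suc (Suc i))" "?w s = w s" using rs by (auto simp: transpose_def)
      then show False using bad dom[of i s] dom[of "Suc i" s] ascent.hyps(2) 3 rs
        by (metis Suc_lessD linorder_neqE_nat permutes_inj[OF ascent.hyps(1)] injD less_irrefl less_imp_le order.trans le_SucI)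
    next
      case 4
      then have "?w r = w r" "?w (Suc r) = w (Suc r)" by (auto simp: transpose_def)
      moreover have "Suc r < simple_transp i s" using rs 4 by (auto simp: transpose_def)
      ultimately show False using bad dom[of r "simple_transp i s"] rs by auto
    qed
  qed
  then obtain a where a: "genfun (biwords (reduced_words ?w) flagged) = monom a" "part a 0 = 0"
    "\<And>k. 1 \<le> k \<Longrightarrow> part a k = code ?w k" using ascent.IH by blast
  note fin = finite_code[OF ascent.hyps(1)]
  have c1: "code ?w (Suc i) = code w i"
  proof -
    have "{j. Suc i < j \<and> ?w j < ?w (Suc i)} = {j. i < j \<and> w j < w i}"
      using ascent.hyps(4) by (auto simp: transpose_def Suc_lessI)
    then show ?thesis by simp
  qed
  have c2: "code w (Suc i) = code w i"
  proof -
    have "{j. Suc i < j \<and> w j < w (Suc i)} = {j. i < j \<and> w j < w i}"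
    proof (intro equalityI subsetI; clarify)
      fix j assume j: "Suc i < j" "w j < w (Suc i)"
      have "w j \<noteq> w i" using j permutes_inj[OF ascent.hyps(1)] by (metis Suc_lessD injD less_irrefl)
      then show "i < j \<and> w j < w i" using dom[of i j] j ascent.hyps(2) by auto
    next
      fix j assume j: "i < j" "w j < w i"
      then have "j \<noteq> Suc i" using ascent.hyps(4) by auto
      then show "Suc i < j \<and> w j < w (Suc i)" using j ascent.hyps(4) by auto
    qed
    then show ?thesis by simp
  qed
  have c3: "code ?w i = Suc (code w i)"
  proof -
    have "{j. i < j \<and> ?w j < ?w i} = insert (Suc i) {j. Suc i < j \<and> w j < w (Suc i)}"
      using ascent.hyps(4) by (auto simp: transpose_def Suc_lessI split: if_splits)
    then have "code ?w i = Suc (code w (Suc i))" using fin by simp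
    then show ?thesis using c2 by simp
  qed
  have c4: "code ?w k = code w k" if "k \<noteq> i" "k \<noteq> Suc i" for k
  proof -
    have "bij_betw (simple_transp i) {j. k < j \<and> ?w j < ?w k} {j. k < j \<and> w j < w k}"
      using that by (intro bij_betw_byWitness[of _ "simple_transp i"]) (auto simp: transpose_def split: if_splits)
    then show ?thesis by (rule bij_betw_same_card)
  qed
  define b where "b = a - unit_comp i"
  have ab: "a = b + unit_comp i"
    unfolding b_def using a(3)[OF ascent.hyps(2)] c3
    by (intro poly_mapping_eqI) (auto simp: lookup_add lookup_minus lookup_single when_def)
  have pb: "part b k = code w k" if "1 \<le> k" for k
  proof -
    have "part a k = code ?w k" using a(3) that by blast
    moreover have "part a k = part b k + (if k = i then 1 else 0)" unfolding ab by (simp add: lookup_add lookup_single when_def)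
    ultimately show ?thesis using c1 c2 c3 c4[of k] by (cases "k = i"; cases "k = Suc i") auto
  qed
  have sw: "swap_parts i b = b"
    using pb[of i] pb[of "Suc i"] c2 ascent.hyps(2) by (intro poly_mapping_eqI) (auto simp: transpose_def)
  have "genfun (biwords (reduced_words w) flagged) = divdiff i (monom a)"
  proof -
    have "?w (Suc i) < ?w i" using ascent.hyps by simp
    from divdiff_genfun_reduced_words[OF pw ascent.hyps(2) this]
    moreover have "?w \<circ> simple_transp i = w" by (simp add: fun_eq_iff)
    ultimately show ?thesis using a(1) by (simp only:)
  qed
  also have "\<dots> = monom b"
  proof (rule divdiff_eqI)
    have "monom a = X i * monom b" "swap_vars i (monom a) = X (Suc i) * monom b"
      using sw unfolding ab by (simp_all add: X_def mult_single swap_parts_add ac_simps)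
    then show "(X i - X (Suc i)) * monom b = monom a - swap_vars i (monom a)" by (simp add: algebra_simps)
  qed
  finally have "genfun (biwords (reduced_words w) flagged) = monom b" .
  moreover have "part b 0 = 0" using a(2) ascent.hyps(2) unfolding b_def by (simp add: lookup_minus)
  ultimately show ?case using pb by blast
qed

lemma code_dominant_decreasing:
  assumes "w permutes {1..n}" "dominant w" "1 \<le> i"
  shows "code w (Suc i) \<le> code w i"
proof (rule card_mono[OF finite_code[OF assms(1)]], clarify)
  fix j assume j: "Suc i < j" "w j < w (Suc i)"
  have "w j \<noteq> w i" using j permutes_inj[OF assms(1)] by (metis Suc_lessD injD less_irrefl)
  moreover have "\<not> (w i < w j \<and> w j < w (Suc i))" using assms(2,3) j unfolding dominant_def by blast
  ultimately show "i < j \<and> w j < w i" using j by auto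
qed

section \<open>Little bumps\<close>

definition del :: "nat \<Rightarrow> nat list \<Rightarrow> nat list" where
  "del j \<rho> = take j \<rho> @ drop (Suc j) \<rho>"

definition dec :: "nat \<Rightarrow> nat list \<Rightarrow> nat list" where
  "dec j \<rho> = \<rho>[j := \<rho> ! j - 1]"

lemma length_dec [simp]: "length (dec j \<rho>) = length \<rho>"
  by (simp add: dec_def)

lemma length_del: "j < length \<rho> \<Longrightarrow> length (del j \<rho>) = length \<rho> - 1"
  by (simp add: del_def)

lemma del_dec [simp]: "del j (dec j \<rho>) = del j \<rho>"
  by (simp add: del_def dec_def)

lemma take_dec [simp]: "take j (dec j \<rho>) = take j \<rho>"
  by (simp add: dec_def)

lemma nth_dec: "k < length \<rho> \<Longrightarrow> dec j \<rho> ! k = (if k = j then \<rho> ! k - 1 else \<rho> ! k)"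
  by (simp add: dec_def nth_list_update)

lemma del_append_middle [simp]: "del (length A) (A @ c # B) = A @ B"
  by (simp add: del_def)

lemma del_append_right: "del (length A + m) (A @ D) = A @ del m D"
  by (simp add: del_def)

lemma word_perm_cancel: "word_perm (A @ xs @ D) = word_perm (A @ ys @ D) \<longleftrightarrow> word_perm xs = word_perm ys"
proof
  assume eq: "word_perm (A @ xs @ D) = word_perm (A @ ys @ D)"
  show "word_perm xs = word_perm ys"
  proof
    fix i
    have "word_perm (A @ xs @ D) (word_perm (rev A) i) = word_perm (A @ ys @ D) (word_perm (rev A) i)"
      using eq by simp
    then show "word_perm xs i = word_perm ys i"
      by (simp add: word_perm_append word_perm_apply_rev)
  qed
qed (simp add: word_perm_append)

lemma split_at_two:
  assumes "j < k" "k < length \<rho>"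
  obtains A c B d D where "\<rho> = A @ c # B @ d # D" "length A = j" "length (A @ c # B) = k"
    "del j \<rho> = A @ B @ d # D" "del k \<rho> = A @ c # B @ D"
proof -
  define A c B d D where "A = take j \<rho>" and "c = \<rho> ! j" and "B = take (k - Suc j) (drop (Suc j) \<rho>)"
    and "d = \<rho> ! k" and "D = drop (Suc k) \<rho>"
  have 1: "\<rho> = A @ c # drop (Suc j) \<rho>" unfolding A_def c_def using assms by (intro id_take_nth_drop) simp
  have "drop (Suc j) \<rho> = B @ drop (Suc j) \<rho> ! (k - Suc j) # drop (Suc (k - Suc j)) (drop (Suc j) \<rho>)"
    unfolding B_def using assms by (intro id_take_nth_drop) simp
  then have 2: "drop (Suc j) \<rho> = B @ d # D" using assms by (simp add: d_def D_def)
  have eq: "\<rho> = A @ c # B @ d # D" using 1 2 by simp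
  have len: "length A = j" "length (A @ c # B) = k" using assms by (auto simp: A_def B_def)
  have "del j \<rho> = A @ B @ d # D" unfolding eq len(1)[symmetric] by simp
  moreover have "del k \<rho> = A @ c # B @ D"
    using del_append_middle[of "A @ c # B" d D] unfolding eq len(2)[symmetric] by simp
  ultimately show ?thesis using that eq len by blast
qed

lemma deletion_equation:
  assumes "word_perm (A @ B @ d # D) = word_perm (A @ c # B @ D)"
  shows "word_perm (c # B) = word_perm (B @ [d])"
  using assms word_perm_cancel[of A "B @ [d]" D "c # B"] by simp

lemma deletion_unique:
  assumes "j < k" "k < l" "l < length \<rho>" "word_perm (del j \<rho>) = word_perm (del k \<rho>)" "\<forall>i\<in>set \<rho>. 1 \<le> i"
  shows "\<not> reduced_word (del l \<rho>)"
proof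
  assume red: "reduced_word (del l \<rho>)"
  have k: "k < length \<rho>" using assms by simp
  obtain A c B d D where \<rho>: "\<rho> = A @ c # B @ d # D" "length (A @ c # B) = k"
    "del j \<rho> = A @ B @ d # D" "del k \<rho> = A @ c # B @ D"
    using split_at_two[OF assms(1) k] by metis
  then have eq: "word_perm (c # B) = word_perm (B @ [d])" using deletion_equation assms(4) by metis
  define m where "m = l - Suc k"
  have m: "m < length D" "l = length (A @ c # B @ [d]) + m" using \<rho> assms by (auto simp: m_def)
  have dl: "del l \<rho> = A @ (c # B) @ d # del m D"
    using del_append_right[of "A @ c # B @ [d]" m D] unfolding \<rho>(1) m(2) by simp
  have "word_perm (A @ (c # B) @ d # del m D) = word_perm (A @ (B @ [d]) @ d # del m D)"
    using eq by (rule word_perm_context)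
  moreover have "\<forall>i\<in>set (A @ (B @ [d]) @ d # del m D). 1 \<le> i"
    using assms(5) \<rho>(1) by (auto simp: del_def dest: in_set_takeD in_set_dropD)
  ultimately have "reduced_word (A @ (B @ [d]) @ d # del m D)"
    using red unfolding dl by (elim reduced_word_cong) auto
  then show False using not_reduced_word_repeat[of "A @ B" d "del m D"] by simp
qed

lemma deletion_unique_reduced:
  assumes "reduced_word \<rho>" "j < length \<rho>" "k < length \<rho>" "word_perm (del j \<rho>) = word_perm (del k \<rho>)"
  shows "j = k"
proof (rule ccontr)
  assume "j \<noteq> k"
  have False if jk: "j < k" "k < length \<rho>" "word_perm (del j \<rho>) = word_perm (del k \<rho>)" for j k
  proof -
    obtain A c B d D where \<rho>: "\<rho> = A @ c # B @ d # D"
      "del j \<rho> = A @ B @ d # D" "del k \<rho> = A @ c # B @ D"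
      using split_at_two[OF jk(1,2)] by metis
    then have "word_perm (c # B) = word_perm (B @ [d])" using deletion_equation jk(3) by metis
    then have "word_perm (A @ (c # B) @ d # D) = word_perm (A @ (B @ [d]) @ d # D)" by (rule word_perm_context)
    then have "reduced_word (A @ (B @ [d]) @ d # D)"
      using assms(1) unfolding \<rho>(1) by (auto simp: reduced_word_iff)
    then show False using not_reduced_word_repeat[of "A @ B" d D] by simp
  qed
  then show False using assms \<open>j \<noteq> k\<close> by (metis linorder_neqE_nat)
qed

text \<open>A marked word \<open>(\<rho>, j)\<close> becomes a reduced word of \<open>v\<close> when its letter \<open>\<rho> ! j\<close> is deleted.
  The wire that ends in position \<open>r\<close> passes the marked column at height \<open>\<rho> ! j\<close> before the
  letter is decremented and at height \<open>\<rho> ! j + 1\<close> afterwards.\<close>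

definition marked :: "nat \<Rightarrow> (nat \<Rightarrow> nat) \<Rightarrow> nat \<Rightarrow> nat list \<times> nat \<Rightarrow> bool" where
  "marked h v r = (\<lambda>(\<rho>, j). j < length \<rho> \<and> (\<forall>i\<in>set \<rho>. 1 \<le> i) \<and> reduced_word (del j \<rho>) \<and>
     word_perm (del j \<rho>) = v \<and> word_perm (take j \<rho>) r = \<rho> ! j + h)"

definition bump_step :: "nat list \<times> nat \<Rightarrow> nat list \<times> nat \<Rightarrow> bool" where
  "bump_step = (\<lambda>(\<rho>, j) s. \<exists>k. k < length \<rho> \<and> j < length \<rho> \<and> k \<noteq> j \<and> word_perm (del k \<rho>) = word_perm (del j \<rho>) \<and>
     s = (dec k \<rho>, k))"

lemma word_perm_ge_1:
  assumes "\<forall>i\<in>set xs. 1 \<le> i" "1 \<le> a"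
  shows "1 \<le> word_perm xs a"
proof -
  have "word_perm xs 0 = 0" using assms(1) by (induction xs) (auto simp: word_perm_Cons transpose_def)
  then have "word_perm xs a \<noteq> 0" using word_perm_eq_iff[of xs a 0] assms(2) by simp
  then show ?thesis by simp
qed

lemma marked_nextI:
  assumes "marked 1 v r (\<rho>, j)" "k < length \<rho>" "k \<noteq> j" "word_perm (del k \<rho>) = word_perm (del j \<rho>)"
  shows "marked 0 v r (\<rho>, k)"
proof -
  have s: "j < length \<rho>" "\<forall>i\<in>set \<rho>. 1 \<le> i" "reduced_word (del j \<rho>)" "word_perm (del j \<rho>) = v"
    "word_perm (take j \<rho>) r = Suc (\<rho> ! j)" using assms(1) by (auto simp: marked_def)
  have "\<forall>i\<in>set (del k \<rho>). 1 \<le> i" using s(2) by (auto simp: del_def dest: in_set_takeD in_set_dropD)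
  then have red: "reduced_word (del k \<rho>)"
    using reduced_word_cong[OF assms(4)[symmetric] _ _ s(3)] assms(2) s(1) by (simp add: length_del)
  have "word_perm (take k \<rho>) r = \<rho> ! k"
  proof (cases "j < k")
    case True
    obtain A c B d D where \<rho>: "\<rho> = A @ c # B @ d # D" "length A = j" "length (A @ c # B) = k"
      "del j \<rho> = A @ B @ d # D" "del k \<rho> = A @ c # B @ D"
      using split_at_two[OF True assms(2)] by metis
    have eq: "word_perm (c # B) = word_perm (B @ [d])" using deletion_equation assms(4) \<rho> by metis
    have "reduced_word (c # B)"
      using red reduced_word_appendD1[of "c # B" D] reduced_word_appendD2[of A "c # B @ D"] \<rho> by simp
    then have lt: "word_perm B c < word_perm B (Suc c)" by (simp add: reduced_word_Cons)
    have "word_perm (c # B) (Suc c) = word_perm (B @ [d]) (Suc c)" "word_perm (c # B) c = word_perm (B @ [d]) c"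
      using eq by auto
    then have "word_perm B c = simple_transp d (word_perm B (Suc c))" "word_perm B (Suc c) = simple_transp d (word_perm B c)"
      by (auto simp: word_perm_snoc word_perm_Cons)
    then have Bc: "word_perm B c = d" using lt by (auto simp: transpose_def split: if_splits)
    have tj: "take j \<rho> = A" "\<rho> ! j = c" using \<rho>(1,2) by auto
    have tk: "take k \<rho> = A @ c # B" "\<rho> ! k = d" unfolding \<rho>(1) \<rho>(3)[symmetric] by (simp_all add: nth_append)
    show ?thesis using s(5) Bc unfolding tj tk by (simp add: word_perm_append word_perm_Cons)
  next
    case False
    then have "k < j" using assms(3) by simp
    obtain A d B c D where \<rho>: "\<rho> = A @ d # B @ c # D" "length A = k" "length (A @ d # B) = j"
      "del k \<rho> = A @ B @ c # D" "del j \<rho> = A @ d # B @ D"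
      using split_at_two[OF \<open>k < j\<close> s(1)] by metis
    have eq: "word_perm (d # B) = word_perm (B @ [c])" using deletion_equation assms(4) \<rho> by metis
    have "reduced_word (d # B)"
      using s(3) reduced_word_appendD1[of "d # B" D] reduced_word_appendD2[of A "d # B @ D"] \<rho> by simp
    then have lt: "word_perm B d < word_perm B (Suc d)" by (simp add: reduced_word_Cons)
    have "word_perm (d # B) (Suc d) = word_perm (B @ [c]) (Suc d)" "word_perm (d # B) d = word_perm (B @ [c]) d"
      using eq by auto
    then have "word_perm B d = simple_transp c (word_perm B (Suc d))" "word_perm B (Suc d) = simple_transp c (word_perm B d)"
      by (auto simp: word_perm_snoc word_perm_Cons)
    then have Bd: "word_perm B d = c" using lt by (auto simp: transpose_def split: if_splits)
    have tk: "take k \<rho> = A" "\<rho> ! k = d" using \<rho>(1,2) by auto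
    have tj: "take j \<rho> = A @ d # B" "\<rho> ! j = c" unfolding \<rho>(1) \<rho>(3)[symmetric] by (simp_all add: nth_append)
    have "word_perm (d # B) (word_perm A r) = Suc c" using s(5) unfolding tj by (simp add: word_perm_append)
    then have "simple_transp c (word_perm B (word_perm A r)) = Suc c" unfolding eq word_perm_snoc .
    then have "word_perm B (word_perm A r) = word_perm B d" using Bd by (metis transpose_apply_second transpose_involutory)
    then show ?thesis unfolding tk by simp
  qed
  then show ?thesis using s red assms(2,4) by (simp add: marked_def)
qed

context
  fixes v :: "nat \<Rightarrow> nat" and r :: nat
  assumes r: "2 \<le> r" "v (r - 1) < v r"
begin

lemma marked_dec:
  assumes "marked 0 v r (\<rho>, k)"
  shows "2 \<le> \<rho> ! k" "marked 1 v r (dec k \<rho>, k)"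
proof -
  have s: "k < length \<rho>" "\<forall>i\<in>set \<rho>. 1 \<le> i" "reduced_word (del k \<rho>)" "word_perm (del k \<rho>) = v"
    "word_perm (take k \<rho>) r = \<rho> ! k" using assms by (auto simp: marked_def)
  have "\<not> word_perm (take k \<rho>) r < word_perm (take k \<rho>) (r - 1)"
  proof
    assume "word_perm (take k \<rho>) r < word_perm (take k \<rho>) (r - 1)"
    moreover have "r - 1 < r" using r by simp
    ultimately have "word_perm (del k \<rho>) r < word_perm (del k \<rho>) (r - 1)"
      using reduced_word_inversion_persists s(3) unfolding del_def by blast
    then show False using r s(4) by simp
  qed
  moreover have "word_perm (take k \<rho>) r \<noteq> word_perm (take k \<rho>) (r - 1)" using r by simp
  moreover have "1 \<le> word_perm (take k \<rho>) (r - 1)"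
    using s(2) r by (intro word_perm_ge_1) (auto dest: in_set_takeD)
  ultimately show ge: "2 \<le> \<rho> ! k" using s(5) by linarith
  have "\<forall>i\<in>set (dec k \<rho>). 1 \<le> i"
    using s(2) ge set_update_subset_insert[of \<rho> k "\<rho> ! k - 1"] by (auto simp: dec_def)
  then show "marked 1 v r (dec k \<rho>, k)" using s ge by (simp add: marked_def nth_dec)
qed

lemma bump_stepE:
  assumes "bump_step (\<rho>, j) s" "marked 1 v r (\<rho>, j)"
  obtains k where "s = (dec k \<rho>, k)" "k < length \<rho>" "k \<noteq> j" "word_perm (del k \<rho>) = word_perm (del j \<rho>)"
    "marked 0 v r (\<rho>, k)"
  using assms marked_nextI unfolding bump_step_def by blast

lemma marked_bump_step:
  assumes "bump_step s s'" "marked 1 v r s"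
  shows "marked 1 v r s'"
proof (cases s)
  case (Pair \<rho> j)
  then show ?thesis using assms bump_stepE[of \<rho> j s'] marked_dec(2) by metis
qed

lemma marked_bump_steps:
  assumes "bump_step\<^sup>*\<^sup>* s s'" "marked 1 v r s"
  shows "marked 1 v r s'"
  using assms by (induction rule: rtranclp_induct) (use marked_bump_step in blast)+

lemma mark_unique:
  assumes "marked 1 v r (\<rho>, j)" "k < length \<rho>" "l < length \<rho>" "k \<noteq> j" "l \<noteq> j"
    "word_perm (del k \<rho>) = v" "word_perm (del l \<rho>) = v"
  shows "k = l"
proof (rule ccontr)
  assume "k \<noteq> l"
  have s: "j < length \<rho>" "\<forall>i\<in>set \<rho>. 1 \<le> i" "reduced_word (del j \<rho>)" "word_perm (del j \<rho>) = v"
    using assms(1) by (auto simp: marked_def)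
  have red: "reduced_word (del i \<rho>)" if "word_perm (del i \<rho>) = v" "i < length \<rho>" for i
  proof (rule reduced_word_cong[OF _ _ _ s(3)])
    show "\<forall>i\<in>set (del i \<rho>). 1 \<le> i" using s(2) by (auto simp: del_def dest: in_set_takeD in_set_dropD)
  qed (use that s length_del in auto)
  have no: False if "i1 < i2" "i2 < i3" "i3 < length \<rho>" "word_perm (del i1 \<rho>) = v" "word_perm (del i2 \<rho>) = v" "word_perm (del i3 \<rho>) = v" for i1 i2 i3
    using deletion_unique[OF that(1-3) _ s(2)] red that by metis
  show False using no[of j k l] no[of j l k] no[of k j l] no[of l j k] no[of k l j] no[of l k j] assms s \<open>k \<noteq> l\<close>
    by (metis linorder_neqE_nat)
qed

lemma bump_step_deterministic:
  assumes "marked 1 v r s" "bump_step s s1" "bump_step s s2"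
  shows "s1 = s2"
proof (cases s)
  case (Pair \<rho> j)
  have v: "word_perm (del j \<rho>) = v" using assms(1) Pair by (simp add: marked_def)
  obtain k where k: "s1 = (dec k \<rho>, k)" "k < length \<rho>" "k \<noteq> j" "word_perm (del k \<rho>) = word_perm (del j \<rho>)"
    using assms Pair bump_stepE by metis
  obtain l where l: "s2 = (dec l \<rho>, l)" "l < length \<rho>" "l \<noteq> j" "word_perm (del l \<rho>) = word_perm (del j \<rho>)"
    using assms Pair bump_stepE by metis
  have "k = l" using mark_unique k l v assms(1) Pair by metis
  then show ?thesis using k l by simp
qed

lemma bump_step_not_reduced:
  assumes "bump_step (\<rho>, j) s"
  shows "\<not> reduced_word \<rho>"
  using assms deletion_unique_reduced unfolding bump_step_def by blast

lemma marked_word_perm: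
  assumes "marked 1 v r (\<rho>, j)"
  obtains q where "q \<noteq> r" "word_perm (take j \<rho>) q = \<rho> ! j" "word_perm \<rho> = v \<circ> Transposition.transpose q r"
proof -
  have s: "j < length \<rho>" "word_perm (del j \<rho>) = v" "word_perm (take j \<rho>) r = Suc (\<rho> ! j)"
    using assms by (auto simp: marked_def)
  define q where "q = word_perm (rev (take j \<rho>)) (\<rho> ! j)"
  have q: "word_perm (take j \<rho>) q = \<rho> ! j" by (simp add: q_def word_perm_apply_rev)
  then have "q \<noteq> r" using s(3) by auto
  have "\<rho> = take j \<rho> @ \<rho> ! j # drop (Suc j) \<rho>" using s(1) by (rule id_take_nth_drop)
  then have "word_perm \<rho> = word_perm (drop (Suc j) \<rho>) \<circ> simple_transp (\<rho> ! j) \<circ> word_perm (take j \<rho>)"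
    using word_perm_append[of "take j \<rho>" "\<rho> ! j # drop (Suc j) \<rho>"] by (simp add: word_perm_Cons)
  moreover have "simple_transp (\<rho> ! j) (word_perm (take j \<rho>) i) = word_perm (take j \<rho>) (Transposition.transpose q r i)" for i
  proof -
    have "word_perm (take j \<rho>) i = \<rho> ! j \<longleftrightarrow> i = q" "word_perm (take j \<rho>) i = Suc (\<rho> ! j) \<longleftrightarrow> i = r"
      using q s(3) word_perm_eq_iff by metis+
    then show ?thesis using q s(3) by (auto simp: transpose_def)
  qed
  moreover have "v = word_perm (drop (Suc j) \<rho>) \<circ> word_perm (take j \<rho>)"
    using s(2) by (simp add: del_def word_perm_append)
  ultimately have "word_perm \<rho> = v \<circ> Transposition.transpose q r" by (simp add: fun_eq_iff)
  then show ?thesis using that q \<open>q \<noteq> r\<close> by blast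
qed

lemma marked_reduced_iff:
  assumes "marked 1 v r (\<rho>, j)" "word_perm (take j \<rho>) q = \<rho> ! j"
  shows "reduced_word \<rho> \<longleftrightarrow> q < r \<and> v q < v r"
proof -
  have s: "j < length \<rho>" "\<forall>i\<in>set \<rho>. 1 \<le> i" "reduced_word (del j \<rho>)" "word_perm (del j \<rho>) = v"
    "word_perm (take j \<rho>) r = Suc (\<rho> ! j)" using assms by (auto simp: marked_def)
  obtain q' where q': "q' \<noteq> r" "word_perm (take j \<rho>) q' = \<rho> ! j" "word_perm \<rho> = v \<circ> Transposition.transpose q' r"
    using marked_word_perm[OF assms(1)] by blast
  then have "q' = q" using assms(2) by (metis word_perm_eq_iff)
  note q = q'[unfolded \<open>q' = q\<close>]
  have eq: "\<rho> = take j \<rho> @ \<rho> ! j # drop (Suc j) \<rho>" using s(1) by (rule id_take_nth_drop)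
  have fin: "finite (inversions v)" "finite (inversions (v \<circ> Transposition.transpose q r))"
    using finite_inversions_word_perm[of "del j \<rho>"] finite_inversions_word_perm[of \<rho>] s(4) q(3) by simp_all
  have len: "length \<rho> = Suc (num_inversions v)"
    using s(1,3,4) length_del[of j \<rho>] unfolding reduced_word_iff by simp linarith
  show ?thesis
  proof
    assume red: "reduced_word \<rho>"
    have "reduced_word (take j \<rho> @ [\<rho> ! j])"
      using red eq reduced_word_appendD1[of "take j \<rho> @ [\<rho> ! j]" "drop (Suc j) \<rho>"] by simp
    then have "word_perm (rev (take j \<rho>)) (\<rho> ! j) < word_perm (rev (take j \<rho>)) (Suc (\<rho> ! j))"
      by (simp add: reduced_word_snoc)
    then have "q < r" using q(2) s(5) by (metis word_perm_rev_eq_iff)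
    moreover have "reduced_word (\<rho> ! j # drop (Suc j) \<rho>)"
      using red eq reduced_word_appendD2 by metis
    then have "word_perm (drop (Suc j) \<rho>) (\<rho> ! j) < word_perm (drop (Suc j) \<rho>) (Suc (\<rho> ! j))"
      by (simp add: reduced_word_Cons)
    then have "v q < v r" using q(2) s(5) unfolding s(4)[symmetric] del_def word_perm_append by simp
    ultimately show "q < r \<and> v q < v r" by blast
  next
    assume "q < r \<and> v q < v r"
    then have "num_inversions v < num_inversions (word_perm \<rho>)"
      unfolding q(3) using fin by (intro num_inversions_transpose_gt) auto
    then show "reduced_word \<rho>" using s(2) len num_inversions_le_length[of \<rho>] by (simp add: reduced_word_iff)
  qed
qed

lemma bump_step_exists:
  assumes "marked 1 v r (\<rho>, j)" "\<not> reduced_word \<rho>"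
  shows "\<exists>s. bump_step (\<rho>, j) s"
proof -
  have s: "j < length \<rho>" "\<forall>i\<in>set \<rho>. 1 \<le> i" "reduced_word (del j \<rho>)" "word_perm (del j \<rho>) = v"
    "word_perm (take j \<rho>) r = Suc (\<rho> ! j)" using assms by (auto simp: marked_def)
  obtain q where q: "q \<noteq> r" "word_perm (take j \<rho>) q = \<rho> ! j" using marked_word_perm[OF assms(1)] by blast
  then consider "r < q" | "v r < v q"
    using marked_reduced_iff[OF assms(1) q(2)] assms(2) s(4) word_perm_eq_iff[of "del j \<rho>" q r]
    by (metis linorder_neqE_nat)
  then show ?thesis
  proof cases
    case 1
    then obtain B d D where split: "take j \<rho> = B @ d # D" "word_perm B r = d" "word_perm B q = Suc d"
      using word_perm_crossing[of r q "take j \<rho>"] q(2) s(5) by auto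
    have eq: "\<rho> = B @ d # D @ \<rho> ! j # drop (Suc j) \<rho>" using id_take_nth_drop[OF s(1)] split(1) by simp
    have lenj: "j = length (B @ d # D)" using split(1) s(1) by (metis length_take min.absorb2 less_imp_le)
    define e where "e = \<rho> ! j"
    have De: "word_perm D (Suc d) = Suc e" "word_perm D d = e"
      using q(2) s(5) split unfolding e_def by (simp_all add: word_perm_append word_perm_Cons)
    have "word_perm (d # D) = word_perm (D @ [e])"
    proof
      fix i
      have "word_perm D i = e \<longleftrightarrow> i = d" "word_perm D i = Suc e \<longleftrightarrow> i = Suc d" using De word_perm_eq_iff by metis+
      then show "word_perm (d # D) i = word_perm (D @ [e]) i"
        using De by (auto simp: word_perm_snoc word_perm_Cons transpose_def)
    qed
    then have "word_perm (B @ (d # D) @ drop (Suc j) \<rho>) = word_perm (B @ (D @ [e]) @ drop (Suc j) \<rho>)"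
      by (rule word_perm_context)
    moreover have "del j \<rho> = B @ (d # D) @ drop (Suc j) \<rho>" unfolding del_def split(1) by simp
    moreover have "del (length B) \<rho> = B @ (D @ [e]) @ drop (Suc j) \<rho>"
      by (subst eq) (simp add: e_def del_append_middle)
    moreover have "length B < length \<rho>" "length B \<noteq> j" using lenj s(1) by auto
    ultimately show ?thesis using s(1) unfolding bump_step_def by auto
  next
    case 2
    let ?C = "drop (Suc j) \<rho>"
    have vC: "v q = word_perm ?C (\<rho> ! j)" "v r = word_perm ?C (Suc (\<rho> ! j))"
      using q(2) s(5) unfolding s(4)[symmetric] del_def word_perm_append by simp_all
    then obtain B d D where split: "?C = B @ d # D" "word_perm B (\<rho> ! j) = d" "word_perm B (Suc (\<rho> ! j)) = Suc d"
      using word_perm_crossing[of "\<rho> ! j" "Suc (\<rho> ! j)" ?C] 2 by auto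
    define e where "e = \<rho> ! j"
    have eq: "\<rho> = take j \<rho> @ e # B @ d # D" using id_take_nth_drop[OF s(1)] split(1) by (simp add: e_def)
    have "word_perm (e # B) = word_perm (B @ [d])"
    proof
      fix i
      have "word_perm B i = d \<longleftrightarrow> i = e" "word_perm B i = Suc d \<longleftrightarrow> i = Suc e" using split word_perm_eq_iff unfolding e_def by metis+
      then show "word_perm (e # B) i = word_perm (B @ [d]) i"
        using split by (auto simp: word_perm_snoc word_perm_Cons transpose_def e_def)
    qed
    then have w: "word_perm (take j \<rho> @ (e # B) @ D) = word_perm (take j \<rho> @ (B @ [d]) @ D)"
      by (rule word_perm_context)
    have d1: "del j \<rho> = take j \<rho> @ (B @ [d]) @ D" unfolding del_def split(1) by simp
    define k where "k = length (take j \<rho> @ e # B)"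
    have "\<rho> = (take j \<rho> @ e # B) @ d # D" using eq by simp
    then have "del k \<rho> = (take j \<rho> @ e # B) @ D" unfolding k_def by (metis del_append_middle)
    moreover have "k < length \<rho>" using \<open>\<rho> = (take j \<rho> @ e # B) @ d # D\<close> unfolding k_def
      by (metis length_append less_add_same_cancel1 length_greater_0_conv list.distinct(1))
    moreover have "k \<noteq> j" using s(1) by (simp add: k_def)
    ultimately have "k < length \<rho> \<and> j < length \<rho> \<and> k \<noteq> j \<and> word_perm (del k \<rho>) = word_perm (del j \<rho>)"
      using w d1 s(1) by simp
    then show ?thesis unfolding bump_step_def by blast
  qed
qed

lemma sum_list_dec: "k < length \<rho> \<Longrightarrow> 0 < \<rho> ! k \<Longrightarrow> sum_list (dec k \<rho>) < sum_list \<rho>"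
  unfolding dec_def
proof (induction \<rho> arbitrary: k)
  case (Cons a \<rho>)
  then show ?case by (cases k) auto
qed simp

lemma bump_step_sum_list:
  assumes "bump_step s s'" "marked 1 v r s"
  shows "sum_list (fst s') < sum_list (fst s)"
proof (cases s)
  case (Pair \<rho> j)
  then obtain k where "s' = (dec k \<rho>, k)" "k < length \<rho>" "marked 0 v r (\<rho>, k)"
    using assms bump_stepE by metis
  then show ?thesis using sum_list_dec marked_dec(1)[of \<rho> k] Pair by simp
qed

lemma bump_terminates:
  assumes "marked 1 v r s"
  shows "\<exists>f. bump_step\<^sup>*\<^sup>* s f \<and> reduced_word (fst f)"
  using assms
proof (induction "sum_list (fst s)" arbitrary: s rule: less_induct)
  case less
  show ?case
  proof (cases "reduced_word (fst s)")
    case False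
    then obtain s' where s': "bump_step s s'" using bump_step_exists[of "fst s" "snd s"] less.prems by auto
    then obtain f where "bump_step\<^sup>*\<^sup>* s' f" "reduced_word (fst f)"
      using less.hyps[OF bump_step_sum_list] less.prems marked_bump_step by blast
    then show ?thesis using s' by (meson converse_rtranclp_into_rtranclp)
  qed blast
qed

lemma bump_steps_confluent:
  assumes "bump_step\<^sup>*\<^sup>* s t" "marked 1 v r s" "bump_step\<^sup>*\<^sup>* s f" "reduced_word (fst f)"
  shows "bump_step\<^sup>*\<^sup>* t f"
  using assms
proof (induction rule: converse_rtranclp_induct)
  case (step s s1)
  from step.prems(2) show ?case
  proof (cases rule: converse_rtranclpE)
    case base
    then show ?thesis using step.hyps(1) step.prems(3) bump_step_not_reduced[of "fst s" "snd s" s1] by simp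
  next
    case (step s2)
    then show ?thesis using step.IH step.hyps step.prems bump_step_deterministic marked_bump_step by metis
  qed
qed simp

end

section \<open>Little bumps commute with Coxeter--Knuth moves\<close>

text \<open>Matching positions of a window before and after a Coxeter--Knuth move (up to symmetry):
  deleting matched letters gives words of the same permutation. The middle letter of a braid is unmatched.\<close>

inductive match :: "nat list \<Rightarrow> nat \<Rightarrow> nat list \<Rightarrow> nat \<Rightarrow> bool" where
  "a < b \<Longrightarrow> b < c \<Longrightarrow> match [b, a, c] 0 [b, c, a] 0"
| "a < b \<Longrightarrow> b < c \<Longrightarrow> match [b, a, c] 1 [b, c, a] 2"
| "a < b \<Longrightarrow> b < c \<Longrightarrow> match [b, a, c] 2 [b, c, a] 1"
| "a < b \<Longrightarrow> b < c \<Longrightarrow> match [a, c, b] 0 [c, a, b] 1"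
| "a < b \<Longrightarrow> b < c \<Longrightarrow> match [a, c, b] 1 [c, a, b] 0"
| "a < b \<Longrightarrow> b < c \<Longrightarrow> match [a, c, b] 2 [c, a, b] 2"
| "y = Suc x \<Longrightarrow> match [x, y, x] 0 [y, x, y] 2"
| "y = Suc x \<Longrightarrow> match [x, y, x] 2 [y, x, y] 0"

definition matched :: "nat \<Rightarrow> nat list \<times> nat \<Rightarrow> nat list \<times> nat \<Rightarrow> bool" where
  "matched i s s' \<longleftrightarrow> (\<exists>A B T T'. length A = i \<and> fst s = A @ T @ B \<and> fst s' = A @ T' @ B \<and>
     (ck_triple T T' \<and> snd s = snd s' \<and> (snd s < i \<or> i + 3 \<le> snd s \<and> snd s < length (A @ T @ B)) \<or>
      (\<exists>t t'. snd s = i + t \<and> snd s' = i + t' \<and> (match T t T' t' \<or> match T' t' T t))))"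

lemma match_ck_triple: "match T t T' t' \<Longrightarrow> ck_triple T T' \<and> t < 3 \<and> t' < 3"
  by (induction rule: match.induct) (auto intro: ck_triple.intros)

lemma match_word_perm_del: "match T t T' t' \<Longrightarrow> word_perm (del t T) = word_perm (del t' T')"
  by (induction rule: match.induct)
    (auto simp: del_def word_perm_far_commute numeral_2_eq_2)

lemma match_injective:
  assumes "match T t T' m \<or> match T' m T t" "match T u T' m \<or> match T' m T u"
  shows "t = u"
  using assms by (elim disjE match.cases) auto

lemma match_exists:
  assumes "ck_triple T T'" "t < 3" "\<not> (\<exists>x y z. T = [x, y, z] \<and> t = 1 \<and> x = z)"
  shows "\<exists>t'. match T t T' t' \<or> match T' t' T t"
proof -
  have t: "t = 0 \<or> t = 1 \<or> t = 2" using assms(2) by auto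
  show ?thesis
    using assms(1)
  proof (cases rule: ck_triple.cases)
    case (1 q p r) then show ?thesis using t match.intros(1-3) by blast
  next
    case (2 r p q) then show ?thesis using t match.intros(1-3) by blast
  next
    case (3 p r q) then show ?thesis using t match.intros(4-6) by blast
  next
    case (4 q r p) then show ?thesis using t match.intros(4-6) by blast
  next
    case (5 q p) then show ?thesis using t assms(3) match.intros(7,8) by blast
  next
    case (6 p q) then show ?thesis using t assms(3) match.intros(7,8) by blast
  qed
qed

lemma del_append: "del j (A @ B) = (if j < length A then del j A @ B else A @ del (j - length A) B)"
  by (auto simp: del_def Suc_diff_le)

lemma dec_append: "dec j (A @ B) = (if j < length A then dec j A @ B else A @ dec (j - length A) B)"
  by (auto simp: dec_def list_update_append nth_append)

lemma matched_outsideI: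
  assumes "ck_triple T T'" "j < length A \<or> length A + 3 \<le> j \<and> j < length (A @ T @ B)"
  shows "matched (length A) (A @ T @ B, j) (A @ T' @ B, j)"
  unfolding matched_def fst_conv snd_conv
  by (rule exI[of _ A], rule exI[of _ B], rule exI[of _ T], rule exI[of _ T']) (use assms in simp)

lemma matched_insideI:
  assumes "match T t T' t' \<or> match T' t' T t"
  shows "matched (length A) (A @ T @ B, length A + t) (A @ T' @ B, length A + t')"
  unfolding matched_def fst_conv snd_conv
  by (rule exI[of _ A], rule exI[of _ B], rule exI[of _ T], rule exI[of _ T']) (use assms in simp)

lemma matchedE:
  assumes "matched i (\<rho>, j) (\<sigma>, j')"
  obtains A B T T' where "i = length A" "\<rho> = A @ T @ B" "\<sigma> = A @ T' @ B" "ck_triple T T'"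
    "length T = 3" "length T' = 3"
    "j = j' \<and> (j < length A \<or> length A + 3 \<le> j \<and> j < length \<rho>) \<or>
      (\<exists>t t'. j = length A + t \<and> j' = length A + t' \<and> (match T t T' t' \<or> match T' t' T t))"
proof -
  from assms obtain A B T T' where *: "length A = i" "\<rho> = A @ T @ B" "\<sigma> = A @ T' @ B"
    "ck_triple T T' \<and> j = j' \<and> (j < i \<or> i + 3 \<le> j \<and> j < length (A @ T @ B)) \<or>
      (\<exists>t t'. j = i + t \<and> j' = i + t' \<and> (match T t T' t' \<or> match T' t' T t))"
    unfolding matched_def fst_conv snd_conv by (elim exE conjE)
  from *(4) have ck: "ck_triple T T'"
    by (elim disjE exE conjE) (use match_ck_triple ck_triple_sym in metis)+
  show ?thesis
  proof (rule that[of A T B T'])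
    show "j = j' \<and> (j < length A \<or> length A + 3 \<le> j \<and> j < length \<rho>) \<or>
      (\<exists>t t'. j = length A + t \<and> j' = length A + t' \<and> (match T t T' t' \<or> match T' t' T t))"
      using *(4) unfolding *(1)[symmetric] *(2) by (rule disjE) (rule disjI1, blast, rule disjI2, assumption)
  qed (use * ck ck_triple_length[OF ck] in simp_all)
qed

lemma matched_ck_at:
  assumes "matched i s s'"
  shows "ck_at i (fst s) (fst s')"
proof -
  have "matched i (fst s, snd s) (fst s', snd s')" using assms by simp
  then obtain A B T T' where "i = length A" "fst s = A @ T @ B" "fst s' = A @ T' @ B" "ck_triple T T'"
    by (rule matchedE)
  then show ?thesis unfolding ck_at_def by (intro exI[of _ A] exI[of _ T] exI[of _ T'] exI[of _ B]) simp
qed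

lemma matched_word_perm_del:
  assumes "matched i (\<rho>, j) (\<sigma>, j')"
  shows "word_perm (del j \<rho>) = word_perm (del j' \<sigma>)" "j < length \<rho>" "j' < length \<sigma>"
proof -
  obtain A B T T' where *: "i = length A" "\<rho> = A @ T @ B" "\<sigma> = A @ T' @ B" "ck_triple T T'"
    "length T = 3" "length T' = 3"
    "j = j' \<and> (j < length A \<or> length A + 3 \<le> j \<and> j < length \<rho>) \<or>
      (\<exists>t t'. j = length A + t \<and> j' = length A + t' \<and> (match T t T' t' \<or> match T' t' T t))"
    using assms by (rule matchedE)
  have "word_perm (del j \<rho>) = word_perm (del j' \<sigma>) \<and> j < length \<rho> \<and> j' < length \<sigma>"
    using *(7)
  proof
    assume "j = j' \<and> (j < length A \<or> length A + 3 \<le> j \<and> j < length \<rho>)"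
    then show ?thesis unfolding *(2,3) using ck_triple_word_perm[OF *(4)] *(5,6)
      by (auto simp: del_append word_perm_append)
  next
    assume "\<exists>t t'. j = length A + t \<and> j' = length A + t' \<and> (match T t T' t' \<or> match T' t' T t)"
    then obtain t t' where t: "j = length A + t" "j' = length A + t'" "match T t T' t' \<or> match T' t' T t" by blast
    from t(3) have "word_perm (del t T) = word_perm (del t' T') \<and> t < 3 \<and> t' < 3"
    proof
      assume "match T t T' t'"
      then show ?thesis using match_word_perm_del[of T t T' t'] match_ck_triple[of T t T' t'] by simp
    next
      assume "match T' t' T t"
      then show ?thesis using match_word_perm_del[of T' t' T t] match_ck_triple[of T' t' T t] by simp
    qed
    then show ?thesis unfolding *(2,3) t using *(5,6)
      by (simp add: del_append word_perm_append)
  qed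
  then show "word_perm (del j \<rho>) = word_perm (del j' \<sigma>)" "j < length \<rho>" "j' < length \<sigma>" by blast+
qed

lemma match_less_3: "match T t T' t' \<or> match T' t' T t \<Longrightarrow> t < 3 \<and> t' < 3"
  by (elim disjE) (simp_all add: match_ck_triple)

lemma matched_injective:
  assumes "matched i (\<rho>, j) (\<sigma>, m)" "matched i (\<rho>, k) (\<sigma>, m)"
  shows "j = k"
proof -
  obtain A B T T' where 1: "i = length A" "\<rho> = A @ T @ B" "\<sigma> = A @ T' @ B" "ck_triple T T'"
    "length T = 3" "length T' = 3"
    "j = m \<and> (j < length A \<or> length A + 3 \<le> j \<and> j < length \<rho>) \<or>
      (\<exists>t t'. j = length A + t \<and> m = length A + t' \<and> (match T t T' t' \<or> match T' t' T t))"
    using assms(1) by (rule matchedE)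
  obtain A2 B2 U U' where 2: "i = length A2" "\<rho> = A2 @ U @ B2" "\<sigma> = A2 @ U' @ B2" "ck_triple U U'"
    "length U = 3" "length U' = 3"
    "k = m \<and> (k < length A2 \<or> length A2 + 3 \<le> k \<and> k < length \<rho>) \<or>
      (\<exists>t t'. k = length A2 + t \<and> m = length A2 + t' \<and> (match U t U' t' \<or> match U' t' U t))"
    using assms(2) by (rule matchedE)
  have eq: "A2 = A" "U = T" "U' = T'" using 1 2 by auto
  note 2 = 2(7)[unfolded eq]
  show ?thesis
  proof (cases "m < length A \<or> length A + 3 \<le> m")
    case True
    then have no: "\<not> (m = length A + t' \<and> (match T t T' t' \<or> match T' t' T t))" for t t'
      using match_less_3[of T t T' t'] by auto
    have "j = m" using 1(7) no by blast
    moreover have "k = m" using 2 no by blast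
    ultimately show ?thesis by simp
  next
    case False
    then obtain t m1 where t: "j = length A + t" "m = length A + m1" "match T t T' m1 \<or> match T' m1 T t"
      using 1(7) by blast
    obtain u m2 where u: "k = length A + u" "m = length A + m2" "match T u T' m2 \<or> match T' m2 T u"
      using 2 False by blast
    have "m2 = m1" using t(2) u(2) by simp
    then show ?thesis using match_injective[of T t T' m1 u] t u by simp
  qed
qed

lemma matched_exists:
  assumes "ck_at i \<rho> \<sigma>" "k < length \<rho>" "reduced_word (del k \<rho>)"
  shows "\<exists>k'. matched i (\<rho>, k) (\<sigma>, k')"
proof -
  obtain A B T T' where *: "length A = i" "\<rho> = A @ T @ B" "\<sigma> = A @ T' @ B" "ck_triple T T'"
    using assms(1) unfolding ck_at_def by (elim exE conjE)
  have len: "length T = 3" using ck_triple_length[OF *(4)] by simp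
  show ?thesis
  proof (cases "k < i \<or> i + 3 \<le> k")
    case True
    then have "matched i (\<rho>, k) (\<sigma>, k)"
      using matched_outsideI[OF *(4), of k A B] assms(2) unfolding *(2,3) *(1) by simp
    then show ?thesis by (rule exI)
  next
    case False
    define t where "t = k - i"
    have t: "k = i + t" "t < 3" using False by (auto simp: t_def)
    have "\<not> (\<exists>x y z. T = [x, y, z] \<and> t = 1 \<and> x = z)"
    proof
      assume "\<exists>x y z. T = [x, y, z] \<and> t = 1 \<and> x = z"
      then obtain x y where xy: "T = [x, y, x]" "t = 1" by auto
      have "del k \<rho> = A @ del t T @ B" unfolding t(1) *(2) *(1)[symmetric]
        using t(2) len by (simp add: del_append)
      also have "\<dots> = A @ x # x # B" using xy by (simp add: del_def)
      finally show False using assms(3) not_reduced_word_repeat by simp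
    qed
    then obtain t' where "match T t T' t' \<or> match T' t' T t" using match_exists[OF *(4) t(2)] by auto
    then have "matched i (\<rho>, k) (\<sigma>, i + t')"
      using matched_insideI[of T t T' t' A B] unfolding *(2,3) t(1) *(1)[symmetric] by simp
    then show ?thesis by (rule exI)
  qed
qed

lemma bump_step_context:
  assumes "bump_step (T, t) (U, u)"
  shows "bump_step (A @ T @ B, length A + t) (A @ U @ B, length A + u)"
proof -
  have *: "u < length T" "t < length T" "u \<noteq> t" "word_perm (del u T) = word_perm (del t T)" "U = dec u T"
    using assms unfolding bump_step_def by auto
  have "word_perm (del (length A + u) (A @ T @ B)) = word_perm (del (length A + t) (A @ T @ B))"
    using * by (simp add: del_append word_perm_append)
  moreover have "dec (length A + u) (A @ T @ B) = A @ U @ B" using * by (simp add: dec_append)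
  ultimately show ?thesis unfolding bump_step_def using * by auto
qed

lemma bump_steps_context:
  assumes "bump_step\<^sup>*\<^sup>* (T, t) (U, u)"
  shows "bump_step\<^sup>*\<^sup>* (A @ T @ B, length A + t) (A @ U @ B, length A + u)"
  using assms
proof (induction "(U, u)" arbitrary: U u rule: rtranclp_induct)
  case (step s)
  then show ?case using bump_step_context[of "fst s" "snd s" U u A B] by (cases s) (auto intro: rtranclp.rtrancl_into_rtrancl)
qed simp

lemma bump_stepI:
  "u < length T \<Longrightarrow> t < length T \<Longrightarrow> u \<noteq> t \<Longrightarrow> word_perm (del u T) = word_perm (del t T) \<Longrightarrow> U = dec u T \<Longrightarrow>
   bump_step (T, t) (U, u)"
  by (auto simp: bump_step_def)

text \<open>Decrementing matched letters can spoil the Coxeter--Knuth move. Then an immediate further step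
  inside the window restores it.\<close>

lemma match_dec:
  assumes "match T t T' t'" "\<forall>x\<in>set T. 1 \<le> x"
  shows "\<exists>U u U' u'. bump_step\<^sup>*\<^sup>* (dec t T, t) (U, u) \<and> bump_step\<^sup>*\<^sup>* (dec t' T', t') (U', u') \<and>
    (match U u U' u' \<or> match U' u' U u)"
  using assms
proof (cases rule: match.cases)
  case (1 a b c)
  show ?thesis
  proof (cases "b = Suc a")
    case False
    then have "match [b - 1, a, c] 0 [b - 1, c, a] 0" using 1 by (intro match.intros) auto
    then show ?thesis using 1 by (intro exI[of _ "[b - 1, a, c]"] exI[of _ "0::nat"] exI[of _ "[b - 1, c, a]"]) (auto simp: dec_def)
  next
    case True
    have "bump_step ([a, a, c], 0) ([a, a - 1, c], 1)"
      by (rule bump_stepI) (auto simp: del_def dec_def)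
    moreover have "bump_step ([a, c, a], 0) ([a, c, a - 1], 2)"
      using word_perm_far_commute[of a c] 1 True by (intro bump_stepI) (auto simp: del_def dec_def numeral_2_eq_2)
    moreover have "match [a, a - 1, c] 1 [a, c, a - 1] 2" using 1 True assms(2) by (intro match.intros) auto
    ultimately show ?thesis using 1 True
      by (intro exI[of _ "[a, a - 1, c]"] exI[of _ "1::nat"] exI[of _ "[a, c, a - 1]"] exI[of _ "2::nat"]) (auto simp: dec_def)
  qed
next
  case (2 a b c)
  then have "match [b, a - 1, c] 1 [b, c, a - 1] 2" by (intro match.intros) auto
  then show ?thesis using 2 by (intro exI[of _ "[b, a - 1, c]"] exI[of _ "1::nat"] exI[of _ "[b, c, a - 1]"] exI[of _ "2::nat"]) (auto simp: dec_def numeral_2_eq_2)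
next
  case (3 a b c)
  consider "c \<noteq> Suc b" | "c = Suc b" "b = Suc a" | "c = Suc b" "b \<noteq> Suc a" by blast
  then show ?thesis
  proof cases
    case c: 1
    then have "match [b, a, c - 1] 2 [b, c - 1, a] 1" using 3 by (intro match.intros) auto
    then show ?thesis using 3 by (intro exI[of _ "[b, a, c - 1]"] exI[of _ "2::nat"] exI[of _ "[b, c - 1, a]"] exI[of _ "1::nat"]) (auto simp: dec_def numeral_2_eq_2)
  next
    case c: 2
    have "bump_step ([b, b, a], 1) ([a, b, a], 0)" using c by (intro bump_stepI) (auto simp: del_def dec_def)
    moreover have "match [a, b, a] 0 [b, a, b] 2" using c by (intro match.intros)
    ultimately show ?thesis using 3 c
      by (intro exI[of _ "[b, a, b]"] exI[of _ "2::nat"] exI[of _ "[a, b, a]"] exI[of _ "0::nat"]) (auto simp: dec_def numeral_2_eq_2)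
  next
    case c: 3
    have "bump_step ([b, b, a], 1) ([b - 1, b, a], 0)" by (intro bump_stepI) (auto simp: del_def dec_def)
    moreover have "bump_step ([b, a, b], 2) ([b - 1, a, b], 0)"
      using word_perm_far_commute[of a b] 3 c by (intro bump_stepI) (auto simp: del_def dec_def numeral_2_eq_2)
    moreover have "match [b - 1, a, b] 0 [b - 1, b, a] 0" using 3 c by (intro match.intros) auto
    ultimately show ?thesis using 3 c
      by (intro exI[of _ "[b - 1, a, b]"] exI[of _ "0::nat"] exI[of _ "[b - 1, b, a]"] exI[of _ "0::nat"]) (auto simp: dec_def numeral_2_eq_2)
  qed
next
  case (4 a b c)
  then have "match [a - 1, c, b] 0 [c, a - 1, b] 1" by (intro match.intros) auto
  then show ?thesis using 4 by (intro exI[of _ "[a - 1, c, b]"] exI[of _ "0::nat"] exI[of _ "[c, a - 1, b]"] exI[of _ "1::nat"]) (auto simp: dec_def)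
next
  case (5 a b c)
  consider "c \<noteq> Suc b" | "c = Suc b" "b = Suc a" | "c = Suc b" "b \<noteq> Suc a" by blast
  then show ?thesis
  proof cases
    case c: 1
    then have "match [a, c - 1, b] 1 [c - 1, a, b] 0" using 5 by (intro match.intros) auto
    then show ?thesis using 5 by (intro exI[of _ "[a, c - 1, b]"] exI[of _ "1::nat"] exI[of _ "[c - 1, a, b]"] exI[of _ "0::nat"]) (auto simp: dec_def)
  next
    case c: 2
    have "bump_step ([a, b, b], 1) ([a, b, a], 2)" using c by (intro bump_stepI) (auto simp: del_def dec_def numeral_2_eq_2)
    moreover have "match [a, b, a] 2 [b, a, b] 0" using c by (intro match.intros)
    ultimately show ?thesis using 5 c
      by (intro exI[of _ "[a, b, a]"] exI[of _ "2::nat"] exI[of _ "[b, a, b]"] exI[of _ "0::nat"]) (auto simp: dec_def)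
  next
    case c: 3
    have "bump_step ([a, b, b], 1) ([a, b, b - 1], 2)" by (intro bump_stepI) (auto simp: del_def dec_def numeral_2_eq_2)
    moreover have "bump_step ([b, a, b], 0) ([b, a, b - 1], 2)"
      using word_perm_far_commute[of a b] 5 c by (intro bump_stepI) (auto simp: del_def dec_def numeral_2_eq_2)
    moreover have "match [a, b, b - 1] 2 [b, a, b - 1] 2" using 5 c by (intro match.intros) auto
    ultimately show ?thesis using 5 c
      by (intro exI[of _ "[a, b, b - 1]"] exI[of _ "2::nat"] exI[of _ "[b, a, b - 1]"] exI[of _ "2::nat"]) (auto simp: dec_def)
  qed
next
  case (6 a b c)
  show ?thesis
  proof (cases "b = Suc a")
    case False
    then have "match [a, c, b - 1] 2 [c, a, b - 1] 2" using 6 by (intro match.intros) auto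
    then show ?thesis using 6 by (intro exI[of _ "[a, c, b - 1]"] exI[of _ "2::nat"] exI[of _ "[c, a, b - 1]"] exI[of _ "2::nat"]) (auto simp: dec_def numeral_2_eq_2)
  next
    case True
    have "bump_step ([c, a, a], 2) ([c, a - 1, a], 1)"
      by (rule bump_stepI) (auto simp: del_def dec_def numeral_2_eq_2)
    moreover have "bump_step ([a, c, a], 2) ([a - 1, c, a], 0)"
      using word_perm_far_commute[of a c] 6 True by (intro bump_stepI) (auto simp: del_def dec_def numeral_2_eq_2)
    moreover have "match [a - 1, c, a] 0 [c, a - 1, a] 1" using 6 True assms(2) by (intro match.intros) auto
    ultimately show ?thesis using 6 True
      by (intro exI[of _ "[a - 1, c, a]"] exI[of _ "0::nat"] exI[of _ "[c, a - 1, a]"] exI[of _ "1::nat"]) (auto simp: dec_def numeral_2_eq_2)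
  qed
next
  case (7 y x)
  have "bump_step ([y, x, x], 2) ([y, x - 1, x], 1)" by (intro bump_stepI) (auto simp: del_def dec_def numeral_2_eq_2)
  moreover have "match [x - 1, y, x] 0 [y, x - 1, x] 1" using 7 assms(2) by (intro match.intros) auto
  ultimately show ?thesis using 7
    by (intro exI[of _ "[x - 1, y, x]"] exI[of _ "0::nat"] exI[of _ "[y, x - 1, x]"] exI[of _ "1::nat"]) (auto simp: dec_def numeral_2_eq_2)
next
  case (8 y x)
  have "bump_step ([x, x, y], 0) ([x, x - 1, y], 1)" by (intro bump_stepI) (auto simp: del_def dec_def)
  moreover have "match [x, x - 1, y] 1 [x, y, x - 1] 2" using 8 assms(2) by (intro match.intros) auto
  ultimately show ?thesis using 8
    by (intro exI[of _ "[x, y, x - 1]"] exI[of _ "2::nat"] exI[of _ "[x, x - 1, y]"] exI[of _ "1::nat"]) (auto simp: dec_def numeral_2_eq_2)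
qed

lemma matched_dec:
  assumes "matched i (\<rho>, j) (\<sigma>, j')" "\<forall>x\<in>set \<rho>. 1 \<le> x"
  shows "\<exists>s s'. bump_step\<^sup>*\<^sup>* (dec j \<rho>, j) s \<and> bump_step\<^sup>*\<^sup>* (dec j' \<sigma>, j') s' \<and> matched i s s'"
proof -
  obtain A B T T' where *: "i = length A" "\<rho> = A @ T @ B" "\<sigma> = A @ T' @ B" "ck_triple T T'"
    "length T = 3" "length T' = 3"
    "j = j' \<and> (j < length A \<or> length A + 3 \<le> j \<and> j < length \<rho>) \<or>
      (\<exists>t t'. j = length A + t \<and> j' = length A + t' \<and> (match T t T' t' \<or> match T' t' T t))"
    using assms(1) by (rule matchedE)
  have pos: "\<forall>x\<in>set T. 1 \<le> x" "\<forall>x\<in>set T'. 1 \<le> x" using assms(2) *(2) ck_triple_set[OF *(4)] by auto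
  from *(7) show ?thesis
  proof
    assume out: "j = j' \<and> (j < length A \<or> length A + 3 \<le> j \<and> j < length \<rho>)"
    have "matched i (dec j \<rho>, j) (dec j' \<sigma>, j')"
    proof (cases "j < length A")
      case True
      then have "dec j \<rho> = dec j A @ T @ B" "dec j' \<sigma> = dec j A @ T' @ B"
        using * out by (simp_all add: dec_append)
      then show ?thesis using matched_outsideI[OF *(4), of j "dec j A" B] *(1) out True by simp
    next
      case False
      then have "dec j \<rho> = A @ T @ dec (j - length A - 3) B" "dec j' \<sigma> = A @ T' @ dec (j - length A - 3) B"
        using *(1-3,5,6) out by (auto simp: dec_append)
      then show ?thesis using matched_outsideI[OF *(4), of j A "dec (j - length A - 3) B"] *(1,2,5) out False by simp
    qed
    then show ?thesis by blast
  next
    assume "\<exists>t t'. j = length A + t \<and> j' = length A + t' \<and> (match T t T' t' \<or> match T' t' T t)"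
    then obtain t t' where t: "j = length A + t" "j' = length A + t'" "match T t T' t' \<or> match T' t' T t" by blast
    have d: "dec j \<rho> = A @ dec t T @ B" "dec j' \<sigma> = A @ dec t' T' @ B"
      using *(2,3,5,6) t(1,2) match_less_3[OF t(3)] by (simp_all add: dec_append)
    have "\<exists>U u U' u'. bump_step\<^sup>*\<^sup>* (dec t T, t) (U, u) \<and> bump_step\<^sup>*\<^sup>* (dec t' T', t') (U', u') \<and>
      (match U u U' u' \<or> match U' u' U u)"
      using t(3)
    proof
      assume "match T' t' T t"
      from match_dec[OF this pos(2)] show ?thesis by blast
    qed (rule match_dec[OF _ pos(1)])
    then obtain U u U' u' where U: "bump_step\<^sup>*\<^sup>* (dec t T, t) (U, u)" "bump_step\<^sup>*\<^sup>* (dec t' T', t') (U', u')"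
      "match U u U' u' \<or> match U' u' U u" by blast
    have "bump_step\<^sup>*\<^sup>* (dec j \<rho>, j) (A @ U @ B, i + u)" "bump_step\<^sup>*\<^sup>* (dec j' \<sigma>, j') (A @ U' @ B, i + u')"
      using bump_steps_context[OF U(1), of A B] bump_steps_context[OF U(2), of A B] d t(1,2) *(1) by simp_all
    moreover have "matched i (A @ U @ B, i + u) (A @ U' @ B, i + u')"
      using matched_insideI[OF U(3), of A B] *(1) by simp
    ultimately show ?thesis by blast
  qed
qed

context
  fixes v :: "nat \<Rightarrow> nat" and r :: nat
  assumes r: "2 \<le> r" "v (r - 1) < v r"
begin

lemma bump_simulation:
  assumes "marked 1 v r s" "marked 1 v r s'" "matched i s s'" "bump_step\<^sup>*\<^sup>* s f" "reduced_word (fst f)"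
  shows "\<exists>f'. bump_step\<^sup>*\<^sup>* s' f' \<and> matched i f f'"
  using assms
proof (induction "sum_list (fst s)" arbitrary: s s' rule: less_induct)
  case less
  obtain \<rho> j where s: "s = (\<rho>, j)" by (cases s)
  obtain \<sigma> j' where s': "s' = (\<sigma>, j')" by (cases s')
  from less.prems(4) show ?case
  proof (cases rule: converse_rtranclpE)
    case base
    then show ?thesis using less.prems by blast
  next
    case (step s1)
    then obtain k where k: "s1 = (dec k \<rho>, k)" "k < length \<rho>" "k \<noteq> j" "word_perm (del k \<rho>) = word_perm (del j \<rho>)"
      "marked 0 v r (\<rho>, k)"
      using bump_stepE[OF r] less.prems(1) unfolding s by metis
    then have "reduced_word (del k \<rho>)" by (simp add: marked_def)
    moreover have ck: "ck_at i \<rho> \<sigma>" using matched_ck_at[OF less.prems(3)] s s' by simp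
    ultimately obtain k' where k': "matched i (\<rho>, k) (\<sigma>, k')" using matched_exists k(2) by blast
    have m: "matched i (\<rho>, j) (\<sigma>, j')" using less.prems(3) s s' by simp
    have "k' \<noteq> j'" using matched_injective m k' k(3) by blast
    moreover have "k' < length \<sigma>" "word_perm (del k' \<sigma>) = word_perm (del j' \<sigma>)"
      using matched_word_perm_del[OF k'] matched_word_perm_del[OF m] k(4) by auto
    moreover have "j' < length \<sigma>" using matched_word_perm_del[OF m] by simp
    ultimately have s1': "bump_step s' (dec k' \<sigma>, k')" unfolding s' by (auto simp: bump_step_def)
    have pos: "\<forall>x\<in>set \<rho>. 1 \<le> x" using less.prems(1) s by (simp add: marked_def)
    obtain t t' where t: "bump_step\<^sup>*\<^sup>* s1 t" "bump_step\<^sup>*\<^sup>* (dec k' \<sigma>, k') t'" "matched i t t'"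
      using matched_dec[OF k' pos] k(1) by blast
    have st: "bump_step\<^sup>*\<^sup>* s t" "bump_step\<^sup>*\<^sup>* s' t'"
      using t step(1) s1' by (meson converse_rtranclp_into_rtranclp)+
    have mt: "marked 1 v r t" "marked 1 v r t'" using marked_bump_steps[OF r] st less.prems by blast+
    have "bump_step\<^sup>*\<^sup>* t f" using bump_steps_confluent[OF r st(1) less.prems(1,4,5)] .
    moreover have "sum_list (fst t) < sum_list (fst s)"
    proof -
      have m1: "marked 1 v r s1" using marked_bump_step[OF r step(1)] less.prems by blast
      have "sum_list (fst t) \<le> sum_list (fst s1) \<and> marked 1 v r t"
        using t(1)
      proof (induction rule: rtranclp_induct)
        case (step x y)
        then show ?case using bump_step_sum_list[OF r step.hyps(2)] marked_bump_step[OF r step.hyps(2)] by simp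
      qed (use m1 in simp)
      then show ?thesis using bump_step_sum_list[OF r step(1)] less.prems(1) by simp
    qed
    ultimately obtain f' where "bump_step\<^sup>*\<^sup>* t' f'" "matched i f f'"
      using less.hyps[of t t'] mt t(3) less.prems(5) by blast
    then show ?thesis using st(2) by (meson rtranclp_trans)
  qed
qed

definition bump :: "nat list \<Rightarrow> nat list \<times> nat" where
  "bump \<rho> = (THE f. \<exists>j. marked 0 v r (\<rho>, j) \<and> bump_step\<^sup>*\<^sup>* (dec j \<rho>, j) f \<and> reduced_word (fst f))"

lemma bump_eqI:
  assumes "reduced_word \<rho>" "marked 0 v r (\<rho>, j)" "bump_step\<^sup>*\<^sup>* (dec j \<rho>, j) f" "reduced_word (fst f)"
  shows "bump \<rho> = f"
  unfolding bump_def
proof (rule the_equality)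
  show "\<exists>j. marked 0 v r (\<rho>, j) \<and> bump_step\<^sup>*\<^sup>* (dec j \<rho>, j) f \<and> reduced_word (fst f)" using assms by blast
  fix g assume "\<exists>j. marked 0 v r (\<rho>, j) \<and> bump_step\<^sup>*\<^sup>* (dec j \<rho>, j) g \<and> reduced_word (fst g)"
  then obtain k where k: "marked 0 v r (\<rho>, k)" "bump_step\<^sup>*\<^sup>* (dec k \<rho>, k) g" "reduced_word (fst g)" by blast
  have "k = j" using deletion_unique_reduced[OF assms(1)] k(1) assms(2) by (simp add: marked_def)
  then have "bump_step\<^sup>*\<^sup>* (dec j \<rho>, j) g" using k by simp
  then have "bump_step\<^sup>*\<^sup>* g f"
    using bump_steps_confluent[OF r _ marked_dec(2)[OF r assms(2)] assms(3,4)] by blast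
  then show "g = f"
    by (cases rule: converse_rtranclpE) (use bump_step_not_reduced[OF r, of "fst g" "snd g"] k(3) in auto)
qed

lemma bump_ex:
  assumes "reduced_word \<rho>" "marked 0 v r (\<rho>, j)"
  shows "bump_step\<^sup>*\<^sup>* (dec j \<rho>, j) (bump \<rho>)" "reduced_word (fst (bump \<rho>))" "marked 1 v r (bump \<rho>)"
proof -
  have m: "marked 1 v r (dec j \<rho>, j)" using marked_dec(2)[OF r assms(2)] .
  obtain f where f: "bump_step\<^sup>*\<^sup>* (dec j \<rho>, j) f" "reduced_word (fst f)" using bump_terminates[OF r m] by blast
  then have "bump \<rho> = f" using bump_eqI assms by blast
  then show "bump_step\<^sup>*\<^sup>* (dec j \<rho>, j) (bump \<rho>)" "reduced_word (fst (bump \<rho>))" using f by auto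
  then show "marked 1 v r (bump \<rho>)" using marked_bump_steps[OF r _ m] by blast
qed

lemma bump_ck_at:
  assumes "reduced_word \<rho>" "marked 0 v r (\<rho>, j)" "marked 0 v r (\<sigma>, j')" "ck_at i \<rho> \<sigma>"
  shows "ck_at i (fst (bump \<rho>)) (fst (bump \<sigma>))"
proof -
  have s: "j < length \<rho>" "reduced_word (del j \<rho>)" "word_perm (del j \<rho>) = v" "\<forall>x\<in>set \<rho>. 1 \<le> x"
    using assms(2) by (auto simp: marked_def)
  have red: "reduced_word \<sigma>" using ck_at_props(4)[OF assms(4)] assms(1) by simp
  obtain k where k: "matched i (\<rho>, j) (\<sigma>, k)" using matched_exists[OF assms(4) s(1,2)] by blast
  have "k = j'"
    using deletion_unique_reduced[OF red matched_word_perm_del(3)[OF k]] matched_word_perm_del(1)[OF k] s assms(3)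
    by (simp add: marked_def)
  then have "matched i (\<rho>, j) (\<sigma>, j')" using k by simp
  from matched_dec[OF this s(4)] obtain t t' where
    t: "bump_step\<^sup>*\<^sup>* (dec j \<rho>, j) t" "bump_step\<^sup>*\<^sup>* (dec j' \<sigma>, j') t'" "matched i t t'" by blast
  have m: "marked 1 v r (dec j \<rho>, j)" "marked 1 v r (dec j' \<sigma>, j')" using marked_dec(2)[OF r] assms by blast+
  have mt: "marked 1 v r t" "marked 1 v r t'" using marked_bump_steps[OF r t(1) m(1)] marked_bump_steps[OF r t(2) m(2)] by auto
  have "bump_step\<^sup>*\<^sup>* t (bump \<rho>)"
    using bump_steps_confluent[OF r t(1) m(1)] bump_ex[OF assms(1,2)] by blast
  then obtain f' where f': "bump_step\<^sup>*\<^sup>* t' f'" "matched i (bump \<rho>) f'"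
    using bump_simulation[OF mt t(3)] bump_ex(2)[OF assms(1,2)] by blast
  have ck: "ck_at i (fst (bump \<rho>)) (fst f')" using matched_ck_at f'(2) .
  then have "reduced_word (fst f')" using ck_at_props(4) bump_ex(2)[OF assms(1,2)] by blast
  moreover have "bump_step\<^sup>*\<^sup>* (dec j' \<sigma>, j') f'" using t(2) f'(1) by (rule rtranclp_trans)
  ultimately have "bump \<sigma> = f'" using bump_eqI[OF red assms(3)] by blast
  then show ?thesis using ck by simp
qed

lemma bump_injective:
  assumes "reduced_word \<rho>" "marked 0 v r (\<rho>, j)" "reduced_word \<sigma>" "marked 0 v r (\<sigma>, j')"
    and eq: "fst (bump \<rho>) = fst (bump \<sigma>)"
  shows "\<rho> = \<sigma>"
proof -
  have inc: "\<rho> = \<tau>[k := Suc (\<tau> ! k)]" if "marked 0 v r (\<rho>, k)" "\<tau> = dec k \<rho>" for \<rho> k \<tau>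
    using marked_dec(1)[OF r that(1)] that by (auto simp: dec_def marked_def)
  have mark: "snd (bump \<rho>) = snd (bump \<sigma>)"
  proof (rule deletion_unique_reduced)
    show "reduced_word (fst (bump \<rho>))" using bump_ex assms by blast
    show "snd (bump \<rho>) < length (fst (bump \<rho>))" "snd (bump \<sigma>) < length (fst (bump \<rho>))"
      "word_perm (del (snd (bump \<rho>)) (fst (bump \<rho>))) = word_perm (del (snd (bump \<sigma>)) (fst (bump \<rho>)))"
      using bump_ex(3)[OF assms(1,2)] bump_ex(3)[OF assms(3,4)] eq by (auto simp: marked_def)
  qed
  have main: "\<rho> = \<sigma>" if "bump_step\<^sup>*\<^sup>* (dec j \<rho>, j) s" "bump_step\<^sup>*\<^sup>* (dec j' \<sigma>, j') s" for s
    using that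
  proof (induction rule: rtranclp_induct)
    case base
    from base show ?case
    proof (cases rule: rtranclp.cases)
      case rtrancl_refl
      then show ?thesis using inc assms(2,4) by blast
    next
      case (rtrancl_into_rtrancl s1)
      have m1: "marked 1 v r s1" using marked_bump_steps[OF r rtrancl_into_rtrancl(1) marked_dec(2)[OF r assms(4)]] .
      then obtain k where k: "dec j \<rho> = dec k (fst s1)" "j = k" "marked 0 v r (fst s1, k)"
        using bump_stepE[OF r, of "fst s1" "snd s1"] rtrancl_into_rtrancl(2) by (metis prod.collapse prod.inject)
      then have "\<rho> = fst s1" using inc[OF assms(2) refl] inc[OF k(3) refl] by simp
      then show ?thesis using assms(1) bump_step_not_reduced[OF r, of "fst s1" "snd s1"] rtrancl_into_rtrancl(2) by simp
    qed
  next
    case (step s1 s2)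
    have m1: "marked 1 v r s1" using marked_bump_steps[OF r step.hyps(1) marked_dec(2)[OF r assms(2)]] .
    then obtain k where k: "s2 = (dec k (fst s1), k)" "k \<noteq> snd s1" "k < length (fst s1)" "marked 0 v r (fst s1, k)"
      "word_perm (del k (fst s1)) = word_perm (del (snd s1) (fst s1))"
      using bump_stepE[OF r, of "fst s1" "snd s1"] step.hyps(2) by (metis prod.collapse)
    from step.prems show ?case
    proof (cases rule: rtranclp.cases)
      case rtrancl_refl
      then have "dec j' \<sigma> = dec k (fst s1)" "j' = k" using k(1) by auto
      then have "\<sigma> = fst s1" using inc[OF assms(4) refl] inc[OF k(4) refl] by simp
      then show ?thesis using assms(3) bump_step_not_reduced[OF r, of "fst s1" "snd s1"] step.hyps(2) by simp
    next
      case (rtrancl_into_rtrancl s1')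
      have m1': "marked 1 v r s1'" using marked_bump_steps[OF r rtrancl_into_rtrancl(1) marked_dec(2)[OF r assms(4)]] .
      then obtain k' where k': "s2 = (dec k' (fst s1'), k')" "k' \<noteq> snd s1'" "k' < length (fst s1')" "marked 0 v r (fst s1', k')"
        "word_perm (del k' (fst s1')) = word_perm (del (snd s1') (fst s1'))"
        using bump_stepE[OF r, of "fst s1'" "snd s1'"] rtrancl_into_rtrancl(2) by (metis prod.collapse)
      have kk: "k' = k" "dec k (fst s1) = dec k (fst s1')" using k(1) k'(1) by auto
      then have f: "fst s1 = fst s1'" using inc[OF k(4) refl] inc[OF k'(4) refl] by simp
      have mk: "marked 0 v r (fst s1, k)" by (rule k(4))
      have "marked 1 v r (fst s1, snd s1)" using m1 by simp
      moreover have "snd s1' < length (fst s1)" "word_perm (del (snd s1') (fst s1)) = v"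
        using m1' f by (cases s1'; simp add: marked_def)+
      moreover have "word_perm (del k (fst s1)) = v" using mk by (simp add: marked_def)
      ultimately have "snd s1' \<noteq> snd s1 \<Longrightarrow> snd s1' = k"
        using mark_unique[OF r, of "fst s1" "snd s1" "snd s1'" k] k(2,3) by blast
      then have "snd s1 = snd s1'" using k'(2) kk(1) by metis
      then have "s1 = s1'" using f by (simp add: prod_eq_iff)
      then show ?thesis using step.IH rtrancl_into_rtrancl(1) by simp
    qed
  qed
  show ?thesis
  proof (rule main)
    show "bump_step\<^sup>*\<^sup>* (dec j \<rho>, j) (bump \<rho>)" using bump_ex assms by blast
    have "bump \<rho> = bump \<sigma>" using mark eq by (simp add: prod_eq_iff)
    then show "bump_step\<^sup>*\<^sup>* (dec j' \<sigma>, j') (bump \<rho>)" using bump_ex(1)[OF assms(3,4)] by simp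
  qed
qed

end

section \<open>Little bumps of compatible biwords\<close>

lemma reduced_word_adjacent:
  assumes "reduced_word \<rho>" "Suc t < length \<rho>"
  shows "\<rho> ! t \<noteq> \<rho> ! Suc t"
proof
  assume eq: "\<rho> ! t = \<rho> ! Suc t"
  have "\<rho> = take t \<rho> @ \<rho> ! t # drop (Suc t) \<rho>" using assms(2) by (intro id_take_nth_drop) simp
  also have "drop (Suc t) \<rho> = \<rho> ! Suc t # drop (Suc (Suc t)) \<rho>"
    using assms(2) by (rule Cons_nth_drop_Suc[symmetric])
  finally have "\<rho> = take t \<rho> @ \<rho> ! t # \<rho> ! t # drop (Suc (Suc t)) \<rho>" using eq by simp
  then show False using assms(1) not_reduced_word_repeat by metis
qed

lemma del_adjacent:
  assumes "Suc t < length \<rho>" "\<rho> ! t = \<rho> ! Suc t"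
  shows "del t \<rho> = del (Suc t) \<rho>"
proof -
  have "drop (Suc t) \<rho> = \<rho> ! Suc t # drop (Suc (Suc t)) \<rho>" using assms(1) by (rule Cons_nth_drop_Suc[symmetric])
  moreover have "take (Suc t) \<rho> = take t \<rho> @ [\<rho> ! t]" using assms(1) by (intro take_Suc_conv_app_nth) simp
  ultimately show ?thesis using assms(2) by (simp add: del_def)
qed

text \<open>Ascents and descents of the original word \<open>\<rho>\<^sub>0\<close> persist, except that decrementing the marked letter
  may produce two equal letters. Then the next step decrements the other one.\<close>

definition runs_kept :: "nat list \<Rightarrow> nat list \<Rightarrow> nat \<Rightarrow> bool" where
  "runs_kept \<rho>\<^sub>0 \<rho> j \<longleftrightarrow> (\<forall>t. Suc t < length \<rho>\<^sub>0 \<longrightarrow>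
     (\<rho>\<^sub>0 ! t < \<rho>\<^sub>0 ! Suc t \<longrightarrow> \<rho> ! t < \<rho> ! Suc t \<or> \<rho> ! t = \<rho> ! Suc t \<and> j = Suc t) \<and>
     (\<rho>\<^sub>0 ! Suc t < \<rho>\<^sub>0 ! t \<longrightarrow> \<rho> ! Suc t < \<rho> ! t \<or> \<rho> ! t = \<rho> ! Suc t \<and> j = t))"

definition runs_ready :: "nat list \<Rightarrow> nat list \<Rightarrow> nat \<Rightarrow> bool" where
  "runs_ready \<rho>\<^sub>0 \<rho> k \<longleftrightarrow> (\<forall>t. Suc t < length \<rho>\<^sub>0 \<longrightarrow>
     (\<rho>\<^sub>0 ! t < \<rho>\<^sub>0 ! Suc t \<longrightarrow> \<rho> ! t < \<rho> ! Suc t \<or> \<rho> ! t = \<rho> ! Suc t \<and> k = t) \<and>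
     (\<rho>\<^sub>0 ! Suc t < \<rho>\<^sub>0 ! t \<longrightarrow> \<rho> ! Suc t < \<rho> ! t \<or> \<rho> ! t = \<rho> ! Suc t \<and> k = Suc t))"

lemma runs_kept_dec:
  assumes "runs_ready \<rho>\<^sub>0 \<rho> k" "length \<rho> = length \<rho>\<^sub>0" "1 \<le> \<rho> ! k"
  shows "runs_kept \<rho>\<^sub>0 (dec k \<rho>) k"
  unfolding runs_kept_def
proof (intro allI impI)
  fix t assume t: "Suc t < length \<rho>\<^sub>0"
  have n: "dec k \<rho> ! t = (if t = k then \<rho> ! t - 1 else \<rho> ! t)"
    "dec k \<rho> ! Suc t = (if Suc t = k then \<rho> ! Suc t - 1 else \<rho> ! Suc t)"
    using t assms(2) by (simp_all add: nth_dec)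
  have a: "\<rho>\<^sub>0 ! t < \<rho>\<^sub>0 ! Suc t \<Longrightarrow> \<rho> ! t < \<rho> ! Suc t \<or> \<rho> ! t = \<rho> ! Suc t \<and> k = t"
    "\<rho>\<^sub>0 ! Suc t < \<rho>\<^sub>0 ! t \<Longrightarrow> \<rho> ! Suc t < \<rho> ! t \<or> \<rho> ! t = \<rho> ! Suc t \<and> k = Suc t"
    using assms(1) t unfolding runs_ready_def by blast+
  show "(\<rho>\<^sub>0 ! t < \<rho>\<^sub>0 ! Suc t \<longrightarrow> dec k \<rho> ! t < dec k \<rho> ! Suc t \<or> dec k \<rho> ! t = dec k \<rho> ! Suc t \<and> k = Suc t) \<and>
     (\<rho>\<^sub>0 ! Suc t < \<rho>\<^sub>0 ! t \<longrightarrow> dec k \<rho> ! Suc t < dec k \<rho> ! t \<or> dec k \<rho> ! t = dec k \<rho> ! Suc t \<and> k = t)"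
  proof (intro conjI impI)
    assume "\<rho>\<^sub>0 ! t < \<rho>\<^sub>0 ! Suc t"
    from a(1)[OF this] show "dec k \<rho> ! t < dec k \<rho> ! Suc t \<or> dec k \<rho> ! t = dec k \<rho> ! Suc t \<and> k = Suc t"
      unfolding n using assms(3) by (cases "t = k"; cases "Suc t = k") auto
  next
    assume "\<rho>\<^sub>0 ! Suc t < \<rho>\<^sub>0 ! t"
    from a(2)[OF this] show "dec k \<rho> ! Suc t < dec k \<rho> ! t \<or> dec k \<rho> ! t = dec k \<rho> ! Suc t \<and> k = t"
      unfolding n using assms(3) by (cases "t = k"; cases "Suc t = k") auto
  qed
qed

context
  fixes v :: "nat \<Rightarrow> nat" and r :: nat
  assumes r: "2 \<le> r" "v (r - 1) < v r"
begin

lemma runs_ready_step: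
  assumes "runs_kept \<rho>\<^sub>0 \<rho> j" "marked 1 v r (\<rho>, j)" "length \<rho> = length \<rho>\<^sub>0" "k < length \<rho>" "k \<noteq> j"
    "word_perm (del k \<rho>) = word_perm (del j \<rho>)"
  shows "runs_ready \<rho>\<^sub>0 \<rho> k"
  unfolding runs_ready_def
proof (intro allI impI)
  fix t assume t: "Suc t < length \<rho>\<^sub>0"
  have v: "word_perm (del j \<rho>) = v" using assms(2) by (simp add: marked_def)
  have 1: "k = t" if "\<rho> ! t = \<rho> ! Suc t" "j = Suc t"
    using mark_unique[OF r assms(2,4), of t] del_adjacent[of t \<rho>] that t assms(3,5,6) v by simp
  have 2: "k = Suc t" if "\<rho> ! t = \<rho> ! Suc t" "j = t"
    using mark_unique[OF r assms(2,4), of "Suc t"] del_adjacent[of t \<rho>] that t assms(3,5,6) v by simp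
  show "(\<rho>\<^sub>0 ! t < \<rho>\<^sub>0 ! Suc t \<longrightarrow> \<rho> ! t < \<rho> ! Suc t \<or> \<rho> ! t = \<rho> ! Suc t \<and> k = t) \<and>
     (\<rho>\<^sub>0 ! Suc t < \<rho>\<^sub>0 ! t \<longrightarrow> \<rho> ! Suc t < \<rho> ! t \<or> \<rho> ! t = \<rho> ! Suc t \<and> k = Suc t)"
    using assms(1)[unfolded runs_kept_def, rule_format, OF t] 1 2 by blast
qed

text \<open>The invariants of a bump of \<open>\<rho>\<^sub>0\<close> with indices \<open>is\<close>: the flag condition can only fail at the very end,
  by a letter \<open>r - 1\<close> with index \<open>r\<close>.\<close>

definition flags_kept :: "nat list \<Rightarrow> nat list \<Rightarrow> nat \<Rightarrow> bool" where
  "flags_kept is \<rho> j \<longleftrightarrow> (\<forall>t<length \<rho>. is ! t \<le> \<rho> ! t) \<or>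
     reduced_word \<rho> \<and> word_perm (take j \<rho>) (r - 1) = \<rho> ! j \<and>
     (\<forall>t<length \<rho>. is ! t \<le> \<rho> ! t \<or> is ! t = r \<and> \<rho> ! t = r - 1)"

lemma word_perm_fixes:
  assumes "\<forall>x\<in>set xs. c < x" "i \<le> c"
  shows "word_perm xs i = i"
  using assms(1)
proof (induction xs)
  case (Cons a xs)
  then show ?case using assms(2) by (simp add: word_perm_Cons transpose_def)
qed simp

lemma flags_kept_dec:
  assumes m: "marked 0 v r (\<rho>, k)" and ready: "runs_ready \<rho>\<^sub>0 \<rho> k"
    and len: "length \<rho> = length \<rho>\<^sub>0" "length is = length \<rho>\<^sub>0"
    and sorted: "\<And>s t. s < t \<Longrightarrow> t < length \<rho>\<^sub>0 \<Longrightarrow> is ! t < is ! s \<or> is ! s = is ! t \<and> \<rho>\<^sub>0 ! s < \<rho>\<^sub>0 ! t"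
    and flags: "\<forall>t<length \<rho>. is ! t \<le> \<rho> ! t"
  shows "flags_kept is (dec k \<rho>) k"
proof (cases "is ! k \<le> \<rho> ! k - 1")
  case True
  then show ?thesis using flags by (auto simp: flags_kept_def nth_dec)
next
  case False
  have s: "k < length \<rho>" "word_perm (take k \<rho>) r = \<rho> ! k" using m by (auto simp: marked_def)
  have tight: "is ! k = \<rho> ! k" using flags s(1) False by force
  have above: "\<rho> ! k < \<rho> ! t" if t: "t < k" for t
  proof (cases "is ! k < is ! t")
    case True
    then show ?thesis using flags tight t s(1) by (metis less_le_trans less_trans)
  next
    case False
    then have eq: "is ! t = is ! k" using sorted[OF t] s(1) len by auto
    have k: "Suc (k - 1) = k" using t by simp
    have "is ! (k - 1) = is ! k \<and> \<rho>\<^sub>0 ! (k - 1) < \<rho>\<^sub>0 ! k"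
    proof (cases "t = k - 1")
      case False
      then have "t < k - 1" using t by simp
      moreover have "k - 1 < length \<rho>\<^sub>0" using s(1) len by linarith
      ultimately have "is ! (k - 1) \<le> is ! t" using sorted[of t "k - 1"] by linarith
      then show ?thesis using sorted[of "k - 1" k] eq t s(1) len by auto
    qed (use sorted[of "k - 1" k] eq t s(1) len in auto)
    moreover from this have "\<rho> ! (k - 1) < \<rho> ! k"
      using ready[unfolded runs_ready_def, rule_format, of "k - 1"] k s(1) len by auto
    moreover have "is ! (k - 1) \<le> \<rho> ! (k - 1)" using flags s(1) by simp
    ultimately show ?thesis using tight by simp
  qed
  have big: "\<forall>x\<in>set (take k \<rho>). \<rho> ! k < x"
    using above s(1) by (auto simp: in_set_conv_nth)
  have fix': "word_perm (take k \<rho>) i = i" if "i \<le> \<rho> ! k" for i using word_perm_fixes[OF big that] .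
  have "word_perm (take k \<rho>) (\<rho> ! k) = \<rho> ! k" by (rule fix') simp
  then have rk: "\<rho> ! k = r" using s(2) word_perm_eq_iff by metis
  have q: "word_perm (take k (dec k \<rho>)) (r - 1) = dec k \<rho> ! k"
    using fix'[of "r - 1"] rk s(1) by (simp add: nth_dec)
  have "reduced_word (dec k \<rho>)"
    using marked_reduced_iff[OF r marked_dec(2)[OF r m] q] r by simp
  moreover have "\<forall>t<length (dec k \<rho>). is ! t \<le> dec k \<rho> ! t \<or> is ! t = r \<and> dec k \<rho> ! t = r - 1"
    using flags tight rk by (auto simp: nth_dec)
  ultimately show ?thesis using q by (simp add: flags_kept_def)
qed

lemma bump_path:
  assumes "marked 0 v r (\<rho>\<^sub>0, j\<^sub>0)" "bump_step\<^sup>*\<^sup>* (dec j\<^sub>0 \<rho>\<^sub>0, j\<^sub>0) f"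
  shows "length (fst f) = length \<rho>\<^sub>0" "runs_kept \<rho>\<^sub>0 (fst f) (snd f)"
    "\<forall>t<length \<rho>\<^sub>0. fst f ! t \<le> \<rho>\<^sub>0 ! t" "fst f ! snd f < \<rho>\<^sub>0 ! snd f"
    "length is = length \<rho>\<^sub>0 \<Longrightarrow> (\<And>s t. s < t \<Longrightarrow> t < length \<rho>\<^sub>0 \<Longrightarrow> is ! t < is ! s \<or> is ! s = is ! t \<and> \<rho>\<^sub>0 ! s < \<rho>\<^sub>0 ! t)
      \<Longrightarrow> \<forall>t<length \<rho>\<^sub>0. is ! t \<le> \<rho>\<^sub>0 ! t \<Longrightarrow> flags_kept is (fst f) (snd f)"
proof -
  let ?S = "length is = length \<rho>\<^sub>0 \<and> (\<forall>s t. s < t \<longrightarrow> t < length \<rho>\<^sub>0 \<longrightarrow> is ! t < is ! s \<or> is ! s = is ! t \<and> \<rho>\<^sub>0 ! s < \<rho>\<^sub>0 ! t)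
     \<and> (\<forall>t<length \<rho>\<^sub>0. is ! t \<le> \<rho>\<^sub>0 ! t)"
  have "length (fst f) = length \<rho>\<^sub>0 \<and> runs_kept \<rho>\<^sub>0 (fst f) (snd f) \<and>
    (\<forall>t<length \<rho>\<^sub>0. fst f ! t \<le> \<rho>\<^sub>0 ! t) \<and> fst f ! snd f < \<rho>\<^sub>0 ! snd f \<and> (?S \<longrightarrow> flags_kept is (fst f) (snd f))"
    using assms(2)
  proof (induction rule: rtranclp_induct)
    case base
    have j: "j\<^sub>0 < length \<rho>\<^sub>0" using assms(1) by (simp add: marked_def)
    have ge: "2 \<le> \<rho>\<^sub>0 ! j\<^sub>0" using marked_dec(1)[OF r assms(1)] .
    have ready: "runs_ready \<rho>\<^sub>0 \<rho>\<^sub>0 j\<^sub>0" by (auto simp: runs_ready_def)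
    have "runs_kept \<rho>\<^sub>0 (dec j\<^sub>0 \<rho>\<^sub>0) j\<^sub>0" using ready ge by (intro runs_kept_dec) auto
    moreover have "?S \<longrightarrow> flags_kept is (dec j\<^sub>0 \<rho>\<^sub>0) j\<^sub>0"
      using flags_kept_dec[OF assms(1) ready refl, of "is"] by blast
    ultimately show ?case using j ge by (simp add: nth_dec)
  next
    case (step s1 s2)
    obtain \<rho> j where s1: "s1 = (\<rho>, j)" by (cases s1)
    have m1: "marked 1 v r (\<rho>, j)" using marked_bump_steps[OF r step.hyps(1) marked_dec(2)[OF r assms(1)]] s1 by simp
    obtain k where k: "s2 = (dec k \<rho>, k)" "k < length \<rho>" "k \<noteq> j" "word_perm (del k \<rho>) = word_perm (del j \<rho>)"
      "marked 0 v r (\<rho>, k)"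
      using bump_stepE[OF r _ m1] step.hyps(2) unfolding s1 by metis
    have IH: "length \<rho> = length \<rho>\<^sub>0" "runs_kept \<rho>\<^sub>0 \<rho> j" "\<And>t. t < length \<rho>\<^sub>0 \<Longrightarrow> \<rho> ! t \<le> \<rho>\<^sub>0 ! t"
      "?S \<Longrightarrow> flags_kept is \<rho> j" using step.IH s1 by auto
    have ge: "2 \<le> \<rho> ! k" using marked_dec(1)[OF r k(5)] .
    have ready: "runs_ready \<rho>\<^sub>0 \<rho> k" using runs_ready_step[OF IH(2) m1 IH(1) k(2,3,4)] .
    have "runs_kept \<rho>\<^sub>0 (dec k \<rho>) k" using ready IH(1) ge by (intro runs_kept_dec) auto
    moreover have "flags_kept is (dec k \<rho>) k" if S: ?S
    proof -
      have "\<not> reduced_word \<rho>" using bump_step_not_reduced[OF r] step.hyps(2) s1 by blast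
      then have "\<forall>t<length \<rho>. is ! t \<le> \<rho> ! t" using IH(4)[OF S] by (simp add: flags_kept_def)
      then show ?thesis using flags_kept_dec[OF k(5) ready IH(1), of "is"] S by blast
    qed
    moreover have "\<forall>t<length \<rho>\<^sub>0. dec k \<rho> ! t \<le> \<rho>\<^sub>0 ! t"
    proof (intro allI impI)
      fix t assume "t < length \<rho>\<^sub>0"
      then show "dec k \<rho> ! t \<le> \<rho>\<^sub>0 ! t" using IH(1) IH(3)[of t] by (cases "t = k") (auto simp: nth_dec)
    qed
    moreover have "dec k \<rho> ! k < \<rho>\<^sub>0 ! k"
      using IH(1) IH(3)[of k] k(2) ge by (simp add: nth_dec)
    ultimately show ?case using k(1) IH(1) by simp
  qed
  then show "length (fst f) = length \<rho>\<^sub>0" "runs_kept \<rho>\<^sub>0 (fst f) (snd f)"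
    "\<forall>t<length \<rho>\<^sub>0. fst f ! t \<le> \<rho>\<^sub>0 ! t" "fst f ! snd f < \<rho>\<^sub>0 ! snd f"
    "length is = length \<rho>\<^sub>0 \<Longrightarrow> (\<And>s t. s < t \<Longrightarrow> t < length \<rho>\<^sub>0 \<Longrightarrow> is ! t < is ! s \<or> is ! s = is ! t \<and> \<rho>\<^sub>0 ! s < \<rho>\<^sub>0 ! t)
      \<Longrightarrow> \<forall>t<length \<rho>\<^sub>0. is ! t \<le> \<rho>\<^sub>0 ! t \<Longrightarrow> flags_kept is (fst f) (snd f)"
    by blast+
qed

end

lemma sorted_before_zip:
  assumes "length is = length \<rho>"
  shows "sorted_wrt before (zip is \<rho>) \<longleftrightarrow>
    (\<forall>t. Suc t < length \<rho> \<longrightarrow> is ! Suc t < is ! t \<or> is ! t = is ! Suc t \<and> \<rho> ! t < \<rho> ! Suc t)"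
proof -
  have "transp before" by (auto simp: transp_def before_def)
  then show ?thesis using assms by (simp add: sorted_wrt_iff_nth_Suc_transp before_def)
qed

lemma sorted_before_zip_nth:
  assumes "sorted_wrt before (zip is \<rho>)" "length is = length \<rho>" "s < t" "t < length \<rho>"
  shows "is ! t < is ! s \<or> is ! s = is ! t \<and> \<rho> ! s < \<rho> ! t"
  using sorted_wrt_nth_less[OF assms(1,3)] assms(2-4) by (simp add: before_def)

context
  fixes v :: "nat \<Rightarrow> nat" and r :: nat
  assumes r: "2 \<le> r" "v (r - 1) < v r"
begin

private abbreviation \<theta> :: "nat list \<Rightarrow> nat list" where
  "\<theta> \<rho> \<equiv> fst (bump v r \<rho>)"

context
  fixes \<rho> j
  assumes red: "reduced_word \<rho>" and mark: "marked 0 v r (\<rho>, j)"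
begin

lemma bump_length: "length (\<theta> \<rho>) = length \<rho>"
  using bump_path(1)[OF r mark] bump_ex(1)[OF r red mark] by blast

lemma bump_le: "t < length \<rho> \<Longrightarrow> \<theta> \<rho> ! t \<le> \<rho> ! t"
  using bump_path(3)[OF r mark] bump_ex(1)[OF r red mark] by blast

lemma bump_mark_less: "\<theta> \<rho> ! snd (bump v r \<rho>) < \<rho> ! snd (bump v r \<rho>)"
  using bump_path(4)[OF r mark] bump_ex(1)[OF r red mark] by blast

lemma bump_ascent_iff:
  assumes "Suc t < length \<rho>"
  shows "\<rho> ! t < \<rho> ! Suc t \<longleftrightarrow> \<theta> \<rho> ! t < \<theta> \<rho> ! Suc t"
proof -
  have "runs_kept \<rho> (\<theta> \<rho>) (snd (bump v r \<rho>))"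
    using bump_path(2)[OF r mark] bump_ex(1)[OF r red mark] by blast
  moreover have "\<theta> \<rho> ! t \<noteq> \<theta> \<rho> ! Suc t" "\<rho> ! t \<noteq> \<rho> ! Suc t"
    using reduced_word_adjacent bump_ex(2)[OF r red mark] red assms bump_length by simp_all
  ultimately show ?thesis using assms unfolding runs_kept_def by (metis linorder_neqE_nat less_asym')
qed

lemma bump_sorted_before:
  assumes "length is = length \<rho>"
  shows "sorted_wrt before (zip is (\<theta> \<rho>)) \<longleftrightarrow> sorted_wrt before (zip is \<rho>)"
  using assms bump_ascent_iff by (auto simp: sorted_before_zip bump_length)

lemma bump_sum_list: "sum_list (\<theta> \<rho>) < sum_list \<rho>"
proof -
  let ?k = "snd (bump v r \<rho>)"
  have k: "?k < length \<rho>" using bump_ex(3)[OF r red mark] bump_length by (cases "bump v r \<rho>") (simp add: marked_def)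
  have "sum_list (\<theta> \<rho>) = (\<Sum>t = 0..<length \<rho>. \<theta> \<rho> ! t)" by (simp add: sum_list_sum_nth bump_length)
  also have "\<dots> < (\<Sum>t = 0..<length \<rho>. \<rho> ! t)"
    using k bump_le bump_mark_less by (intro sum_strict_mono_ex1) auto
  finally show ?thesis by (simp add: sum_list_sum_nth)
qed

lemma bump_word_perm:
  obtains q where "word_perm (\<theta> \<rho>) = v \<circ> Transposition.transpose q r" "q < r"
    "word_perm (take (snd (bump v r \<rho>)) (\<theta> \<rho>)) q = \<theta> \<rho> ! snd (bump v r \<rho>)"
proof -
  have m: "marked 1 v r (\<theta> \<rho>, snd (bump v r \<rho>))" using bump_ex(3)[OF r red mark] by simp
  obtain q where q: "q \<noteq> r" "word_perm (take (snd (bump v r \<rho>)) (\<theta> \<rho>)) q = \<theta> \<rho> ! snd (bump v r \<rho>)"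
    "word_perm (\<theta> \<rho>) = v \<circ> Transposition.transpose q r"
    using marked_word_perm[OF r m] by blast
  then show ?thesis using that marked_reduced_iff[OF r m q(2)] bump_ex(2)[OF r red mark] by blast
qed

lemma inj_v: "inj v"
  using mark bij_is_inj[OF bij_word_perm[of "del j \<rho>"]] by (auto simp: marked_def)

lemma bump_flags_forward:
  assumes "length is = length \<rho>" "sorted_wrt before (zip is \<rho>)" "\<forall>t<length \<rho>. is ! t \<le> \<rho> ! t"
    and q: "word_perm (\<theta> \<rho>) = v \<circ> Transposition.transpose q r" and t: "t < length \<rho>"
  shows "is ! t \<le> \<theta> \<rho> ! t \<or> q = r - 1 \<and> is ! t = r \<and> \<theta> \<rho> ! t = r - 1"
proof -
  obtain q' where q': "word_perm (\<theta> \<rho>) = v \<circ> Transposition.transpose q' r"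
    "word_perm (take (snd (bump v r \<rho>)) (\<theta> \<rho>)) q' = \<theta> \<rho> ! snd (bump v r \<rho>)" using bump_word_perm by blast
  have "v q = v q'" using q q'(1) by (metis comp_apply transpose_apply_second)
  then have "q' = q" using inj_v by (simp add: inj_eq)
  have "flags_kept r is (\<theta> \<rho>) (snd (bump v r \<rho>))"
    using bump_path(5)[OF r mark bump_ex(1)[OF r red mark] assms(1)] sorted_before_zip_nth[OF assms(2,1)] assms(3)
    by blast
  then consider "is ! t \<le> \<theta> \<rho> ! t"
    | "word_perm (take (snd (bump v r \<rho>)) (\<theta> \<rho>)) (r - 1) = \<theta> \<rho> ! snd (bump v r \<rho>)" "is ! t = r" "\<theta> \<rho> ! t = r - 1"
    unfolding flags_kept_def[OF r] bump_length using t by blast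
  then show ?thesis
  proof cases
    case 2
    then have "q = r - 1"
      using q'(2) \<open>q' = q\<close> word_perm_eq_iff[of "take (snd (bump v r \<rho>)) (\<theta> \<rho>)" q "r - 1"] by simp
    then show ?thesis using 2 by simp
  qed simp
qed

lemma bump_flags_backward:
  assumes "length is = length \<rho>" "sorted_wrt before (zip is (\<theta> \<rho>))"
    and q: "word_perm (\<theta> \<rho>) = v \<circ> Transposition.transpose q r"
    and fl: "\<And>t. t < length \<rho> \<Longrightarrow> is ! t \<le> \<theta> \<rho> ! t \<or> q = r - 1 \<and> is ! t = r \<and> \<theta> \<rho> ! t = r - 1"
    and t: "t < length \<rho>"
  shows "is ! t \<le> \<rho> ! t"
proof (cases "is ! t \<le> \<theta> \<rho> ! t")
  case True
  then show ?thesis using bump_le[OF t] by simp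
next
  case False
  then have bad: "q = r - 1" "is ! t = r" "\<theta> \<rho> ! t = r - 1" using fl[OF t] by auto
  have above: "r < \<theta> \<rho> ! u" if u: "u < t" for u
  proof -
    have s: "is ! t < is ! u \<or> is ! u = is ! t \<and> \<theta> \<rho> ! u < \<theta> \<rho> ! t"
      using sorted_before_zip_nth[OF assms(2) _ u] assms(1) t bump_length by simp
    have f: "is ! u \<le> \<theta> \<rho> ! u \<or> is ! u = r \<and> \<theta> \<rho> ! u = r - 1" using fl[of u] u t by auto
    show ?thesis using s f bad r by linarith
  qed
  let ?A = "take t (\<theta> \<rho>)" and ?D = "drop (Suc t) (\<theta> \<rho>)"
  have "\<theta> \<rho> = ?A @ (r - 1) # ?D" using id_take_nth_drop[of t "\<theta> \<rho>"] t bump_length bad by simp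
  moreover have "\<forall>a\<in>set ?A. Suc (r - 1) < a" using above t bump_length r by (auto simp: in_set_conv_nth)
  ultimately have "word_perm (\<theta> \<rho>) = word_perm ((r - 1) # ?A @ ?D)" using word_perm_move_left by metis
  then have "v \<circ> simple_transp (r - 1) = word_perm (del t (\<theta> \<rho>)) \<circ> simple_transp (r - 1)"
    using q bad(1) r by (simp add: word_perm_Cons del_def)
  then have "v \<circ> simple_transp (r - 1) \<circ> simple_transp (r - 1) = word_perm (del t (\<theta> \<rho>)) \<circ> simple_transp (r - 1) \<circ> simple_transp (r - 1)"
    by simp
  then have "v = word_perm (del t (\<theta> \<rho>))" by (simp add: comp_assoc fun_eq_iff)
  moreover have "snd (bump v r \<rho>) < length (\<theta> \<rho>)" "word_perm (del (snd (bump v r \<rho>)) (\<theta> \<rho>)) = v"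
    using bump_ex(3)[OF r red mark] by (cases "bump v r \<rho>"; simp add: marked_def)+
  ultimately have "t = snd (bump v r \<rho>)"
    using deletion_unique_reduced[OF bump_ex(2)[OF r red mark], of t "snd (bump v r \<rho>)"] t bump_length by simp
  then show ?thesis using bump_mark_less bad by auto
qed

end

end

section \<open>Every Coxeter--Knuth class yields a key polynomial or zero\<close>

definition ck_class :: "nat list \<Rightarrow> nat list set" where
  "ck_class \<rho> = {\<sigma>. ck_equiv \<rho> \<sigma>}"

lemma ck_class_eq: "ck_equiv \<rho> \<sigma> \<Longrightarrow> ck_class \<rho> = ck_class \<sigma>"
  unfolding ck_class_def using ck_equiv_sym ck_equiv_trans by blast

lemma ck_closed_ck_class:
  assumes "reduced_word \<rho>"
  shows "ck_closed (ck_class \<rho>)"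
proof -
  have "finite (ck_class \<rho>)"
  proof (rule finite_subset)
    show "ck_class \<rho> \<subseteq> {\<sigma>. set \<sigma> \<subseteq> set \<rho> \<and> length \<sigma> = length \<rho>}"
      unfolding ck_class_def using ck_equiv_props by auto
  qed (simp add: finite_lists_length_eq)
  then show ?thesis unfolding ck_closed_def ck_class_def using assms ck_equiv_props(4) ck_equiv_trans by blast
qed

lemma content_zip: "length is = length \<rho> \<Longrightarrow> content (zip is \<rho>) = (\<Sum>i\<leftarrow>is. unit_comp i)"
  unfolding content_def by (induction "is" \<rho> rule: list_induct2) auto

lemma zip_mem_biwords:
  assumes "length is = length \<rho>"
  shows "zip is \<rho> \<in> biwords C F \<longleftrightarrow> sorted_wrt before (zip is \<rho>) \<and> \<rho> \<in> C \<and> (\<forall>t<length \<rho>. F (is ! t, \<rho> ! t))"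
proof -
  have "(\<forall>x\<in>set (zip is \<rho>). F x) \<longleftrightarrow> (\<forall>t<length (zip is \<rho>). F (zip is \<rho> ! t))"
    by (rule all_set_conv_all_nth)
  also have "\<dots> \<longleftrightarrow> (\<forall>t<length \<rho>. F (is ! t, \<rho> ! t))" using assms by simp
  finally show ?thesis using assms by (simp add: biwords_def)
qed

lemma ck_at_window:
  assumes "ck_at i \<rho> \<sigma>"
  shows "Suc (Suc i) < length \<rho>"
    "\<rho> ! i < \<rho> ! Suc i \<longleftrightarrow> \<rho> ! Suc (Suc i) < \<rho> ! Suc i"
    "\<rho> ! i \<noteq> \<rho> ! Suc i" "\<rho> ! Suc i \<noteq> \<rho> ! Suc (Suc i)"
proof -
  obtain A T T' B where *: "length A = i" "\<rho> = A @ T @ B" "ck_triple T T'"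
    using assms unfolding ck_at_def by blast
  have n: "\<rho> ! i = T ! 0" "\<rho> ! Suc i = T ! 1" "\<rho> ! Suc (Suc i) = T ! 2"
    using * ck_triple_length[OF *(3)] by (auto simp: nth_append numeral_2_eq_2)
  show "Suc (Suc i) < length \<rho>" using * ck_triple_length[OF *(3)] by simp
  show "\<rho> ! i < \<rho> ! Suc i \<longleftrightarrow> \<rho> ! Suc (Suc i) < \<rho> ! Suc i"
    "\<rho> ! i \<noteq> \<rho> ! Suc i" "\<rho> ! Suc i \<noteq> \<rho> ! Suc (Suc i)"
    unfolding n using *(3) by (cases rule: ck_triple.cases; simp)+
qed

lemma ck_at_exists:
  assumes "reduced_word \<rho>" "Suc (Suc i) < length \<rho>"
    "\<rho> ! i < \<rho> ! Suc i \<longleftrightarrow> \<rho> ! Suc (Suc i) < \<rho> ! Suc i"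
  shows "\<exists>\<sigma>. ck_at i \<rho> \<sigma>"
proof -
  obtain A p q x B where \<rho>: "\<rho> = A @ [p, q, x] @ B" "length A = i" using split_at_window[OF assms(2)] .
  then have n: "\<rho> ! i = p" "\<rho> ! Suc i = q" "\<rho> ! Suc (Suc i) = x" by (auto simp: nth_append)
  have "p \<noteq> q" "q \<noteq> x" using reduced_word_adjacent[OF assms(1)] assms(2) n by (metis Suc_lessD)+
  then have "p > q \<and> q < x \<or> p < q \<and> q > x" using assms(3) n by auto
  then obtain T' where "ck_triple [p, q, x] T'" using ck_triple_exists[of A p q x B] assms(1) \<rho> by auto
  then show ?thesis unfolding ck_at_def using \<rho> by blast
qed

lemma genfun_bump:
  assumes red: "reduced_word \<rho>\<^sub>0" and w: "word_perm \<rho>\<^sub>0 = w"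
    and rs: "2 \<le> r" "r < s" "w (r - 1) < w s" "w s < w r" "\<And>k. r < k \<Longrightarrow> k < s \<Longrightarrow> w k < w s \<or> w r < w k"
  shows "\<exists>\<rho>\<^sub>1. reduced_word \<rho>\<^sub>1 \<and> sum_list \<rho>\<^sub>1 < sum_list \<rho>\<^sub>0 \<and>
    (genfun (biwords (ck_class \<rho>\<^sub>0) flagged) = genfun (biwords (ck_class \<rho>\<^sub>1) flagged) \<or>
     genfun (biwords (ck_class \<rho>\<^sub>0) flagged) = genfun (biwords (ck_class \<rho>\<^sub>1) (relaxed (r - 1))))"
proof -
  define v where "v = w \<circ> Transposition.transpose r s"
  have v: "v r = w s" "v s = w r" "v (r - 1) = w (r - 1)" "\<And>k. r < k \<Longrightarrow> k < s \<Longrightarrow> v k = w k"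
    using rs by (auto simp: v_def transpose_def)
  have r: "2 \<le> r" "v (r - 1) < v r" using rs v by auto
  have mk: "\<exists>j<length \<sigma>. word_perm (take j \<sigma>) r = \<sigma> ! j \<and> word_perm (del j \<sigma>) = v" if w\<sigma>: "word_perm \<sigma> = w" for \<sigma>
  proof -
    obtain B d D where split: "\<sigma> = B @ d # D" "word_perm B r = d" "word_perm B s = Suc d"
      using word_perm_crossing[OF rs(2), of \<sigma>] rs(4) unfolding w\<sigma> by metis
    have "simple_transp d (word_perm B (Transposition.transpose r s i)) = word_perm B i" for i
    proof -
      have "word_perm B i = d \<longleftrightarrow> i = r" "word_perm B i = Suc d \<longleftrightarrow> i = s" using split word_perm_eq_iff by metis+
      then show ?thesis using split by (auto simp: transpose_def)
    qed
    then have "word_perm (B @ D) = v"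
      unfolding v_def w\<sigma>[symmetric] split(1) by (simp add: word_perm_append word_perm_Cons fun_eq_iff)
    then show ?thesis using split by (intro exI[of _ "length B"]) auto
  qed
  have num: "num_inversions w = Suc (num_inversions v)"
  proof -
    obtain j where "word_perm (del j \<rho>\<^sub>0) = v" using mk[OF w] by blast
    then have "finite (inversions v)" using finite_inversions_word_perm[of "del j \<rho>\<^sub>0"] by simp
    moreover have wv: "v \<circ> Transposition.transpose r s = w" by (simp add: v_def fun_eq_iff)
    moreover have "finite (inversions w)" using finite_inversions_word_perm[of \<rho>\<^sub>0] w by simp
    ultimately have fin: "finite (inversions v)" "finite (inversions (v \<circ> Transposition.transpose r s))"
      and wv: "v \<circ> Transposition.transpose r s = w" by simp_all
    have "num_inversions (v \<circ> Transposition.transpose r s) = Suc (num_inversions v)"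
    proof (rule num_inversions_transpose_cover[OF fin rs(2)])
      show "v r < v s" using rs v by simp
      fix k assume "r < k" "k < s"
      then show "v k < v r \<or> v s < v k" using rs(5) v by simp
    qed
    then show ?thesis using wv by simp
  qed
  have mark: "\<exists>j. marked 0 v r (\<sigma>, j)" if \<sigma>: "reduced_word \<sigma>" "word_perm \<sigma> = w" for \<sigma>
  proof -
    obtain j where j: "j < length \<sigma>" "word_perm (take j \<sigma>) r = \<sigma> ! j" "word_perm (del j \<sigma>) = v" using mk \<sigma> by blast
    have pos: "\<forall>i\<in>set \<sigma>. 1 \<le> i" and l: "length \<sigma> = Suc (num_inversions v)"
      using \<sigma> num by (simp_all add: reduced_word_iff)
    have "\<forall>i\<in>set (del j \<sigma>). 1 \<le> i"
      using pos by (auto simp: del_def dest: in_set_takeD in_set_dropD)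
    moreover have "length (del j \<sigma>) = num_inversions v" using length_del[OF j(1)] l by simp
    ultimately have "reduced_word (del j \<sigma>)" unfolding reduced_word_iff j(3) by blast
    then have "marked 0 v r (\<sigma>, j)" using j pos by (simp add: marked_def)
    then show ?thesis by blast
  qed
  define \<theta> where "\<theta> = (\<lambda>\<rho>. fst (bump v r \<rho>))"
  define C where "C = ck_class \<rho>\<^sub>0"
  have C: "reduced_word \<sigma>" "word_perm \<sigma> = w" if "\<sigma> \<in> C" for \<sigma>
    using that ck_equiv_props red w unfolding C_def ck_class_def by auto
  have step: "ck_at i (\<theta> \<sigma>) (\<theta> \<tau>)" if "\<sigma> \<in> C" "\<tau> \<in> C" "ck_at i \<sigma> \<tau>" for i \<sigma> \<tau>
    using bump_ck_at[OF r C(1)[OF that(1)] _ _ that(3)] mark C that unfolding \<theta>_def by blast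
  have red\<theta>: "reduced_word (\<theta> \<sigma>)" if "\<sigma> \<in> C" for \<sigma>
    using bump_ex(2)[OF r] mark C that unfolding \<theta>_def by blast
  have img1: "ck_equiv (\<theta> \<rho>\<^sub>0) (\<theta> \<sigma>)" if "ck_equiv \<rho>\<^sub>0 \<sigma>" for \<sigma>
    using that
  proof (induction rule: ck_equiv_induct)
    case (step \<sigma> \<tau> i)
    then have "\<sigma> \<in> C" "\<tau> \<in> C" using ck_equiv_step ck_equiv_trans by (auto simp: C_def ck_class_def)
    then show ?case using \<open>\<And>i \<sigma> \<tau>. \<lbrakk>\<sigma> \<in> C; \<tau> \<in> C; ck_at i \<sigma> \<tau>\<rbrakk> \<Longrightarrow> ck_at i (\<theta> \<sigma>) (\<theta> \<tau>)\<close> step ck_equiv_step ck_equiv_trans by blast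
  qed simp
  have img2: "\<exists>\<sigma>\<in>C. \<tau> = \<theta> \<sigma>" if "ck_equiv (\<theta> \<rho>\<^sub>0) \<tau>" for \<tau>
    using that
  proof (induction rule: ck_equiv_induct)
    case refl
    have "\<rho>\<^sub>0 \<in> C" by (simp add: C_def ck_class_def)
    then show ?case by blast
  next
    case (step \<tau> \<tau>' i)
    then obtain \<sigma> where \<sigma>: "\<sigma> \<in> C" "\<tau> = \<theta> \<sigma>" by blast
    obtain j where j: "marked 0 v r (\<sigma>, j)" using mark C \<sigma> by blast
    have len: "length (\<theta> \<sigma>) = length \<sigma>" using bump_length[OF r C(1)[OF \<sigma>(1)] j] by (simp add: \<theta>_def)
    note win = ck_at_window[OF step(2)]
    have asc: "\<sigma> ! i < \<sigma> ! Suc i \<longleftrightarrow> \<tau> ! i < \<tau> ! Suc i"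
      "\<sigma> ! Suc i < \<sigma> ! Suc (Suc i) \<longleftrightarrow> \<tau> ! Suc i < \<tau> ! Suc (Suc i)"
      using bump_ascent_iff[OF r C(1)[OF \<sigma>(1)] j] win(1) len \<sigma>(2) by (simp_all add: \<theta>_def)
    have "\<sigma> ! Suc i \<noteq> \<sigma> ! Suc (Suc i)" using reduced_word_adjacent[OF C(1)[OF \<sigma>(1)]] win(1) len \<sigma>(2) by simp
    then have "\<sigma> ! i < \<sigma> ! Suc i \<longleftrightarrow> \<sigma> ! Suc (Suc i) < \<sigma> ! Suc i"
      using asc win(2-4) by (metis linorder_neqE_nat less_asym')
    then obtain \<sigma>' where \<sigma>': "ck_at i \<sigma> \<sigma>'" using ck_at_exists C(1) \<sigma> win(1) len by metis
    then have "\<sigma>' \<in> C" using \<sigma>(1) ck_equiv_step ck_equiv_trans by (auto simp: C_def ck_class_def)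
    then have "ck_at i \<tau> (\<theta> \<sigma>')" using \<open>\<And>i \<sigma> \<tau>. \<lbrakk>\<sigma> \<in> C; \<tau> \<in> C; ck_at i \<sigma> \<tau>\<rbrakk> \<Longrightarrow> ck_at i (\<theta> \<sigma>) (\<theta> \<tau>)\<close> \<sigma> \<sigma>' by blast
    then have "\<tau>' = \<theta> \<sigma>'" using ck_at_functional step(2) by blast
    then show ?case using \<open>\<sigma>' \<in> C\<close> by blast
  qed
  have \<rho>\<^sub>0: "\<rho>\<^sub>0 \<in> C" by (simp add: C_def ck_class_def)
  have img: "\<theta> ` C = ck_class (\<theta> \<rho>\<^sub>0)" using img1 img2 unfolding C_def ck_class_def by blast
  have inj: "inj_on \<theta> C"
  proof (rule inj_onI)
    fix \<sigma> \<tau> assume *: "\<sigma> \<in> C" "\<tau> \<in> C" "\<theta> \<sigma> = \<theta> \<tau>"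
    obtain j j' where "marked 0 v r (\<sigma>, j)" "marked 0 v r (\<tau>, j')" using mark C * by metis
    then show "\<sigma> = \<tau>" using bump_injective[OF r C(1)[OF *(1)] _ C(1)[OF *(2)]] *(3) unfolding \<theta>_def by blast
  qed
  obtain j\<^sub>0 where j\<^sub>0: "marked 0 v r (\<rho>\<^sub>0, j\<^sub>0)" using mark red w by blast
  obtain q where q: "word_perm (\<theta> \<rho>\<^sub>0) = v \<circ> Transposition.transpose q r"
    using bump_word_perm[OF r red j\<^sub>0] unfolding \<theta>_def by blast
  have q\<theta>: "word_perm (\<theta> \<sigma>) = v \<circ> Transposition.transpose q r" if "\<sigma> \<in> C" for \<sigma>
    using img1 that ck_equiv_props(1) q unfolding C_def ck_class_def by force
  define F where "F = (if q = r - 1 then relaxed (r - 1) else flagged)"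
  have F: "F (i, a) \<longleftrightarrow> 1 \<le> i \<and> (i \<le> a \<or> q = r - 1 \<and> i = r \<and> a = r - 1)" for i a
    using r(1) by (auto simp: F_def relaxed_def flagged_def)
  have len: "length (\<theta> \<sigma>) = length \<sigma>" if "\<sigma> \<in> C" for \<sigma>
    using bump_length[OF r C(1)[OF that]] mark C that unfolding \<theta>_def by blast
  have mem: "zip is (\<theta> \<sigma>) \<in> biwords (\<theta> ` C) F \<longleftrightarrow> zip is \<sigma> \<in> biwords C flagged"
    if \<sigma>: "\<sigma> \<in> C" and "is": "length is = length \<sigma>" for "is" \<sigma>
  proof -
    obtain j where j: "marked 0 v r (\<sigma>, j)" using mark C \<sigma> by blast
    note b = C(1)[OF \<sigma>] j
    have s: "sorted_wrt before (zip is (\<theta> \<sigma>)) \<longleftrightarrow> sorted_wrt before (zip is \<sigma>)"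
      using bump_sorted_before[OF r b "is"] by (simp add: \<theta>_def)
    have f: "(\<forall>t<length \<sigma>. F (is ! t, \<theta> \<sigma> ! t)) \<longleftrightarrow> (\<forall>t<length \<sigma>. flagged (is ! t, \<sigma> ! t))"
      if sorted: "sorted_wrt before (zip is \<sigma>)"
    proof
      assume a: "\<forall>t<length \<sigma>. F (is ! t, \<theta> \<sigma> ! t)"
      then have a': "is ! t \<le> \<theta> \<sigma> ! t \<or> q = r - 1 \<and> is ! t = r \<and> \<theta> \<sigma> ! t = r - 1" if "t < length \<sigma>" for t
        using that F by blast
      have "is ! t \<le> \<sigma> ! t" if "t < length \<sigma>" for t
        using bump_flags_backward[OF r b "is", of q t] a' q\<theta>[OF \<sigma>] s sorted that unfolding \<theta>_def by blast
      then show "\<forall>t<length \<sigma>. flagged (is ! t, \<sigma> ! t)" using a F by (auto simp: flagged_def)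
    next
      assume a: "\<forall>t<length \<sigma>. flagged (is ! t, \<sigma> ! t)"
      then have "\<forall>t<length \<sigma>. is ! t \<le> \<sigma> ! t" by (simp add: flagged_def)
      then have "is ! t \<le> \<theta> \<sigma> ! t \<or> q = r - 1 \<and> is ! t = r \<and> \<theta> \<sigma> ! t = r - 1" if "t < length \<sigma>" for t
        using bump_flags_forward[OF r b "is" sorted _ _ that, of q] q\<theta>[OF \<sigma>] unfolding \<theta>_def by blast
      then show "\<forall>t<length \<sigma>. F (is ! t, \<theta> \<sigma> ! t)" using a F by (auto simp: flagged_def)
    qed
    show ?thesis
      using "is" len[OF \<sigma>] s f \<sigma> by (simp add: zip_mem_biwords) blast
  qed
  define h where "h = (\<lambda>b :: (nat \<times> nat) list. zip (map fst b) (\<theta> (map snd b)))"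
  have zip_id: "zip (map fst b) (map snd b) = b" for b :: "(nat \<times> nat) list" by (simp add: zip_map_fst_snd)
  have inC: "map snd b \<in> C" if "b \<in> biwords C flagged" for b using that by (simp add: biwords_def)
  have "bij_betw h (biwords C flagged) (biwords (\<theta> ` C) F)"
    unfolding bij_betw_def
  proof
    show "inj_on h (biwords C flagged)"
    proof (rule inj_onI)
      fix b c assume *: "b \<in> biwords C flagged" "c \<in> biwords C flagged" "h b = h c"
      have "map fst (h b) = map fst b" "map snd (h b) = \<theta> (map snd b)" "map fst (h c) = map fst c" "map snd (h c) = \<theta> (map snd c)"
        using len[OF inC[OF *(1)]] len[OF inC[OF *(2)]] by (simp_all add: h_def)
      then have "map fst b = map fst c" "\<theta> (map snd b) = \<theta> (map snd c)" using *(3) by simp_all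
      then have "map fst b = map fst c" "map snd b = map snd c" using inj_onD[OF inj] inC * by blast+
      then show "b = c" using zip_id by metis
    qed
    show "h ` biwords C flagged = biwords (\<theta> ` C) F"
    proof (intro equalityI subsetI)
      fix b' assume "b' \<in> h ` biwords C flagged"
      then obtain b where b: "b' = h b" "b \<in> biwords C flagged" by blast
      then have "zip (map fst b) (map snd b) \<in> biwords C flagged" using zip_id by simp
      then show "b' \<in> biwords (\<theta> ` C) F" unfolding b(1) h_def using mem[OF inC[OF b(2)]] by simp
    next
      fix b' assume b': "b' \<in> biwords (\<theta> ` C) F"
      then obtain \<sigma> where \<sigma>: "\<sigma> \<in> C" "map snd b' = \<theta> \<sigma>" by (auto simp: biwords_def)
      have l: "length (map fst b') = length \<sigma>" using len[OF \<sigma>(1)] \<sigma>(2) by (metis length_map)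
      have "zip (map fst b') (\<theta> \<sigma>) = b'" using zip_id[of b'] \<sigma>(2) by simp
      then have "zip (map fst b') \<sigma> \<in> biwords C flagged" using mem[OF \<sigma>(1) l] b' by simp
      moreover have "h (zip (map fst b') \<sigma>) = b'"
        using l \<open>zip (map fst b') (\<theta> \<sigma>) = b'\<close> by (simp add: h_def)
      ultimately show "b' \<in> h ` biwords C flagged" by (metis imageI)
    qed
  qed
  then have "genfun (biwords (\<theta> ` C) F) = (\<Sum>b\<in>biwords C flagged. monom (content (h b)))"
    unfolding genfun_def by (rule sum.reindex_bij_betw[symmetric])
  also have "\<dots> = genfun (biwords C flagged)"
    unfolding genfun_def
  proof (rule sum.cong[OF refl])
    fix b assume b: "b \<in> biwords C flagged"
    have "content (h b) = content (zip (map fst b) (map snd b))"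
      using len[OF inC[OF b]] by (simp only: h_def content_zip length_map)
    then show "monom (content (h b)) = monom (content b)" using zip_id by simp
  qed
  finally have "genfun (biwords (ck_class \<rho>\<^sub>0) flagged) = genfun (biwords (ck_class (\<theta> \<rho>\<^sub>0)) F)"
    using img unfolding C_def by simp
  moreover have "sum_list (\<theta> \<rho>\<^sub>0) < sum_list \<rho>\<^sub>0" using bump_sum_list[OF r red j\<^sub>0] by (simp add: \<theta>_def)
  ultimately show ?thesis using red\<theta>[OF \<rho>\<^sub>0] unfolding F_def by (intro exI[of _ "\<theta> \<rho>\<^sub>0"]) auto
qed

lemma coeff_genfun:
  assumes "finite S"
  shows "coeff (genfun S) c = int (card {b \<in> S. content b = c})"
proof -
  have "coeff (genfun S) c = (\<Sum>b\<in>S. if content b = c then 1 else 0)"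
    unfolding genfun_def lookup_sum by (intro sum.cong) (auto simp: lookup_single when_def)
  then show ?thesis using assms by (simp add: sum.If_cases Int_def)
qed

lemma finite_corner_biwords:
  assumes "finite C" "1 \<le> p"
  shows "finite (corner_biwords C p)"
proof -
  have "finite (insert_corner p ` corner_biwords C p)"
    using finite_biwords_relaxed[OF assms(1), of p] biwords_relaxed_split(1)[OF assms(2), of C] by simp
  then show ?thesis using biwords_relaxed_split(3)[OF assms(2)] by (simp add: finite_image_iff)
qed

lemma genfun_subset_monom:
  assumes "genfun S = monom a" "finite S" "T \<subseteq> S"
  shows "genfun T = 0 \<or> genfun T = monom a"
proof -
  have c: "int (card {b \<in> S. content b = c}) = (if c = a then 1 else 0)" for c
    using coeff_genfun[OF assms(2), of c] assms(1) by (simp add: lookup_single when_def)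
  have "content b = a" if "b \<in> S" for b
  proof (rule ccontr)
    assume "content b \<noteq> a"
    then have "card {x \<in> S. content x = content b} = 0" using c[of "content b"] by simp
    then show False using assms(2) that by auto
  qed
  then have ca: "\<And>b. b \<in> S \<Longrightarrow> content b = a" "{b \<in> S. content b = a} = S" by auto
  then have "card S = 1" using c[of a] by simp
  then obtain b where "S = {b}" by (auto simp: card_1_singleton_iff)
  then have "T = {} \<or> T = {b}" using assms(3) by auto
  then show ?thesis using ca(1) \<open>S = {b}\<close> by (auto simp: genfun_def)
qed

lemma not_dominantE:
  assumes "w permutes {1..n}" "\<not> dominant w"
  obtains r s where "2 \<le> r" "r < s" "w (r - 1) < w s" "w s < w r"
    "\<And>k. r < k \<Longrightarrow> k < s \<Longrightarrow> w k < w s \<or> w r < w k"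
proof -
  obtain m t where mt: "1 \<le> m" "Suc m < t" "w m < w t" "w t < w (Suc m)"
    using assms(2) unfolding dominant_def by blast
  define K where "K = {k. Suc m < k \<and> w k < w (Suc m)}"
  have fin: "finite K" unfolding K_def using finite_code[OF assms(1)] .
  have t: "t \<in> K" using mt by (simp add: K_def)
  have "Max (w ` K) \<in> w ` K" using fin t by (intro Max_in) auto
  then obtain s where s: "s \<in> K" "w s = Max (w ` K)" by auto
  have max: "w k \<le> w s" if "k \<in> K" for k unfolding s(2) using fin that by (intro Max_ge) auto
  show ?thesis
  proof (rule that[of "Suc m" s])
    show "2 \<le> Suc m" "Suc m < s" "w s < w (Suc m)" using mt s(1) by (auto simp: K_def)
    show "w (Suc m - 1) < w s" using max[OF t] mt by simp
    fix k assume k: "Suc m < k" "k < s"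
    have ne: "w k \<noteq> w s" "w k \<noteq> w (Suc m)" using k permutes_inj[OF assms(1)] by (auto simp: inj_eq)
    show "w k < w s \<or> w (Suc m) < w k"
    proof (cases "w k < w (Suc m)")
      case True
      then have "k \<in> K" using k by (simp add: K_def)
      then show ?thesis using max ne by (metis le_neq_implies_less)
    qed (use ne in auto)
  qed
qed

lemma ck_class_key_like:
  assumes "reduced_word \<rho>"
  shows "genfun (biwords (ck_class \<rho>) flagged) = 0 \<or> (\<exists>a. key_like (genfun (biwords (ck_class \<rho>) flagged)) a)"
  using assms
proof (induction "sum_list \<rho>" arbitrary: \<rho> rule: less_induct)
  case less
  define w where "w = word_perm \<rho>"
  obtain n where n: "w permutes {1..n}"
  proof -
    have "set \<rho> \<subseteq> {1..<Suc (Max (set \<rho>))}" using less.prems by (auto simp: reduced_word_iff less_Suc_eq_le)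
    then show ?thesis using that word_perm_permutes w_def by blast
  qed
  show ?case
  proof (cases "dominant w")
    case True
    obtain a where a: "genfun (biwords (reduced_words w) flagged) = monom a" "part a 0 = 0" "\<forall>i\<ge>1. part a i = code w i"
      using genfun_dominant[OF n True] by blast
    have "ck_class \<rho> \<subseteq> reduced_words w"
      using less.prems ck_equiv_props by (auto simp: ck_class_def reduced_words_iff w_def)
    then have "biwords (ck_class \<rho>) flagged \<subseteq> biwords (reduced_words w) flagged" by (auto simp: biwords_def)
    then have "genfun (biwords (ck_class \<rho>) flagged) = 0 \<or> genfun (biwords (ck_class \<rho>) flagged) = monom a"
      using genfun_subset_monom[OF a(1)] finite_biwords_flagged finite_reduced_words[OF n] by blast
    moreover have "key_like (monom a) a"
      using a(2,3) code_dominant_decreasing[OF n True] by (intro key_like_monom) auto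
    ultimately show ?thesis by metis
  next
    case False
    obtain r s where rs: "2 \<le> r" "r < s" "w (r - 1) < w s" "w s < w r"
      "\<And>k. r < k \<Longrightarrow> k < s \<Longrightarrow> w k < w s \<or> w r < w k"
      using not_dominantE[OF n False] by metis
    obtain \<sigma> where \<sigma>: "reduced_word \<sigma>" "sum_list \<sigma> < sum_list \<rho>"
      "genfun (biwords (ck_class \<rho>) flagged) = genfun (biwords (ck_class \<sigma>) flagged) \<or>
       genfun (biwords (ck_class \<rho>) flagged) = genfun (biwords (ck_class \<sigma>) (relaxed (r - 1)))"
      using genfun_bump[OF less.prems w_def[symmetric] rs] by blast
    let ?f = "genfun (biwords (ck_class \<sigma>) flagged)"
    have IH: "?f = 0 \<or> (\<exists>a. key_like ?f a)" using less.hyps \<sigma> by blast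
    have closed: "ck_closed (ck_class \<sigma>)" using ck_closed_ck_class[OF \<sigma>(1)] .
    have fin: "finite (ck_class \<sigma>)" using closed by (simp add: ck_closed_def)
    have p: "1 \<le> r - 1" using rs(1) by simp
    note dem = demazure_op_genfun[OF closed p]
    from \<sigma>(3) show ?thesis
    proof
      assume eq: "genfun (biwords (ck_class \<rho>) flagged) = genfun (biwords (ck_class \<sigma>) (relaxed (r - 1)))"
      from IH show ?thesis
      proof
        assume "?f = 0"
        moreover have "demazure_op (r - 1) 0 = 0" by (rule demazure_op_symmetric) simp
        ultimately show ?thesis using eq dem by simp
      next
        assume "\<exists>a. key_like ?f a"
        then obtain a where "key_like ?f a" by blast
        from key_like_demazure_op[OF this p dem[symmetric] genfun_relaxed[OF fin p] genfun_corner_symmetric[OF closed p]]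
        have "\<exists>a'. key_like (genfun (biwords (ck_class \<sigma>) (relaxed (r - 1)))) a'"
          using coeff_genfun[OF finite_biwords_flagged[OF fin]] coeff_genfun[OF finite_corner_biwords[OF fin p]] by simp
        then show ?thesis using eq by simp
      qed
    qed (use IH in simp)
  qed
qed

section \<open>The weak descent composition\<close>

lemma runs_nonempty: "runs (x # xs) \<noteq> []"
  by (cases xs) auto

lemma concat_runs: "concat (runs xs) = xs"
proof (induction xs rule: runs.induct)
  case (3 x y zs)
  show ?case
  proof (cases "x < y")
    case True
    have "concat (hd (runs (y # zs)) # tl (runs (y # zs))) = y # zs"
      using 3(1)[OF True] runs_nonempty[of y zs] by simp
    then show ?thesis using True by simp
  qed (use 3 in simp)
qed auto

lemma hd_hd_runs: "hd (runs (x # xs)) \<noteq> [] \<and> hd (hd (runs (x # xs))) = x"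
  by (cases xs) auto

definition run_list :: "nat list list \<Rightarrow> bool" where
  "run_list rs \<longleftrightarrow> (\<forall>run\<in>set rs. run \<noteq> [] \<and> increasing run) \<and> successively (\<lambda>r r'. hd r' \<le> last r) rs"

lemma run_list_runs: "run_list (runs xs)"
proof (induction xs rule: runs.induct)
  case (3 x y zs)
  obtain r rs where r: "runs (y # zs) = r # rs" using runs_nonempty[of y zs] by (cases "runs (y # zs)") auto
  have r1: "r \<noteq> []" "hd r = y" using hd_hd_runs[of y zs] r by auto
  show ?case
  proof (cases "x < y")
    case True
    have IH: "run_list (r # rs)" using 3(1)[OF True] r by simp
    then have "increasing r" by (simp add: run_list_def)
    then have "increasing (x # r)" using r1 True by (cases r) auto
    then show ?thesis using IH True r r1 by (cases rs) (auto simp: run_list_def)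
  next
    case False
    have IH: "run_list (r # rs)" using 3(3)[OF False] r by simp
    then show ?thesis using False r r1 by (auto simp: run_list_def)
  qed
qed (auto simp: run_list_def)

fun rows :: "int \<Rightarrow> nat list list \<Rightarrow> int list" where
  "rows m [] = []"
| "rows m (run # rs) = (let k = min m (int (hd run)) in k # rows (k - 1) rs)"

fun top_indices :: "int \<Rightarrow> nat list list \<Rightarrow> int list" where
  "top_indices m [] = []"
| "top_indices m (run # rs) = (let k = min m (int (hd run)) in replicate (length run) k @ top_indices (k - 1) rs)"

lemma Min_increasing: "increasing run \<Longrightarrow> run \<noteq> [] \<Longrightarrow> Min (set run) = hd run"
  by (cases run) (auto intro!: Min_eqI simp: less_imp_le)

lemma adjust_minima_rows:
  "\<forall>run\<in>set (run # rs). run \<noteq> [] \<and> increasing run \<Longrightarrow>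
   adjust_minima (min m (int (Min (set run))) # map (\<lambda>run. int (Min (set run))) rs) = rows m (run # rs)"
proof (induction rs arbitrary: m run)
  case (Cons run' rs)
  define h where "h = min m (int (hd run))"
  have h: "min m (int (Min (set run))) = h" using Cons.prems by (simp add: Min_increasing h_def)
  have "adjust_minima (min (h - 1) (int (Min (set run'))) # map (\<lambda>run. int (Min (set run))) rs) = rows (h - 1) (run' # rs)"
    using Cons.IH[of run' "h - 1"] Cons.prems by simp
  then have "adjust_minima (h # map (\<lambda>run. int (Min (set run))) (run' # rs)) = h # rows (h - 1) (run' # rs)"
    by (simp only: list.map adjust_minima.simps min.commute)
  moreover have "rows m (run # run' # rs) = h # rows (h - 1) (run' # rs)"
    by (simp only: rows.simps(2)[of m] Let_def h_def)
  ultimately show ?case unfolding h by (simp only:)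
next
  case Nil
  then have "Min (set run) = hd run" by (simp add: Min_increasing)
  then show ?case by simp
qed

lemma run_rows_eq:
  assumes "\<forall>x\<in>set \<rho>. int x \<le> m"
  shows "run_rows \<rho> = rows m (runs \<rho>)"
proof (cases \<rho>)
  case (Cons x xs)
  obtain run rs where r: "runs \<rho> = run # rs" using Cons runs_nonempty by (metis list.exhaust)
  have rl: "\<forall>run\<in>set (run # rs). run \<noteq> [] \<and> increasing run" using run_list_runs[of \<rho>] r by (simp add: run_list_def)
  have "hd run = x" using hd_hd_runs[of x xs] r Cons by simp
  then have "min m (int (Min (set run))) = int (Min (set run))" using assms Cons rl by (simp add: Min_increasing)
  then show ?thesis using adjust_minima_rows[OF rl, of m] r by (simp add: run_rows_def)
qed (simp add: run_rows_def)

lemma rows_decreasing: "rs \<noteq> [] \<Longrightarrow> k \<in> set (rows m rs) \<Longrightarrow> last (rows m rs) \<le> k \<and> k \<le> m"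
proof (induction rs arbitrary: m k)
  case (Cons run rs)
  define h where "h = min m (int (hd run))"
  have eq: "rows m (run # rs) = h # rows (h - 1) rs" by (simp add: h_def Let_def)
  have hm: "h \<le> m" by (simp add: h_def)
  show ?case
  proof (cases rs)
    case Nil
    then show ?thesis using Cons.prems hm unfolding eq by simp
  next
    case (Cons run' rs')
    then have ne: "rs \<noteq> []" "rows (h - 1) rs \<noteq> []" by (auto simp: Let_def)
    have IH: "\<And>k. k \<in> set (rows (h - 1) rs) \<Longrightarrow> last (rows (h - 1) rs) \<le> k \<and> k \<le> h - 1" using Cons.IH ne by blast
    have "last (rows (h - 1) rs) \<in> set (rows (h - 1) rs)" using ne by simp
    then have "last (rows (h - 1) rs) \<le> h" using IH by fastforce
    then show ?thesis using Cons.prems(2) hm IH[of k] ne unfolding eq by auto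
  qed
qed simp

lemma set_top_indices: "\<forall>run\<in>set rs. run \<noteq> [] \<Longrightarrow> set (top_indices m rs) = set (rows m rs)"
  by (induction rs arbitrary: m) (auto simp: Let_def)

lemma length_top_indices: "length (top_indices m rs) = length (concat rs)"
  by (induction rs arbitrary: m) (auto simp: Let_def)

lemma flagged_le_top_indices:
  assumes "run_list rs" "length is = length (concat rs)" "sorted_wrt before (zip is (concat rs))"
    "\<forall>x\<in>set (zip is (concat rs)). flagged x" "\<forall>i\<in>set is. int i \<le> m"
  shows "list_all2 (\<lambda>i k. int i \<le> k) is (top_indices m rs)"
  using assms
proof (induction rs arbitrary: "is" m)
  case (Cons run rs)
  define k where "k = min m (int (hd run))"
  define is1 is2 where "is1 = take (length run) is" and "is2 = drop (length run) is"
  have "is": "is = is1 @ is2" and l1: "length is1 = length run" and l2: "length is2 = length (concat rs)"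
    using Cons.prems(2) by (auto simp: is1_def is2_def)
  have z: "zip is (concat (run # rs)) = zip is1 run @ zip is2 (concat rs)" using "is" l1 by simp
  have run: "run \<noteq> []" using Cons.prems(1) by (simp add: run_list_def)
  obtain i1 is1' a1 run' where h: "is1 = i1 # is1'" "run = a1 # run'" using run l1 by (cases run; cases is1) auto
  have zh: "zip is (concat (run # rs)) = (i1, a1) # zip is1' run' @ zip is2 (concat rs)" using z h by simp
  have dec1: "i \<le> i1" if i: "i \<in> set is" for i
  proof -
    obtain a where "(i, a) \<in> set (zip is (concat (run # rs)))"
      using Cons.prems(2) i by (metis in_set_impl_in_set_zip1)
    then have "(i, a) = (i1, a1) \<or> before (i1, a1) (i, a)" using Cons.prems(3) unfolding zh by (metis set_ConsD sorted_wrt.simps(2))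
    then show ?thesis by (auto simp: before_def)
  qed
  have "flagged (i1, a1)" using Cons.prems(4) unfolding zh by simp
  then have "int i1 \<le> k" using Cons.prems(5) "is" h by (simp add: k_def flagged_def)
  then have k1: "int i \<le> k" if "i \<in> set is" for i using dec1[OF that] by linarith
  have "int i \<le> k - 1" if i: "i \<in> set is2" for i
  proof -
    obtain run2 rs2 where rs: "rs = run2 # rs2" using i l2 by (cases rs) auto
    have r2: "run2 \<noteq> []" "hd run2 \<le> last run" using Cons.prems(1) rs by (auto simp: run_list_def)
    obtain b run2' where b: "run2 = b # run2'" using r2 by (cases run2) auto
    obtain i2 is2' where i2: "is2 = i2 # is2'" using i by (cases is2) auto
    have "(last is1, last run) \<in> set (zip is1 run)"
      using l1 run by (metis last_in_set last_zip length_0_conv zip_eq_Nil_iff)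
    moreover have zi: "zip is2 (concat rs) = (i2, b) # zip is2' (run2' @ concat rs2)" using i2 rs b by simp
    ultimately have "before (last is1, last run) (i2, b)"
      using Cons.prems(3) unfolding z by (auto simp: sorted_wrt_append)
    then have "i2 < last is1" using r2 b by (auto simp: before_def)
    moreover have "last is1 \<in> set is" using "is" h by simp
    ultimately have "int i2 \<le> k - 1" using k1 by fastforce
    moreover have "i \<le> i2"
    proof -
      obtain a where "(i, a) \<in> set (zip is2 (concat rs))" using i l2 by (metis in_set_impl_in_set_zip1)
      moreover have "sorted_wrt before (zip is2 (concat rs))" using Cons.prems(3) unfolding z by (simp add: sorted_wrt_append)
      ultimately have "(i, a) = (i2, b) \<or> before (i2, b) (i, a)" unfolding zi by (metis set_ConsD sorted_wrt.simps(2))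
      then show ?thesis by (auto simp: before_def)
    qed
    ultimately show ?thesis by linarith
  qed
  moreover have "run_list rs" using Cons.prems(1) by (cases rs) (auto simp: run_list_def)
  ultimately have "list_all2 (\<lambda>i k. int i \<le> k) is2 (top_indices (k - 1) rs)"
    using Cons.prems(3,4) l2 unfolding z by (intro Cons.IH) (auto simp: sorted_wrt_append)
  moreover have "list_all2 (\<lambda>i k. int i \<le> k) is1 (replicate (length run) k)"
    using k1 "is" l1 by (auto simp: list_all2_conv_all_nth)
  ultimately have "list_all2 (\<lambda>i k. int i \<le> k) (is1 @ is2) (replicate (length run) k @ top_indices (k - 1) rs)"
    using l1 by (intro list_all2_appendI) auto
  then show ?case by (simp add: "is" k_def Let_def)
qed simp

lemma sorted_top_indices:
  assumes "run_list rs" "\<forall>k\<in>set (top_indices m rs). 1 \<le> k"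
  shows "sorted_wrt before (zip (map nat (top_indices m rs)) (concat rs))"
    "\<forall>x\<in>set (zip (map nat (top_indices m rs)) (concat rs)). flagged x \<and> int (fst x) \<le> m"
proof -
  have "sorted_wrt before (zip (map nat (top_indices m rs)) (concat rs)) \<and>
    (\<forall>x\<in>set (zip (map nat (top_indices m rs)) (concat rs)). flagged x \<and> int (fst x) \<le> m)"
    using assms
  proof (induction rs arbitrary: m)
    case (Cons run rs)
    define k where "k = min m (int (hd run))"
    have eq: "top_indices m (run # rs) = replicate (length run) k @ top_indices (k - 1) rs" by (simp add: k_def Let_def)
    have z: "zip (map nat (top_indices m (run # rs))) (concat (run # rs)) =
      map (Pair (nat k)) run @ zip (map nat (top_indices (k - 1) rs)) (concat rs)"
      unfolding eq by (simp add: zip_replicate1[of "length run", simplified])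
    have run: "run \<noteq> []" "increasing run" "run_list rs" using Cons.prems(1) by (cases rs; auto simp: run_list_def)+
    have "k \<in> set (top_indices m (run # rs))" using run(1) unfolding eq by simp
    then have k1: "1 \<le> k" using Cons.prems(2) by blast
    have IH: "sorted_wrt before (zip (map nat (top_indices (k - 1) rs)) (concat rs))"
      "\<And>x. x \<in> set (zip (map nat (top_indices (k - 1) rs)) (concat rs)) \<Longrightarrow> flagged x \<and> int (fst x) \<le> k - 1"
      using Cons.IH[OF run(3), of "k - 1"] Cons.prems(2) unfolding eq by auto
    have "before (nat k, a) x" if "x \<in> set (zip (map nat (top_indices (k - 1) rs)) (concat rs))" for a x
      using IH(2)[OF that] k1 by (auto simp: before_def)
    then have "sorted_wrt before (zip (map nat (top_indices m (run # rs))) (concat (run # rs)))"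
      unfolding z using IH(1) run(2) by (auto simp: sorted_wrt_append)
    moreover have "flagged (nat k, a) \<and> int (nat k) \<le> m" if "a \<in> set run" for a
    proof -
      have "hd run \<le> a" using that run(2) by (cases run) (auto simp: less_imp_le)
      then show ?thesis using k1 by (auto simp: flagged_def k_def)
    qed
    moreover have "flagged x \<and> int (fst x) \<le> m" if "x \<in> set (zip (map nat (top_indices (k - 1) rs)) (concat rs))" for x
      using IH(2)[OF that] by (auto simp: k_def)
    ultimately show ?case unfolding z by auto
  qed simp
  then show "sorted_wrt before (zip (map nat (top_indices m rs)) (concat rs))"
    "\<forall>x\<in>set (zip (map nat (top_indices m rs)) (concat rs)). flagged x \<and> int (fst x) \<le> m" by blast+
qed

lemma sum_top_indices:
  "(\<Sum>i\<leftarrow>map nat (top_indices m rs). unit_comp i) =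
   (\<Sum>(r, run)\<leftarrow>zip (rows m rs) rs. Poly_Mapping.single (nat r) (length run))"
proof (induction rs arbitrary: m)
  case (Cons run rs)
  have "(\<Sum>i\<leftarrow>replicate l j. unit_comp i) = Poly_Mapping.single j l" for l j
    by (induction l) (simp_all flip: single_add)
  then show ?case using Cons by (simp add: Let_def)
qed simp

lemma sum_part_indices:
  assumes "\<forall>i\<in>set is. 1 \<le> i"
  shows "(\<Sum>i = 1..j. part (\<Sum>i\<leftarrow>is. unit_comp i) i) = length (filter (\<lambda>i. i \<le> j) is)"
  using assms
proof (induction "is")
  case (Cons a "is")
  have "(\<Sum>i = 1..j. part (unit_comp a) i) = (if a \<le> j then 1 else 0)"
    using Cons.prems by (simp add: lookup_single when_def)
  then show ?case using Cons by (simp add: lookup_add sum.distrib)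
qed simp

lemma length_filter_le:
  assumes "list_all2 (\<le>) is ks"
  shows "length (filter (\<lambda>i. i \<le> (j::nat)) ks) \<le> length (filter (\<lambda>i. i \<le> j) is)"
  using assms by (induction rule: list_all2_induct) auto

text \<open>The indices are chosen pointwise maximal.\<close>

lemma top_biword:
  assumes "\<not> virtual \<rho>"
  obtains b where "sorted_wrt before b" "\<forall>x\<in>set b. flagged x" "map snd b = \<rho>" "content b = the (des \<rho>)"
proof -
  define m where "m = int (Max (set \<rho>))"
  have m: "\<forall>x\<in>set \<rho>. int x \<le> m" by (simp add: m_def)
  note rr = run_rows_eq[OF m]
  have rl: "run_list (runs \<rho>)" by (rule run_list_runs)
  then have ne: "\<forall>run\<in>set (runs \<rho>). run \<noteq> []" by (simp add: run_list_def)
  have pos: "\<forall>k\<in>set (top_indices m (runs \<rho>)). 1 \<le> k"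
  proof
    fix k assume "k \<in> set (top_indices m (runs \<rho>))"
    then have k: "k \<in> set (rows m (runs \<rho>))" using set_top_indices[OF ne] by simp
    then have "runs \<rho> \<noteq> []" by auto
    then have "last (run_rows \<rho>) \<le> k" using rows_decreasing k rr by simp
    moreover have "\<rho> \<noteq> []" using \<open>runs \<rho> \<noteq> []\<close> by auto
    ultimately show "1 \<le> k" using assms by (simp add: virtual_def)
  qed
  let ?is = "map nat (top_indices m (runs \<rho>))"
  have l: "length ?is = length \<rho>" using length_top_indices[of m "runs \<rho>"] by (simp add: concat_runs)
  note s = sorted_top_indices[OF rl pos, unfolded concat_runs]
  show ?thesis
  proof (rule that)
    show "sorted_wrt before (zip ?is \<rho>)" "\<forall>x\<in>set (zip ?is \<rho>). flagged x" using s by auto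
    show "map snd (zip ?is \<rho>) = \<rho>" using l by simp
    show "content (zip ?is \<rho>) = the (des \<rho>)"
      unfolding content_zip[OF l] sum_top_indices using assms by (simp add: des_def rr)
  qed
qed

lemma biword_dominates_des:
  assumes "sorted_wrt before b" "\<forall>x\<in>set b. flagged x" "map snd b = \<rho>"
  shows "\<not> virtual \<rho>" "dominates (content b) (the (des \<rho>))"
proof -
  define m where "m = int (Max (set \<rho>))"
  have m: "\<forall>x\<in>set \<rho>. int x \<le> m" by (simp add: m_def)
  note rr = run_rows_eq[OF m]
  have rl: "run_list (runs \<rho>)" by (rule run_list_runs)
  then have ne: "\<forall>run\<in>set (runs \<rho>). run \<noteq> []" by (simp add: run_list_def)
  let ?is = "map fst b" and ?ks = "top_indices m (runs \<rho>)"
  have b: "b = zip ?is \<rho>" using assms(3) zip_map_fst_snd[of b] by simp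
  have lis: "length ?is = length \<rho>" using assms(3) by auto
  have ge1: "\<forall>i\<in>set ?is. 1 \<le> i" using assms(2) by (auto simp: flagged_def)
  have le: "list_all2 (\<lambda>i k. int i \<le> k) ?is ?ks"
  proof (rule flagged_le_top_indices[OF rl])
    show "length ?is = length (concat (runs \<rho>))" using lis by (simp add: concat_runs)
    show "sorted_wrt before (zip ?is (concat (runs \<rho>)))" "\<forall>x\<in>set (zip ?is (concat (runs \<rho>))). flagged x"
      using assms(1,2) b unfolding concat_runs by simp_all
    show "\<forall>i\<in>set ?is. int i \<le> m"
    proof
      fix i assume "i \<in> set ?is"
      then obtain x where x: "x \<in> set b" "i = fst x" by auto
      then have "snd x \<in> set \<rho>" using assms(3) by auto
      then have "int (snd x) \<le> m" using m by blast
      moreover have "fst x \<le> snd x" using assms(2) x by (simp add: flagged_def)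
      ultimately show "int i \<le> m" using x by linarith
    qed
  qed
  have pos: "1 \<le> k" if k: "k \<in> set ?ks" for k
  proof -
    obtain t where t: "t < length ?ks" "k = ?ks ! t" using k by (auto simp: in_set_conv_nth)
    then have "int (?is ! t) \<le> k" "?is ! t \<in> set ?is" using le by (auto simp: list_all2_conv_all_nth)
    then show ?thesis using ge1 by force
  qed
  show nv: "\<not> virtual \<rho>"
  proof
    assume "virtual \<rho>"
    then have v: "\<rho> \<noteq> []" "last (run_rows \<rho>) \<le> 0" by (auto simp: virtual_def)
    obtain run rs where "runs \<rho> = run # rs" using v(1) runs_nonempty by (metis list.exhaust)
    then have "run_rows \<rho> \<noteq> []" unfolding rr by (simp add: Let_def)
    then have "last (run_rows \<rho>) \<in> set ?ks" unfolding set_top_indices[OF ne] rr by simp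
    then show False using pos v(2) by force
  qed
  have "list_all2 (\<le>) ?is (map nat ?ks)"
    using le by (auto simp: list_all2_conv_all_nth le_nat_iff)
  then have f: "length (filter (\<lambda>i. i \<le> j) (map nat ?ks)) \<le> length (filter (\<lambda>i. i \<le> j) ?is)" for j
    by (rule length_filter_le)
  have d: "the (des \<rho>) = (\<Sum>i\<leftarrow>map nat ?ks. unit_comp i)"
    unfolding sum_top_indices using nv by (simp add: des_def rr)
  have c: "content b = (\<Sum>i\<leftarrow>?is. unit_comp i)" using content_zip[OF lis] b by simp
  have ge1': "\<forall>i\<in>set (map nat ?ks). 1 \<le> i" using pos by force
  show "dominates (content b) (the (des \<rho>))"
    unfolding dominates_def d c sum_part_indices[OF ge1] sum_part_indices[OF ge1'] using f by blast
qed

lemma content_part_0: "\<forall>x\<in>set b. flagged x \<Longrightarrow> part (content b) 0 = 0"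
  by (induction b) (auto simp: lookup_add lookup_single when_def flagged_def)

lemma dominates_antisym:
  assumes "dominates a b" "dominates b a" "part a 0 = 0" "part b 0 = 0"
  shows "a = b"
proof (rule poly_mapping_eqI)
  fix i
  have s: "(\<Sum>i = 1..j. part a i) = (\<Sum>i = 1..j. part b i)" for j
    using assms(1,2) by (auto simp: dominates_def intro: antisym)
  show "part a i = part b i"
  proof (cases i)
    case (Suc k)
    then show ?thesis using s[of k] s[of "Suc k"] by simp
  qed (use assms in simp)
qed

section \<open>Yamanouchi words\<close>

lemma yamanouchi_key_like:
  assumes red: "reduced_word \<rho>" and key: "key_like (genfun (biwords (ck_class \<rho>) flagged)) a"
  obtains \<tau> where "\<tau> \<in> ck_class \<rho>" "yamanouchi \<tau>"
    "\<And>\<sigma>. \<sigma> \<in> ck_class \<rho> \<Longrightarrow> yamanouchi \<sigma> \<Longrightarrow> \<sigma> = \<tau> \<and> the (des \<sigma>) = a"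
proof -
  let ?B = "biwords (ck_class \<rho>) flagged"
  have fin: "finite ?B" using ck_closed_ck_class[OF red] by (auto simp: ck_closed_def intro: finite_biwords_flagged)
  note coeff = coeff_genfun[OF fin]
  have a0: "part a 0 = 0" using key key_rel_part_0 by (auto simp: key_like_def)
  have in_ck: "ck_equiv \<sigma> \<tau>" "reduced_word \<sigma>" if "\<sigma> \<in> ck_class \<rho>" "\<tau> \<in> ck_class \<rho>" for \<sigma> \<tau>
  proof -
    have e: "ck_equiv \<rho> \<sigma>" "ck_equiv \<rho> \<tau>" using that by (simp_all add: ck_class_def)
    show "ck_equiv \<sigma> \<tau>" using ck_equiv_trans[OF ck_equiv_sym[OF e(1)] e(2)] .
    show "reduced_word \<sigma>" using ck_equiv_props(4)[OF e(1)] red by simp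
  qed
  have top: "\<exists>b\<in>?B. map snd b = \<sigma> \<and> content b = the (des \<sigma>)" if "\<sigma> \<in> ck_class \<rho>" "\<not> virtual \<sigma>" for \<sigma>
    using top_biword[OF that(2)] that(1) unfolding biwords_def by blast
  have dom: "dominates (content b) a" if "b \<in> ?B" for b
  proof -
    have "card {x \<in> ?B. content x = content b} \<noteq> 0" using fin that by auto
    then have "coeff (genfun ?B) (content b) \<noteq> 0" using coeff by simp
    then show ?thesis using key_like_sum_le[OF key] by (simp add: dominates_def)
  qed
  have "int (card {b \<in> ?B. content b = a}) = 1" using key coeff by (simp add: key_like_def)
  then obtain b0 where b0: "{b \<in> ?B. content b = a} = {b0}" by (auto simp: card_1_singleton_iff)
  define \<tau> where "\<tau> = map snd b0"
  have b0': "sorted_wrt before b0" "\<forall>x\<in>set b0. flagged x" "map snd b0 = \<tau>" "content b0 = a" "\<tau> \<in> ck_class \<rho>"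
    using b0 by (auto simp: biwords_def \<tau>_def)
  note bd = biword_dominates_des[OF b0'(1-3)]
  have des0: "part (the (des \<sigma>)) 0 = 0" if \<sigma>: "\<sigma> \<in> ck_class \<rho>" "\<not> virtual \<sigma>" for \<sigma>
  proof -
    obtain b where "b \<in> ?B" "content b = the (des \<sigma>)" using top[OF \<sigma>] by blast
    then show ?thesis using content_part_0[of b] by (simp add: biwords_def)
  qed
  have desdom: "dominates (the (des \<sigma>)) a" if "\<sigma> \<in> ck_class \<rho>" "\<not> virtual \<sigma>" for \<sigma>
    using top[OF that] dom by metis
  have des\<tau>: "the (des \<tau>) = a"
    using dominates_antisym[OF desdom[OF b0'(5) bd(1)] bd(2)[unfolded b0'(4)] des0[OF b0'(5) bd(1)] a0] .
  have "yamanouchi \<tau>"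
    unfolding yamanouchi_def des\<tau>
  proof (intro conjI allI impI)
    fix \<sigma> assume "reduced_word \<sigma> \<and> \<not> virtual \<sigma> \<and> ck_equiv \<tau> \<sigma>"
    moreover from this have "ck_equiv \<rho> \<sigma>" using b0'(5) ck_equiv_trans[of \<rho> \<tau> \<sigma>] by (simp add: ck_class_def)
    ultimately show "dominates (the (des \<sigma>)) a" using desdom by (simp add: ck_class_def)
  qed (simp_all add: in_ck(2)[OF b0'(5) b0'(5)] bd(1))
  moreover have "\<sigma> = \<tau> \<and> the (des \<sigma>) = a" if \<sigma>: "\<sigma> \<in> ck_class \<rho>" "yamanouchi \<sigma>" for \<sigma>
  proof -
    have nv: "\<not> virtual \<sigma>" using \<sigma>(2) by (simp add: yamanouchi_def)
    have "dominates (the (des \<tau>)) (the (des \<sigma>))"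
      using \<sigma>(2) in_ck[OF \<sigma>(1) b0'(5)] in_ck[OF b0'(5) \<sigma>(1)] bd(1) unfolding yamanouchi_def by blast
    then have d: "the (des \<sigma>) = a"
      using dominates_antisym[OF desdom[OF \<sigma>(1) nv]] des0[OF \<sigma>(1) nv] a0 des\<tau> by simp
    obtain b where b: "b \<in> ?B" "map snd b = \<sigma>" "content b = the (des \<sigma>)" using top[OF \<sigma>(1) nv] by blast
    then have "b \<in> {b \<in> ?B. content b = a}" using d by simp
    then have "b = b0" unfolding b0 by simp
    then show ?thesis using b d \<tau>_def by simp
  qed
  ultimately show ?thesis using that b0'(5) by blast
qed

theorem theorem4p14:
  fixes n :: nat and w :: "nat \<Rightarrow> nat"
  assumes "w permutes {1..n}"
  shows "schubert n w = (\<Sum>\<rho> \<in> YR w. key_poly (the (des \<rho>)))"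
proof -
  let ?B = "\<lambda>\<rho>. biwords (ck_class \<rho>) flagged"
  have fin: "finite (reduced_words w)" using finite_reduced_words[OF assms] .
  have red: "reduced_word \<rho>" "word_perm \<rho> = w" if "\<rho> \<in> reduced_words w" for \<rho>
    using that by (auto simp: reduced_words_iff)
  have finB: "finite (?B \<rho>)" if "\<rho> \<in> reduced_words w" for \<rho>
    using ck_closed_ck_class[OF red(1)[OF that]] by (auto simp: ck_closed_def intro: finite_biwords_flagged)
  have key: "\<exists>a. key_like (genfun (?B \<rho>)) a" if \<rho>: "\<rho> \<in> reduced_words w" and b: "b \<in> ?B \<rho>" for \<rho> b
  proof -
    have "card {x \<in> ?B \<rho>. content x = content b} \<noteq> 0" using finB[OF \<rho>] b by auto
    then have "coeff (genfun (?B \<rho>)) (content b) \<noteq> 0" using coeff_genfun[OF finB[OF \<rho>]] by simp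
    then have "genfun (?B \<rho>) \<noteq> 0" by auto
    then show ?thesis using ck_class_key_like[OF red(1)[OF \<rho>]] by blast
  qed
  have YR: "\<rho> \<in> reduced_words w" "yamanouchi \<rho>" if "\<rho> \<in> YR w" for \<rho> using that by (auto simp: YR_def)
  have self: "\<rho> \<in> ck_class \<rho>" for \<rho> by (simp add: ck_class_def)
  have classes: "\<sigma> \<in> reduced_words w" if "\<rho> \<in> reduced_words w" "\<sigma> \<in> ck_class \<rho>" for \<rho> \<sigma>
    using that ck_equiv_props by (auto simp: ck_class_def reduced_words_iff)
  have keyY: "\<exists>a. key_like (genfun (?B \<rho>)) a" if Y: "\<rho> \<in> YR w" for \<rho>
  proof -
    have "\<not> virtual \<rho>" using YR(2)[OF Y] by (simp add: yamanouchi_def)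
    then obtain b where "sorted_wrt before b" "\<forall>x\<in>set b. flagged x" "map snd b = \<rho>" using top_biword by metis
    then have "b \<in> ?B \<rho>" using self by (simp add: biwords_def)
    then show ?thesis using key YR(1)[OF Y] by blast
  qed
  have unique: "\<rho> = \<sigma>" if Y: "\<rho> \<in> YR w" "\<sigma> \<in> YR w" "ck_equiv \<rho> \<sigma>" for \<rho> \<sigma>
  proof -
    obtain a where "key_like (genfun (?B \<rho>)) a" using keyY[OF Y(1)] by blast
    then obtain \<tau> where \<tau>: "\<And>\<sigma>. \<sigma> \<in> ck_class \<rho> \<Longrightarrow> yamanouchi \<sigma> \<Longrightarrow> \<sigma> = \<tau> \<and> the (des \<sigma>) = a"
      using yamanouchi_key_like[OF red(1)[OF YR(1)[OF Y(1)]]] by metis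
    have "\<rho> = \<tau>" using \<tau>[OF self YR(2)[OF Y(1)]] by blast
    moreover have "\<sigma> = \<tau>" using \<tau>[OF _ YR(2)[OF Y(2)]] Y(3) by (simp add: ck_class_def)
    ultimately show ?thesis by simp
  qed
  have summand: "genfun (?B \<rho>) = key_poly (the (des \<rho>))" if Y: "\<rho> \<in> YR w" for \<rho>
  proof -
    obtain a where a: "key_like (genfun (?B \<rho>)) a" using keyY[OF Y] by blast
    obtain \<tau> where "\<And>\<sigma>. \<sigma> \<in> ck_class \<rho> \<Longrightarrow> yamanouchi \<sigma> \<Longrightarrow> \<sigma> = \<tau> \<and> the (des \<sigma>) = a"
      using yamanouchi_key_like[OF red(1)[OF YR(1)[OF Y]] a] by metis
    then have "the (des \<rho>) = a" using self YR(2)[OF Y] by blast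
    moreover have "key_poly a = genfun (?B \<rho>)" using a by (intro key_poly_eqI) (simp add: key_like_def)
    ultimately show ?thesis by simp
  qed
  have union: "biwords (reduced_words w) flagged = (\<Union>\<rho>\<in>YR w. ?B \<rho>)"
  proof (intro equalityI subsetI)
    fix b assume b: "b \<in> biwords (reduced_words w) flagged"
    define \<sigma> where "\<sigma> = map snd b"
    have \<sigma>: "\<sigma> \<in> reduced_words w" "b \<in> ?B \<sigma>" using b self by (auto simp: biwords_def \<sigma>_def)
    obtain a where "key_like (genfun (?B \<sigma>)) a" using key[OF \<sigma>] by blast
    then obtain \<tau> where \<tau>: "\<tau> \<in> ck_class \<sigma>" "yamanouchi \<tau>" using yamanouchi_key_like[OF red(1)[OF \<sigma>(1)]] by metis
    have "ck_class \<sigma> = ck_class \<tau>" using \<tau>(1) by (intro ck_class_eq) (simp add: ck_class_def)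
    then have "b \<in> ?B \<tau>" using \<sigma>(2) by simp
    moreover have "\<tau> \<in> YR w" using \<tau> classes[OF \<sigma>(1)] by (simp add: YR_def)
    ultimately show "b \<in> (\<Union>\<rho>\<in>YR w. ?B \<rho>)" by blast
  next
    fix b assume "b \<in> (\<Union>\<rho>\<in>YR w. ?B \<rho>)"
    then show "b \<in> biwords (reduced_words w) flagged" using classes YR(1) by (auto simp: biwords_def)
  qed
  have disjoint: "?B \<rho> \<inter> ?B \<sigma> = {}" if "\<rho> \<in> YR w" "\<sigma> \<in> YR w" "\<rho> \<noteq> \<sigma>" for \<rho> \<sigma>
  proof (rule ccontr)
    assume "?B \<rho> \<inter> ?B \<sigma> \<noteq> {}"
    then obtain b where "b \<in> ?B \<rho>" "b \<in> ?B \<sigma>" by blast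
    then have "ck_equiv \<rho> (map snd b)" "ck_equiv \<sigma> (map snd b)" by (simp_all add: biwords_def ck_class_def)
    then have "ck_equiv \<rho> \<sigma>" using ck_equiv_sym ck_equiv_trans by blast
    then show False using unique that by blast
  qed
  have "finite (YR w)" using fin by (rule finite_subset[rotated]) (auto simp: YR_def)
  then have "genfun (biwords (reduced_words w) flagged) = (\<Sum>\<rho>\<in>YR w. genfun (?B \<rho>))"
    unfolding union unfolding genfun_def
    using finB YR(1) disjoint by (intro sum.UNION_disjoint) auto
  also have "\<dots> = (\<Sum>\<rho>\<in>YR w. key_poly (the (des \<rho>)))"
    using summand by (rule sum.cong[OF refl])
  finally show ?thesis using schubert_eq_genfun[OF assms] by simp
qed

end
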